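(* Let $K\subset\mathbb{R}^2$ be a closed (compact), strictly convex domain enclosed by a smooth closed curve $\gamma$ with positive curvature $\kappa>0$, and let $S(K)$ be its Steiner disk. For real parameters $(\alpha,\delta,\mu,\sigma,\eta,\lambda,\xi,\zeta)$ put $$W:=\alpha\int_0^{2\pi}\rho(\theta)^2\,d\theta+\delta L^2+\mu A+\sigma|\tilde A|+\eta\int_0^{2\pi}\rho_\beta(\theta)^2\,d\theta+\lambda(\rho_e-\rho_i)^2+\xi(\rho_M-\rho_m)^2+\zeta\oint_\gamma\kappa^2\,ds ,$$ $$E:=6\pi\alpha-\pi\mu+4\pi\sigma+24\pi\eta+4\lambda+4\xi-12\pi\zeta,\qquad C:=\max\left\{1,\ \frac{3}{2E}\right\}.$$ (i) If the parameters satisfy $$\eta,\xi,\zeta\ge 0,\qquad \lambda\le 0,\qquad 2\alpha+4\pi\delta+\mu-4\zeta\ge 0,\qquad 2\alpha+\sigma-2\eta-4\zeta\ge 0,\qquad E>0,$$ then $$\Big(\max_{\theta\in[0,2\pi]}|p_K(\theta)-p_{S(K)}(\theta)|\Big)^2\le C\,W .$$ (ii) Equality holds in this inequality if $K$ is a disk and the parameters satisfy $2\alpha+4\pi\delta+\mu=0$ and $\zeta=0$ (with $E\neq 0$, so that $C$ is defined).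
   Context: Let $\theta$ be the angle between the $x$-axis and the outward normal vector of $\gamma$. The support function of a compact convex set $K$ is $p_K(\theta)=\max_{x\in K}\langle x,(\cos\theta,\sin\theta)\rangle$; here it is $2\pi$-periodic and smooth, and $\gamma$ is parametrized by $\gamma(\theta)=(p_K\cos\theta-p_K'\sin\theta,\ p_K\sin\theta+p_K'\cos\theta)$. Notation: - $\kappa=1/(p_K+p_K'')$ is the curvature of $\gamma$, and $\rho(\theta)=1/\kappa(\theta)=p_K(\theta)+p_K''(\theta)$ is its curvature radius; $\rho_M,\rho_m$ are the maximum and minimum of $\rho$ over $[0,2\pi]$. - $L=\int_0^{2\pi}\rho\,d\theta$ is the length of $\gamma$, $A=\frac12\int_0^{2\pi}(p_K^2-p_K'^2)\,d\theta$ is the area of $K$, and $ds=\rho\,d\theta$ is arclength on $\gamma$. - $\beta$ is the locus of curvature centers of $\gamma$: $\beta(\theta)=\gamma(\theta)-\rho(\theta)(\cos\theta,\sin\theta)$. $\tilde A=\frac12\oint_\beta(\beta_1\,d\beta_2-\beta_2\,d\beta_1)=\frac12\int_0^{2\pi}(p_K'^2-p_K''^2)\,d\theta$ is the oriented area enclosed by $\beta$, and $\rho_\beta(\theta)=|p_K'(\theta)+p_K'''(\theta)|$ is the curvature radius of $\beta$. - $\rho_e$ and $\rho_i$ are the circumradius of $\gamma$ (radius of the smallest disk containing $K$) and the inradius (radius of the largest disk contained in $K$). - The Steiner point of $K$ is $\frac1\pi\int_0^{2\pi}p_K(\theta)(\cos\theta,\sin\theta)\,d\theta\in\mathbb{R}^2$.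 The Steiner disk $S(K)$ is the disk centered at the Steiner point with radius $L/(2\pi)$, and $p_{S(K)}$ is its support function. *)

theory Defs
  imports "HOL-Analysis.Analysis"
begin

definition velocity :: "(real \<Rightarrow> 'a::real_normed_vector) \<Rightarrow> real \<Rightarrow> 'a" where
  "velocity c t = vector_derivative c (at t)"

definition smooth :: "(real \<Rightarrow> 'a::real_normed_vector) \<Rightarrow> bool" where
  "smooth c \<longleftrightarrow> (\<forall>n t. ((velocity ^^ n) c) differentiable (at t))"

definition smooth_closed_curve :: "(real \<Rightarrow> real^2) \<Rightarrow> real \<Rightarrow> bool" where
  "smooth_closed_curve c T \<longleftrightarrow>
     T > 0 \<and> smooth c \<and> (\<forall>t. c (t + T) = c t) \<and> inj_on c {0..<T} \<and> (\<forall>t. velocity c t \<noteq> 0)"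

text \<open>Signed curvature; for the boundary of a convex set it is nonnegative exactly when the
  parametrization is counterclockwise.\<close>

definition curve_curvature :: "(real \<Rightarrow> real^2) \<Rightarrow> real \<Rightarrow> real" where
  "curve_curvature c t =
     (let v = velocity c t; a = velocity (velocity c) t
      in (v$1 * a$2 - v$2 * a$1) / norm v ^ 3)"

definition strictly_convex :: "(real^2) set \<Rightarrow> bool" where
  "strictly_convex K \<longleftrightarrow>
     (\<forall>x\<in>K. \<forall>y\<in>K. x \<noteq> y \<longrightarrow> open_segment x y \<subseteq> interior K)"

definition unit_vec :: "real \<Rightarrow> real^2" where
  "unit_vec \<theta> = vector [cos \<theta>, sin \<theta>]"

text \<open>For nonempty compact \<open>K\<close> the supremum is attained, so it is the maximum. The same
  applies to the suprema and infima of continuous functions over \<open>[0, 2 pi]\<close> below.\<close>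

definition support_fun :: "(real^2) set \<Rightarrow> real \<Rightarrow> real" where
  "support_fun K \<theta> = (SUP x\<in>K. x \<bullet> unit_vec \<theta>)"

abbreviation support_deriv :: "nat \<Rightarrow> (real^2) set \<Rightarrow> real \<Rightarrow> real" where
  "support_deriv n K \<equiv> (deriv ^^ n) (support_fun K)"

text \<open>From here on the boundary is parametrized by the angle \<open>\<theta>\<close> of its outward normal, and
  curvature, length and area are given by the classical formulas in terms of the support function.
  These are meaningful when the support function is smooth, as it is for a domain bounded by a
  smooth curve of positive curvature.\<close>

definition boundary_curve :: "(real^2) set \<Rightarrow> real \<Rightarrow> real^2" where
  "boundary_curve K \<theta> = vector
     [support_fun K \<theta> * cos \<theta> - support_deriv 1 K \<theta> * sin \<theta>,
      support_fun K \<theta> * sin \<theta> + support_deriv 1 K \<theta> * cos \<theta>]"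

definition radius_of_curvature :: "(real^2) set \<Rightarrow> real \<Rightarrow> real" where
  "radius_of_curvature K \<theta> = support_fun K \<theta> + support_deriv 2 K \<theta>"

definition curvature :: "(real^2) set \<Rightarrow> real \<Rightarrow> real" where
  "curvature K \<theta> = 1 / radius_of_curvature K \<theta>"

definition max_radius_of_curvature :: "(real^2) set \<Rightarrow> real" where
  "max_radius_of_curvature K = (SUP \<theta>\<in>{0..2*pi}. radius_of_curvature K \<theta>)"

definition min_radius_of_curvature :: "(real^2) set \<Rightarrow> real" where
  "min_radius_of_curvature K = (INF \<theta>\<in>{0..2*pi}. radius_of_curvature K \<theta>)"

definition boundary_length :: "(real^2) set \<Rightarrow> real" where
  "boundary_length K = integral {0..2*pi} (radius_of_curvature K)"

definition area :: "(real^2) set \<Rightarrow> real" where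
  "area K = 1/2 * integral {0..2*pi} (\<lambda>\<theta>. (support_fun K \<theta>)\<^sup>2 - (support_deriv 1 K \<theta>)\<^sup>2)"

text \<open>The integral of the squared curvature with respect to arclength
  \<open>ds = radius_of_curvature K \<theta> d\<theta>\<close>.\<close>

definition curvature_energy :: "(real^2) set \<Rightarrow> real" where
  "curvature_energy K =
     integral {0..2*pi} (\<lambda>\<theta>. (curvature K \<theta>)\<^sup>2 * radius_of_curvature K \<theta>)"

definition evolute :: "(real^2) set \<Rightarrow> real \<Rightarrow> real^2" where
  "evolute K \<theta> = boundary_curve K \<theta> - radius_of_curvature K \<theta> *\<^sub>R unit_vec \<theta>"

text \<open>The oriented area as a line integral along the locus of curvature centers.\<close>

definition evolute_area :: "(real^2) set \<Rightarrow> real" where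
  "evolute_area K = 1/2 * integral {0..2*pi}
     (\<lambda>\<theta>. evolute K \<theta> $ 1 * deriv (\<lambda>t. evolute K t $ 2) \<theta>
        - evolute K \<theta> $ 2 * deriv (\<lambda>t. evolute K t $ 1) \<theta>)"

definition evolute_radius_of_curvature :: "(real^2) set \<Rightarrow> real \<Rightarrow> real" where
  "evolute_radius_of_curvature K \<theta> = \<bar>support_deriv 1 K \<theta> + support_deriv 3 K \<theta>\<bar>"

definition circumradius :: "(real^2) set \<Rightarrow> real" where
  "circumradius K = Inf {r. r \<ge> 0 \<and> (\<exists>x. K \<subseteq> cball x r)}"

definition inradius :: "(real^2) set \<Rightarrow> real" where
  "inradius K = Sup {r. r \<ge> 0 \<and> (\<exists>x. cball x r \<subseteq> K)}"

definition steiner_point :: "(real^2) set \<Rightarrow> real^2" where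
  "steiner_point K = (1/pi) *\<^sub>R integral {0..2*pi} (\<lambda>\<theta>. support_fun K \<theta> *\<^sub>R unit_vec \<theta>)"

definition steiner_disk :: "(real^2) set \<Rightarrow> (real^2) set" where
  "steiner_disk K = cball (steiner_point K) (boundary_length K / (2*pi))"

definition steiner_deviation :: "(real^2) set \<Rightarrow> real" where
  "steiner_deviation K =
     (SUP \<theta>\<in>{0..2*pi}. \<bar>support_fun K \<theta> - support_fun (steiner_disk K) \<theta>\<bar>)"

definition W :: "(real^2) set \<Rightarrow> real \<Rightarrow> real \<Rightarrow> real \<Rightarrow> real \<Rightarrow> real \<Rightarrow> real \<Rightarrow> real \<Rightarrow> real \<Rightarrow> real" where
  "W K \<alpha> \<delta> \<mu> \<sigma> \<eta> lam \<xi> \<zeta> =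
     \<alpha> * integral {0..2*pi} (\<lambda>\<theta>. (radius_of_curvature K \<theta>)\<^sup>2)
     + \<delta> * (boundary_length K)\<^sup>2
     + \<mu> * area K
     + \<sigma> * \<bar>evolute_area K\<bar>
     + \<eta> * integral {0..2*pi} (\<lambda>\<theta>. (evolute_radius_of_curvature K \<theta>)\<^sup>2)
     + lam * (circumradius K - inradius K)\<^sup>2
     + \<xi> * (max_radius_of_curvature K - min_radius_of_curvature K)\<^sup>2
     + \<zeta> * curvature_energy K"

definition E_const :: "real \<Rightarrow> real \<Rightarrow> real \<Rightarrow> real \<Rightarrow> real \<Rightarrow> real \<Rightarrow> real \<Rightarrow> real" where
  "E_const \<alpha> \<mu> \<sigma> \<eta> lam \<xi> \<zeta> =
     6*pi*\<alpha> - pi*\<mu> + 4*pi*\<sigma> + 24*pi*\<eta> + 4*lam + 4*\<xi> - 12*pi*\<zeta>"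

definition C_const :: "real \<Rightarrow> real \<Rightarrow> real \<Rightarrow> real \<Rightarrow> real \<Rightarrow> real \<Rightarrow> real \<Rightarrow> real" where
  "C_const \<alpha> \<mu> \<sigma> \<eta> lam \<xi> \<zeta> = max 1 (3 / (2 * E_const \<alpha> \<mu> \<sigma> \<eta> lam \<xi> \<zeta>))"

end

theory Submission
  imports Defs
begin

text \<open>
  Write \<open>p\<close> for the support function of \<open>K\<close>, \<open>a = L / (2 \<pi>)\<close>, and let \<open>dev\<close> be \<open>p\<close> minus the support
  function of the Steiner disk. The support function of a disk is a constant plus a first harmonic,
  and the Steiner disk is the one for which \<open>dev\<close> has no frequencies below 2. Let \<open>z\<^sub>n\<close> be the
  Fourier coefficients of \<open>dev\<close> and put
  \<open>S = \<Sum> (n\<^sup>2 - 1) |z\<^sub>n|\<^sup>2\<close>, \<open>R = \<Sum> (n\<^sup>2 - 1)\<^sup>2 |z\<^sub>n|\<^sup>2\<close>, \<open>V = \<Sum> n\<^sup>2 (n\<^sup>2 - 1)\<^sup>2 |z\<^sub>n|\<^sup>2\<close>.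
  Parseval's identity expresses the quadratic integrals in \<open>W\<close> by \<open>a\<^sup>2\<close> and these sums:
  \<open>\<integral>\<rho>\<^sup>2 = 2 \<pi> a\<^sup>2 + \<pi> R\<close>, \<open>A = \<pi> a\<^sup>2 - \<pi> S / 2\<close>, the evolute has area \<open>- \<pi> (R + S) / 2\<close>, and
  \<open>\<integral>\<rho>\<^sub>\<beta>\<^sup>2 = \<pi> V\<close>. Since \<open>n\<^sup>2 \<ge> 4\<close> for all frequencies that occur, \<open>R \<ge> 3 S\<close> and \<open>V \<ge> 4 R\<close>.

  The other quantities are compared with \<open>S\<close>. From \<open>\<Sum> 1 / (n\<^sup>2 - 1) = 3/4\<close> and the Cauchy-Schwarz
  inequality, \<open>max |dev|\<^sup>2 \<le> 3 S / 4\<close>. The function \<open>\<rho> - a\<close> has mean zero, so its mean square is at most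
  a quarter of its squared oscillation: \<open>(\<rho>\<^sub>M - \<rho>\<^sub>m)\<^sup>2 \<ge> 2 R\<close>. Finally
  \<open>(\<rho>\<^sub>e - \<rho>\<^sub>i)\<^sup>2 \<le> 2 S\<close>, which is Bonnesen's inequality \<open>L\<^sup>2 - 4 \<pi> A \<ge> \<pi>\<^sup>2 (\<rho>\<^sub>e - \<rho>\<^sub>i)\<^sup>2\<close>.
  With \<open>\<alpha> - 2 \<zeta>\<close> in the place of \<open>\<alpha>\<close> (the bending energy and \<open>\<integral>\<rho>\<^sup>2\<close> are nonnegative), the sign
  conditions make \<open>W - (E/2) S\<close> a sum of nonnegative terms, and
  \<open>max |dev|\<^sup>2 \<le> 3 S / 4 = (3 / (2 E)) (E/2) S \<le> C W\<close> (lemma \<open>deviation_le_W\<close>). For a disk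
  \<open>dev = 0\<close>, all three sums vanish, and \<open>W = \<pi> a\<^sup>2 (2 \<alpha> + 4 \<pi> \<delta> + \<mu>) = 0\<close>.

  Bonnesen's inequality is obtained from a duality. Separating points from the convex hull of the
  curve \<open>\<theta> \<mapsto> (u(\<theta>), p(\<theta>))\<close> in \<open>\<real>\<^sup>2 \<times> \<real>\<close>, with \<open>u(\<theta>)\<close> the unit normal, shows that \<open>\<rho>\<^sub>e\<close> is at most, and
  \<open>\<rho>\<^sub>i\<close> at least, a mean of values of \<open>p\<close> over directions whose weighted sum is zero
  (\<open>radii_as_balanced_means\<close>). The difference of two such means only sees \<open>dev\<close>, and by
  Cauchy-Schwarz its square is at most \<open>S\<close> times the energy of a signed measure with respect to the
  kernel \<open>\<Sum> cos (n t) / (n\<^sup>2 - 1)\<close>. This kernel has the closed form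
  \<open>1/2 + (cos t) / 4 - ((\<pi> - t) sin t) / 2\<close> on \<open>[0, 2 \<pi>]\<close>; on balanced
  measures the first term contributes 1/2 and the second 0, and \<open>0 \<le> (\<pi> - t) sin t \<le> 2\<close> bounds the
  energy by 2 (\<open>green_energy_bound\<close>).

  That \<open>p\<close> is smooth with \<open>p + p'' > 0\<close> follows from the curve: its normal angle has a
  positive derivative, its inverse reparametrizes the curve by \<open>\<theta>\<close>, and every point of the curve is
  the support point in the direction of its own normal (\<open>support_fun_smooth\<close>).
\<close>

section \<open>Completeness of the trigonometric system\<close>

text \<open>The normalization is such that a function with mean zero is the real part of the one-sided series
  \<open>\<Sum> z\<^sub>n cis (n t)\<close>. The constant term would need the weight 1/2, which is why the expansions below
  are stated for functions whose coefficient at 0 vanishes.\<close>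

definition fourier_coeff :: "(real \<Rightarrow> real) \<Rightarrow> nat \<Rightarrow> complex" where
  "fourier_coeff f n = (1/pi) *\<^sub>R integral {0..2*pi} (\<lambda>t. complex_of_real (f t) * cis (-(real n * t)))"

lemma has_vector_derivative_cis_mult:
  "((\<lambda>t. cis (a * t)) has_vector_derivative of_real a * (\<i> * cis (a * t))) (at t within S)" for a :: real
proof -
  have "((\<lambda>t. cis (a * t)) has_derivative (\<lambda>h. (h * a) *\<^sub>R (\<i> * cis (a * t)))) (at t within S)"
    by (rule has_derivative_cis) (auto intro!: derivative_eq_intros)
  then show ?thesis by (simp add: has_vector_derivative_def scaleR_conv_of_real mult_ac)
qed

lemma has_vector_derivative_cis_primitive:
  assumes "a \<noteq> (0::int)"
  shows "((\<lambda>t. cis (of_int a * t) / (\<i> * of_int a)) has_vector_derivative cis (of_int a * t)) (at t within S)"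
  using has_vector_derivative_divide[OF has_vector_derivative_cis_mult[of "of_int a" t S], of "\<i> * of_int a"] assms
  by simp

lemma has_integral_cis_int:
  assumes "a \<noteq> (0::int)"
  shows "((\<lambda>t. cis (of_int a * t)) has_integral 0) {0..2*pi}"
proof -
  have "((\<lambda>t. cis (of_int a * t)) has_integral
      (cis (of_int a * (2*pi)) / (\<i> * of_int a) - cis (of_int a * 0) / (\<i> * of_int a))) {0..2*pi}"
    by (intro fundamental_theorem_of_calculus has_vector_derivative_cis_primitive assms) simp
  moreover have "cis (of_int a * (2*pi)) = 1"
    by (metis cis_multiple_2pi Ints_of_int mult.commute)
  ultimately show ?thesis by simp
qed

lemma integral_cis_int:
  "integral {0..2*pi} (\<lambda>t. cis (of_int a * t)) = (if a = 0 then complex_of_real (2*pi) else 0)"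
  using has_integral_cis_int[of a] by (auto simp: integral_unique scaleR_conv_of_real)

lemma fourier_coeff_harmonic:
  assumes "k \<ge> 1"
  shows "fourier_coeff (\<lambda>t. Re (z * cis (real k * t))) n = (if n = k then z else 0)"
proof -
  have eq: "complex_of_real (Re (z * cis (real k * t))) * cis (-(real n * t))
     = (z/2) * cis (of_int (int k - int n) * t) + (cnj z/2) * cis (of_int (-(int k) - int n) * t)" for t
  proof -
    have "complex_of_real (Re (z * cis (real k * t))) = (z * cis (real k * t) + cnj (z * cis (real k * t))) / 2"
      using complex_add_cnj[of "z * cis (real k * t)"] by simp
    also have "\<dots> * cis (-(real n * t)) = (z/2) * (cis (real k * t) * cis (-(real n * t))) + (cnj z/2) * (cis (-(real k * t)) * cis (-(real n * t)))"
      by (simp add: algebra_simps cis_cnj)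
    finally show ?thesis by (simp add: cis_mult algebra_simps)
  qed
  have i: "(\<lambda>t. c * cis (of_int a * t)) integrable_on {0..2*pi}" for a and c :: complex
    by (intro integrable_continuous_interval continuous_intros)
  show ?thesis
    unfolding fourier_coeff_def eq
    unfolding integral_add[OF i i] integral_mult_right integral_cis_int
    using assms by (auto simp: scaleR_conv_of_real)
qed

text \<open>Orthogonality of \<open>f \<psi>\<close> to all characters. Keeping the factor \<open>\<psi>\<close> free makes this notion stable
  under multiplication by trigonometric polynomials.\<close>

definition annihilates :: "(real \<Rightarrow> real) \<Rightarrow> (real \<Rightarrow> real) \<Rightarrow> bool" where
  "annihilates f \<psi> \<longleftrightarrow> continuous_on {0..2*pi} \<psi> \<and>
     (\<forall>n::int. integral {0..2*pi} (\<lambda>t. complex_of_real (f t * \<psi> t) * cis (of_int n * t)) = 0)"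

lemma annihilates_add:
  assumes f: "continuous_on {0..2*pi} f" and "annihilates f \<phi>" "annihilates f \<psi>"
  shows "annihilates f (\<lambda>t. \<phi> t + \<psi> t)"
proof -
  have "complex_of_real (f t * (\<phi> t + \<psi> t)) * cis (of_int n * t)
     = complex_of_real (f t * \<phi> t) * cis (of_int n * t) + complex_of_real (f t * \<psi> t) * cis (of_int n * t)" for n :: int and t
    by (simp add: algebra_simps)
  moreover have "(\<lambda>t. complex_of_real (f t * \<phi> t) * cis (of_int n * t)) integrable_on {0..2*pi}"
    "(\<lambda>t. complex_of_real (f t * \<psi> t) * cis (of_int n * t)) integrable_on {0..2*pi}" for n :: int
    using assms unfolding annihilates_def
    by (auto intro!: integrable_continuous_interval continuous_intros)
  ultimately show ?thesis using assms(2,3) unfolding annihilates_def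
    by (auto simp: integral_add intro!: continuous_intros)
qed

text \<open>A linear function on the circle is a combination of \<open>cis t\<close> and \<open>cis (- t)\<close>, so multiplying by it only
  shifts characters. A product of polynomials is handled by multiplying twice, since \<open>\<psi>\<close> is arbitrary.\<close>

lemma annihilates_polynomial_mult:
  assumes f: "continuous_on {0..2*pi} f" and g: "real_polynomial_function g" and "annihilates f \<psi>"
  shows "annihilates f (\<lambda>t. g (cis t) * \<psi> t)"
  using g assms(3)
proof (induction g arbitrary: \<psi> rule: real_polynomial_function.induct)
  case (linear g)
  note ann = linear(2)
  have c: "continuous_on {0..2*pi} \<psi>" using ann by (simp add: annihilates_def)
  interpret bounded_linear g by fact
  have g: "g (cis t) = cos t * g 1 + sin t * g \<i>" for t
  proof -
    have "cis t = cos t *\<^sub>R 1 + sin t *\<^sub>R \<i>" by (simp add: complex_eq_iff)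
    then show ?thesis by (simp only: add scale) simp
  qed
  \<comment> \<open>On the circle \<open>g (cis t) = w cis t + cnj w cis (- t)\<close>.\<close>
  define w where "w = Complex (g 1 / 2) (- g \<i> / 2)"
  have "complex_of_real (f t * (g (cis t) * \<psi> t)) * cis (of_int n * t) =
     w * (complex_of_real (f t * \<psi> t) * cis (of_int (n+1) * t)) +
     cnj w * (complex_of_real (f t * \<psi> t) * cis (of_int (n-1) * t))" for n t
  proof -
    have "complex_of_real (g (cis t)) = w * cis t + cnj w * cis (-t)"
      by (simp add: g w_def complex_eq_iff algebra_simps)
    moreover have "cis (of_int (n+1) * t) = cis t * cis (of_int n * t)" "cis (of_int (n-1) * t) = cis (-t) * cis (of_int n * t)"
      by (simp_all add: cis_mult algebra_simps)
    ultimately show ?thesis by (simp add: algebra_simps)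
  qed
  moreover have "(\<lambda>t. w * (complex_of_real (f t * \<psi> t) * cis (of_int n * t))) integrable_on {0..2*pi}" for w and n :: int
    using f c by (auto intro!: integrable_continuous_interval continuous_intros)
  ultimately have "integral {0..2*pi} (\<lambda>t. complex_of_real (f t * (g (cis t) * \<psi> t)) * cis (of_int n * t)) =
      w * integral {0..2*pi} (\<lambda>t. complex_of_real (f t * \<psi> t) * cis (of_int (n+1) * t)) +
      cnj w * integral {0..2*pi} (\<lambda>t. complex_of_real (f t * \<psi> t) * cis (of_int (n-1) * t))" for n
    by (simp only: integral_add integral_mult_right)
  moreover have "integral {0..2*pi} (\<lambda>t. complex_of_real (f t * \<psi> t) * cis (of_int n * t)) = 0" for n
    using ann unfolding annihilates_def by blast
  ultimately have "integral {0..2*pi} (\<lambda>t. complex_of_real (f t * (g (cis t) * \<psi> t)) * cis (of_int n * t)) = 0" for n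
    by (simp only:) simp
  then show ?case using c unfolding annihilates_def
    by (auto intro!: continuous_intros continuous_on)
next
  case (const c)
  then show ?case unfolding annihilates_def
    by (auto simp: mult.assoc mult.left_commute[of _ "complex_of_real c"] integral_mult_right intro!: continuous_intros)
next
  case (add g h)
  have "annihilates f (\<lambda>t. g (cis t) * \<psi> t + h (cis t) * \<psi> t)"
    by (intro annihilates_add f add)
  then show ?case by (simp add: algebra_simps)
next
  case (mult g h)
  have "annihilates f (\<lambda>t. g (cis t) * (h (cis t) * \<psi> t))"
    by (intro mult)
  then show ?case by (simp add: algebra_simps)
qed

text \<open>The argument function jumps at 1, so continuity cannot be composed. Instead, the preimage of a
  closed set is the image under \<open>cis\<close> of a compact set of parameters.\<close>

lemma continuous_on_circle_factor:
  fixes f :: "real \<Rightarrow> real"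
  assumes f: "continuous_on {0..2*pi} f" and per: "f 0 = f (2*pi)"
  obtains F where "continuous_on (sphere 0 1) F" "\<And>t. t \<in> {0..2*pi} \<Longrightarrow> F (cis t) = f t"
proof -
  define F where "F z = f (Arg2pi z)" for z
  have F: "F (cis t) = f t" if "t \<in> {0..2*pi}" for t
  proof (cases "t = 2*pi")
    case True
    moreover have "Arg2pi 1 = 0" by (intro Arg2pi_unique[of 1]) auto
    ultimately show ?thesis using per by (simp add: F_def)
  next
    case False
    then have "Arg2pi (cis t) = t" using that by (intro Arg2pi_unique[of 1]) (auto simp: cis_conv_exp)
    then show ?thesis by (simp add: F_def)
  qed
  have "continuous_on (sphere 0 1) F"
    unfolding continuous_on_closed_vimage[OF closed_sphere]
  proof (intro allI impI)
    fix B :: "real set" assume B: "closed B"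
    have "F -` B \<inter> sphere 0 1 = cis ` ({0..2*pi} \<inter> f -` B)"
    proof (intro equalityI subsetI)
      fix z assume z: "z \<in> F -` B \<inter> sphere 0 1"
      then have "z = cis (Arg2pi z)" using Arg2pi_eq[of z] by (auto simp: cis_conv_exp)
      moreover have "Arg2pi z \<in> {0..2*pi} \<inter> f -` B" using z Arg2pi[of z] by (auto simp: F_def)
      ultimately show "z \<in> cis ` ({0..2*pi} \<inter> f -` B)" by blast
    qed (use F in auto)
    moreover have "closed ({0..2*pi} \<inter> f -` B)"
      using f B by (simp add: continuous_on_closed_vimage Int_commute)
    then have "compact ({0..2*pi} \<inter> f -` B)"
      by (metis bounded_closed_interval bounded_Int compact_eq_bounded_closed)
    then have "compact (cis ` ({0..2*pi} \<inter> f -` B))"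
      by (intro compact_continuous_image continuous_intros)
    ultimately show "closed (F -` B \<inter> sphere 0 1)" by (simp add: compact_imp_closed)
  qed
  with F that show ?thesis by blast
qed

text \<open>By the Stone-Weierstrass theorem \<open>f\<close> is a uniform limit of trigonometric polynomials, all of which
  are orthogonal to \<open>f\<close>; hence \<open>\<integral>f\<^sup>2\<close> is arbitrarily small.\<close>

lemma fourier_complete:
  assumes f: "continuous_on {0..2*pi} f" and per: "f 0 = f (2*pi)"
    and 0: "\<And>n. fourier_coeff f n = 0" and t: "t \<in> {0..2*pi}"
  shows "f t = 0"
proof -
  have zero: "integral {0..2*pi} (\<lambda>t. complex_of_real (f t) * cis (-(real n * t))) = 0" for n
    using 0[of n] by (simp add: fourier_coeff_def)
  have base: "annihilates f (\<lambda>_. 1)"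
    unfolding annihilates_def
  proof (intro conjI allI)
    fix n :: int
    show "integral {0..2*pi} (\<lambda>t. complex_of_real (f t * 1) * cis (of_int n * t)) = 0"
    proof (cases n rule: int_cases2)
      case (nonpos m)
      then show ?thesis using zero[of m] by simp
    next
      case (nonneg m)
      have "cnj (integral {0..2*pi} (\<lambda>t. complex_of_real (f t) * cis (-(real m * t)))) = 0"
        unfolding zero by simp
      then show ?thesis by (simp add: nonneg integral_cnj cis_cnj)
    qed
  qed simp
  obtain F where F: "continuous_on (sphere 0 1) F" "\<And>t. t \<in> {0..2*pi} \<Longrightarrow> F (cis t) = f t"
    using continuous_on_circle_factor[OF f per] by blast
  obtain B where "\<forall>t\<in>{0..2*pi}. \<bar>f t\<bar> \<le> B" and "B > 0"
    using compact_continuous_image[OF f compact_Icc, THEN compact_imp_bounded]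
    unfolding bounded_pos by auto
  then have B: "\<And>t. t \<in> {0..2*pi} \<Longrightarrow> \<bar>f t\<bar> \<le> B" by blast
  have "integral {0..2*pi} (\<lambda>t. (f t)\<^sup>2) \<le> e" if "e > 0" for e
  proof -
    \<comment> \<open>Chosen so that \<open>B d\<close>, integrated over the period, is \<open>e\<close>.\<close>
    define d where "d = e / (B * (2*pi))"
    have "d > 0" using that \<open>B > 0\<close> by (simp add: d_def)
    obtain g where g: "real_polynomial_function g" "\<And>z. z \<in> sphere 0 1 \<Longrightarrow> \<bar>F z - g z\<bar> < d"
      using Stone_Weierstrass_real_polynomial_function[OF compact_sphere F(1) \<open>d > 0\<close>] by blast
    have ann: "annihilates f (\<lambda>t. g (cis t))"
      using annihilates_polynomial_mult[OF f g(1) base] by simp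
    then have cg: "continuous_on {0..2*pi} (\<lambda>t. g (cis t))" by (simp add: annihilates_def)
    have "integral {0..2*pi} (\<lambda>t. complex_of_real (f t * g (cis t)) * cis (of_int 0 * t)) = 0"
      using ann unfolding annihilates_def by blast
    then have "complex_of_real (integral {0..2*pi} (\<lambda>t. f t * g (cis t))) = 0"
      using integral_linear[of "\<lambda>t. f t * g (cis t)" "{0..2*pi}" complex_of_real, OF _ bounded_linear_of_real] f cg
      by (simp add: o_def integrable_continuous_interval continuous_intros)
    then have z: "integral {0..2*pi} (\<lambda>t. f t * g (cis t)) = 0" by (simp only: of_real_eq_0_iff)
    have "integral {0..2*pi} (\<lambda>t. (f t)\<^sup>2) = integral {0..2*pi} (\<lambda>t. (f t)\<^sup>2 - f t * g (cis t))"
      using z by (subst integral_diff) (auto intro!: integrable_continuous_interval continuous_intros f cg)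
    also have "\<dots> \<le> integral {0..2*pi} (\<lambda>t. B * d)"
    proof (rule integral_le)
      fix t assume t: "t \<in> {0..2*pi}"
      have "\<bar>f t - g (cis t)\<bar> \<le> d" using g(2)[of "cis t"] F(2)[OF t] by simp
      then have "\<bar>f t * (f t - g (cis t))\<bar> \<le> B * d"
        unfolding abs_mult using B[OF t] \<open>B > 0\<close> by (intro mult_mono) auto
      then show "(f t)\<^sup>2 - f t * g (cis t) \<le> B * d" by (simp add: power2_eq_square algebra_simps)
    qed (auto intro!: integrable_continuous_interval continuous_intros f cg)
    also have "\<dots> = e" using \<open>B > 0\<close> by (simp add: d_def)
    finally show ?thesis .
  qed
  then have "integral {0..2*pi} (\<lambda>t. (f t)\<^sup>2) \<le> 0" by (rule field_le_epsilon[of _ 0, simplified])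
  moreover have "integral {0..2*pi} (\<lambda>t. (f t)\<^sup>2) \<ge> 0" by (simp add: Henstock_Kurzweil_Integration.integral_nonneg integrable_continuous_interval continuous_on_power f)
  ultimately have "integral {0..2*pi} (\<lambda>t. (f t)\<^sup>2) = 0" by simp
  then show ?thesis using integral_eq_0_iff[of 0 "2*pi" "\<lambda>t. (f t)\<^sup>2"] continuous_on_power[OF f, of 2] t by auto
qed

section \<open>Fourier series and Parseval's identity\<close>

definition fourier_series :: "(nat \<Rightarrow> complex) \<Rightarrow> real \<Rightarrow> real" where
  "fourier_series z t = (\<Sum>n. Re (z n * cis (real n * t)))"

lemma harmonic_bound: "norm (Re (z * cis t)) \<le> norm z"
  using abs_Re_le_cmod[of "z * cis t"] by (simp add: norm_mult)

lemma fourier_series_uniform_limit: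
  assumes "summable (\<lambda>n. norm (z n))"
  shows "uniform_limit A (\<lambda>N t. \<Sum>n<N. Re (z n * cis (real n * t))) (fourier_series z) sequentially"
  unfolding fourier_series_def by (rule Weierstrass_m_test[OF harmonic_bound assms])

lemma fourier_series_sums:
  assumes "summable (\<lambda>n. norm (z n))"
  shows "(\<lambda>n. Re (z n * cis (real n * t))) sums fourier_series z t"
  unfolding fourier_series_def
  by (intro summable_sums summable_norm_cancel[OF summable_comparison_test'[OF assms, of 0]])
     (use harmonic_bound in auto)

lemma continuous_on_fourier_series:
  assumes "summable (\<lambda>n. norm (z n))"
  shows "continuous_on A (fourier_series z)"
  by (rule uniform_limit_theorem[OF _ fourier_series_uniform_limit[OF assms]])
     (auto intro!: continuous_intros always_eventually)

lemma fourier_series_integral: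
  fixes g :: "real \<Rightarrow> complex"
  assumes z: "summable (\<lambda>n. norm (z n))" and g: "continuous_on {0..2*pi} g"
  shows "(\<lambda>n. integral {0..2*pi} (\<lambda>t. complex_of_real (Re (z n * cis (real n * t))) * g t)) sums
     integral {0..2*pi} (\<lambda>t. complex_of_real (fourier_series z t) * g t)"
proof -
  obtain B where "\<forall>t\<in>{0..2*pi}. norm (g t) \<le> B" and "B > 0"
    using compact_continuous_image[OF g compact_Icc, THEN compact_imp_bounded]
    unfolding bounded_pos by auto
  then have B: "\<And>t. t \<in> {0..2*pi} \<Longrightarrow> norm (g t) \<le> B" by blast
  have u: "uniform_limit {0..2*pi} (\<lambda>N t. \<Sum>n<N. complex_of_real (Re (z n * cis (real n * t))) * g t)
     (\<lambda>t. \<Sum>n. complex_of_real (Re (z n * cis (real n * t))) * g t) sequentially"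
  proof (rule Weierstrass_m_test)
    show "norm (complex_of_real (Re (z n * cis (real n * t))) * g t) \<le> norm (z n) * B" if "t \<in> {0..2*pi}" for n t
      unfolding norm_mult norm_of_real by (intro mult_mono B that harmonic_bound[unfolded real_norm_def]) auto
    show "summable (\<lambda>n. norm (z n) * B)" by (intro summable_mult2 z)
  qed
  have lim: "(\<Sum>n. complex_of_real (Re (z n * cis (real n * t))) * g t) = complex_of_real (fourier_series z t) * g t" for t
    using sums_mult2[OF sums_of_real[OF fourier_series_sums[OF z, of t], where 'a = complex], of "g t"]
    by (simp add: sums_iff)
  obtain I J where I: "\<And>N. ((\<lambda>t. \<Sum>n<N. complex_of_real (Re (z n * cis (real n * t))) * g t) has_integral I N) {0..2*pi}"
    and J: "((\<lambda>t. complex_of_real (fourier_series z t) * g t) has_integral J) {0..2*pi}" and "I \<longlonglongrightarrow> J"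
    by (rule uniform_limit_integral[OF u[unfolded lim]]) (auto intro!: continuous_intros g)
  moreover have "I = (\<lambda>N. \<Sum>n<N. integral {0..2*pi} (\<lambda>t. complex_of_real (Re (z n * cis (real n * t))) * g t))"
  proof
    fix N
    show "I N = (\<Sum>n<N. integral {0..2*pi} (\<lambda>t. complex_of_real (Re (z n * cis (real n * t))) * g t))"
    using I[of N] by (subst integral_sum[symmetric])
      (auto simp: integral_unique intro!: integrable_continuous_interval continuous_intros g)
  qed
  ultimately show ?thesis unfolding sums_def integral_unique[OF J] by (simp only:)
qed

lemma fourier_coeff_fourier_series:
  assumes "summable (\<lambda>n. norm (z n))" and "z 0 = 0"
  shows "fourier_coeff (fourier_series z) n = z n"
proof -
  have coeff: "(1/pi) *\<^sub>R integral {0..2*pi} (\<lambda>t. complex_of_real (Re (z k * cis (real k * t))) * cis (-(real n * t)))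
      = (if k = n then z n else 0)" for k
    using fourier_coeff_harmonic[of k "z k" n] assms(2)
    by (cases "k = 0") (auto simp: fourier_coeff_def)
  have "(\<lambda>k. (1/pi) *\<^sub>R integral {0..2*pi} (\<lambda>t. complex_of_real (Re (z k * cis (real k * t))) * cis (-(real n * t))))
      sums fourier_coeff (fourier_series z) n"
    unfolding fourier_coeff_def
    by (intro sums_scaleR_right fourier_series_integral assms continuous_intros)
  then have "(\<lambda>k. if k = n then z n else 0) sums fourier_coeff (fourier_series z) n"
    unfolding coeff .
  moreover have "(\<lambda>k. if k = n then z n else 0) sums z n" by (rule sums_single)
  ultimately show ?thesis by (rule sums_unique2)
qed

lemma fourier_coeff_integrable:
  assumes "continuous_on {0..2*pi} f"
  shows "(\<lambda>t. complex_of_real (f t) * cis (-(real n * t))) integrable_on {0..2*pi}"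
  by (intro integrable_continuous_interval continuous_intros assms)

lemma fourier_coeff_add:
  assumes "continuous_on {0..2*pi} f" "continuous_on {0..2*pi} g"
  shows "fourier_coeff (\<lambda>t. f t + g t) n = fourier_coeff f n + fourier_coeff g n"
  unfolding fourier_coeff_def
  using integral_add[OF assms[THEN fourier_coeff_integrable, of n]]
  by (simp add: algebra_simps)

lemma fourier_coeff_cmult: "fourier_coeff (\<lambda>t. c * f t) n = complex_of_real c * fourier_coeff f n"
  unfolding fourier_coeff_def by (simp add: mult.assoc integral_mult_right)

lemma fourier_coeff_diff:
  assumes "continuous_on {0..2*pi} f" "continuous_on {0..2*pi} g"
  shows "fourier_coeff (\<lambda>t. f t - g t) n = fourier_coeff f n - fourier_coeff g n"
  using fourier_coeff_add[OF assms(1), of "\<lambda>t. (-1) * g t"] fourier_coeff_cmult[of "-1" g] assms(2)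
  by (simp add: continuous_on_minus)

text \<open>An absolutely summable Fourier series has the same coefficients as \<open>f\<close>, so completeness applies to the
  difference.\<close>

lemma fourier_series_expansion:
  assumes f: "continuous_on {0..2*pi} f" "f 0 = f (2*pi)" and "fourier_coeff f 0 = 0"
    and z: "summable (\<lambda>n. norm (fourier_coeff f n))" and t: "t \<in> {0..2*pi}"
  shows "f t = fourier_series (fourier_coeff f) t"
proof -
  let ?s = "fourier_series (fourier_coeff f)"
  note cs = continuous_on_fourier_series[OF z]
  have "f t - ?s t = 0"
  proof (rule fourier_complete[where f = "\<lambda>t. f t - ?s t"])
    show "f 0 - ?s 0 = f (2*pi) - ?s (2*pi)"
      using f(2) by (simp add: fourier_series_def cis_multiple_2pi mult.commute[of _ "2*pi"])
    show "fourier_coeff (\<lambda>t. f t - ?s t) n = 0" for n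
      by (subst fourier_coeff_diff) (use assms cs fourier_coeff_fourier_series[OF z] in auto)
  qed (use f cs t in \<open>auto intro!: continuous_intros\<close>)
  then show ?thesis by simp
qed

text \<open>Only \<open>f\<close> is expanded; \<open>g\<close> is integrated term by term against its uniformly convergent series.\<close>

lemma parseval:
  assumes f: "continuous_on {0..2*pi} f" "f 0 = f (2*pi)" and "fourier_coeff f 0 = 0"
    and z: "summable (\<lambda>n. norm (fourier_coeff f n))" and g: "continuous_on {0..2*pi} g"
  shows "(\<lambda>n. pi * Re (fourier_coeff f n * cnj (fourier_coeff g n))) sums integral {0..2*pi} (\<lambda>t. f t * g t)"
proof -
  let ?z = "fourier_coeff f"
  have int: "(\<lambda>t. complex_of_real (g t) * cis (real n * t)) integrable_on {0..2*pi}" for n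
    by (intro integrable_continuous_interval continuous_intros g)
  have "Re (integral {0..2*pi} (\<lambda>t. complex_of_real (Re (?z n * cis (real n * t))) * complex_of_real (g t)))
       = pi * Re (?z n * cnj (fourier_coeff g n))" for n
  proof -
    have "Re (integral {0..2*pi} (\<lambda>t. complex_of_real (Re (?z n * cis (real n * t))) * complex_of_real (g t)))
       = integral {0..2*pi} (\<lambda>t. Re (?z n * (complex_of_real (g t) * cis (real n * t))))"
      by (subst integral_linear[OF _ bounded_linear_Re, unfolded o_def, symmetric])
         (auto intro!: integrable_continuous_interval continuous_intros g integral_cong, simp add: algebra_simps)
    also have "\<dots> = Re (?z n * integral {0..2*pi} (\<lambda>t. complex_of_real (g t) * cis (real n * t)))"
      using integral_linear[OF integrable_on_mult_right[OF int] bounded_linear_Re, unfolded o_def]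
      by (simp only: integral_mult_right)
    also have "integral {0..2*pi} (\<lambda>t. complex_of_real (g t) * cis (real n * t)) = pi * cnj (fourier_coeff g n)"
      by (simp add: fourier_coeff_def integral_cnj cis_cnj scaleR_conv_of_real)
    finally show ?thesis by (simp add: mult.left_commute)
  qed
  moreover have "(\<lambda>n. Re (integral {0..2*pi} (\<lambda>t. complex_of_real (Re (?z n * cis (real n * t))) * complex_of_real (g t))))
     sums Re (integral {0..2*pi} (\<lambda>t. complex_of_real (fourier_series ?z t) * complex_of_real (g t)))"
    by (intro sums_Re fourier_series_integral z continuous_intros g)
  moreover have "Re (integral {0..2*pi} (\<lambda>t. complex_of_real (fourier_series ?z t) * complex_of_real (g t)))
     = integral {0..2*pi} (\<lambda>t. f t * g t)"
  proof -
    have "integral {0..2*pi} (\<lambda>t. complex_of_real (fourier_series ?z t) * complex_of_real (g t))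
       = integral {0..2*pi} (\<lambda>t. complex_of_real (f t * g t))"
      by (intro integral_cong) (use fourier_series_expansion[OF assms(1-4)] in simp)
    also have "\<dots> = complex_of_real (integral {0..2*pi} (\<lambda>t. f t * g t))"
      using integral_linear[of "\<lambda>t. f t * g t" "{0..2*pi}" complex_of_real, OF _ bounded_linear_of_real] f g
      by (simp add: o_def integrable_continuous_interval continuous_intros)
    finally show ?thesis by simp
  qed
  ultimately show ?thesis by simp
qed

text \<open>Integration by parts; the boundary terms cancel by periodicity.\<close>

lemma fourier_coeff_deriv:
  assumes d: "\<And>t. (f has_real_derivative f' t) (at t)" and f': "continuous_on {0..2*pi} f'"
    and per: "f 0 = f (2*pi)"
  shows "fourier_coeff f' n = \<i> * of_nat n * fourier_coeff f n"
proof -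
  have f: "continuous_on {0..2*pi} f"
    using d by (meson DERIV_continuous_on has_field_derivative_at_within)
  have "((\<lambda>t. complex_of_real (f' t) * cis (-(real n * t)) - \<i> * of_nat n * (complex_of_real (f t) * cis (-(real n * t))))
      has_integral (complex_of_real (f (2*pi)) * cis (-(real n * (2*pi))) - complex_of_real (f 0) * cis (-(real n * 0)))) {0..2*pi}"
  proof (rule fundamental_theorem_of_calculus)
    fix t :: real
    have 1: "((\<lambda>t. complex_of_real (f t)) has_vector_derivative complex_of_real (f' t)) (at t within {0..2*pi})"
      using d[of t] by (intro has_vector_derivative_of_real has_vector_derivative_at_within)
        (simp add: has_real_derivative_iff_has_vector_derivative)
    have 2: "((\<lambda>t. cis (-(real n * t))) has_vector_derivative - of_nat n * (\<i> * cis (-(real n * t)))) (at t within {0..2*pi})"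
      using has_vector_derivative_cis_mult[of "- real n"] by simp
    show "((\<lambda>t. complex_of_real (f t) * cis (-(real n * t))) has_vector_derivative
      complex_of_real (f' t) * cis (-(real n * t)) - \<i> * of_nat n * (complex_of_real (f t) * cis (-(real n * t)))) (at t within {0..2*pi})"
      using has_vector_derivative_mult[OF 1 2] by (simp add: algebra_simps)
  qed simp
  moreover have "cis (-(real n * (2*pi))) = 1"
    using cis_multiple_2pi[of "- real n"] by (simp add: mult.commute)
  ultimately have "integral {0..2*pi} (\<lambda>t. complex_of_real (f' t) * cis (-(real n * t)) - \<i> * of_nat n * (complex_of_real (f t) * cis (-(real n * t)))) = 0"
    using per by (simp add: integral_unique)
  then have "integral {0..2*pi} (\<lambda>t. complex_of_real (f' t) * cis (-(real n * t))) =
      \<i> * of_nat n * integral {0..2*pi} (\<lambda>t. complex_of_real (f t) * cis (-(real n * t)))"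
    using integral_diff[OF fourier_coeff_integrable[OF f', of n] integrable_on_mult_right[OF fourier_coeff_integrable[OF f, of n], of "\<i> * of_nat n"]]
    by (simp add: integral_mult_right)
  then show ?thesis by (simp add: fourier_coeff_def scaleR_conv_of_real)
qed

lemma fourier_coeff_bounded:
  assumes f: "continuous_on {0..2*pi} f"
  obtains B where "B > 0" "\<And>n. norm (fourier_coeff f n) \<le> B"
proof -
  obtain B where "\<forall>t\<in>{0..2*pi}. \<bar>f t\<bar> \<le> B" and "B > 0"
    using compact_continuous_image[OF f compact_Icc, THEN compact_imp_bounded]
    unfolding bounded_pos by auto
  then have "norm (complex_of_real (f t) * cis (-(real n * t))) \<le> B" if "t \<in> {0..2*pi}" for t n
    using that by (simp add: norm_mult)
  then have "norm (integral {0..2*pi} (\<lambda>t. complex_of_real (f t) * cis (-(real n * t)))) \<le> B * (2*pi - 0)" for n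
    by (intro integral_bound continuous_intros f) auto
  then have "norm (fourier_coeff f n) \<le> 2 * B" for n
    unfolding fourier_coeff_def norm_scaleR using pi_gt_zero by (simp add: pos_divide_le_eq mult_ac)
  then show ?thesis using that[of "2*B"] \<open>B > 0\<close> by simp
qed

section \<open>The Green kernel and bounds by the isoperimetric deficit\<close>

text \<open>On \<open>[0, 2 \<pi>]\<close> this is the Green function of \<open>- (1 + d\<^sup>2/dt\<^sup>2)\<close> on the functions without frequencies 0
  and 1, whose eigenvalues are \<open>n\<^sup>2 - 1\<close> for \<open>n \<ge> 2\<close>.\<close>

definition green_kernel :: "real \<Rightarrow> real" where
  "green_kernel t = 1/2 + cos t / 4 - (pi - t) * sin t / 2"

definition green_coeff :: "nat \<Rightarrow> real" where
  "green_coeff n = (if n \<ge> 2 then 1 / ((real n)\<^sup>2 - 1) else 0)"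

lemma green_coeff_nonneg: "green_coeff n \<ge> 0"
  by (auto simp: green_coeff_def power_mono[of 1 "real n" 2, simplified])

lemma integral_sawtooth_cis:
  "integral {0..2*pi} (\<lambda>t. complex_of_real (pi - t) * cis (of_int a * t))
     = (if a = 0 then 0 else 2 * pi * \<i> / of_int a)"
proof (cases "a = 0")
  case True
  have "((\<lambda>t. complex_of_real (pi - t)) has_integral
     complex_of_real (pi * (2*pi) - (2*pi)\<^sup>2/2) - complex_of_real (pi * 0 - 0\<^sup>2/2)) {0..2*pi}"
  proof (rule fundamental_theorem_of_calculus)
    fix t :: real
    have "((\<lambda>t. pi * t - t\<^sup>2/2) has_real_derivative pi - t) (at t within {0..2*pi})"
      by (auto intro!: derivative_eq_intros)
    then show "((\<lambda>t. complex_of_real (pi * t - t\<^sup>2/2)) has_vector_derivative complex_of_real (pi - t)) (at t within {0..2*pi})"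
      by (intro has_vector_derivative_of_real) (simp add: has_real_derivative_iff_has_vector_derivative)
  qed simp
  then show ?thesis using True by (simp add: integral_unique power2_eq_square)
next
  case False
  let ?g = "\<lambda>t. complex_of_real (pi - t) * (cis (of_int a * t) / (\<i> * of_int a))"
  have "((\<lambda>t. complex_of_real (pi - t) * cis (of_int a * t) - cis (of_int a * t) / (\<i> * of_int a))
     has_integral (?g (2*pi) - ?g 0)) {0..2*pi}" (is "(?h has_integral _) _")
  proof (rule fundamental_theorem_of_calculus)
    fix t :: real
    have "((\<lambda>t. pi - t) has_real_derivative - 1) (at t within {0..2*pi})"
      by (auto intro!: derivative_eq_intros)
    then have 1: "((\<lambda>t. complex_of_real (pi - t)) has_vector_derivative complex_of_real (-1)) (at t within {0..2*pi})"
      by (intro has_vector_derivative_of_real) (simp add: has_real_derivative_iff_has_vector_derivative)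
    note 2 = has_vector_derivative_cis_primitive[OF False, of t "{0..2*pi}"]
    show "(?g has_vector_derivative complex_of_real (pi - t) * cis (of_int a * t) - cis (of_int a * t) / (\<i> * of_int a)) (at t within {0..2*pi})"
      using has_vector_derivative_mult[OF 1 2] by simp
  qed simp
  from has_integral_add[OF this has_integral_divide[OF has_integral_cis_int[OF False], of "\<i> * of_int a"]]
  have "((\<lambda>t. complex_of_real (pi - t) * cis (of_int a * t)) has_integral (?g (2*pi) - ?g 0)) {0..2*pi}"
    by simp
  moreover have "cis (of_int a * (2*pi)) = 1"
    by (metis cis_multiple_2pi Ints_of_int mult.commute)
  ultimately show ?thesis using False by (simp add: integral_unique field_simps)
qed

lemma fourier_coeff_green_kernel: "fourier_coeff green_kernel n = green_coeff n"
proof -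
  let ?c = "\<lambda>a t. cis (of_int a * t)"
  let ?s = "\<lambda>a t. complex_of_real (pi - t) * cis (of_int a * t)"
  define m where "m = int n"
  have eq: "complex_of_real (green_kernel t) * cis (-(real n * t)) =
     1/2 * ?c (-m) t + 1/8 * ?c (1-m) t + 1/8 * ?c (-1-m) t
     + \<i>/4 * ?s (1-m) t + (-\<i>/4) * ?s (-1-m) t" for t
  proof -
    have c: "complex_of_real (cos t) = (cis t + cis (-t)) / 2" and s: "complex_of_real (sin t) = (cis t - cis (-t)) / (2*\<i>)"
      by (simp_all add: complex_eq_iff)
    have "?c (-m) t = cis (-(real n * t))" "?c (1-m) t = cis t * cis (-(real n * t))" "?c (-1-m) t = cis (-t) * cis (-(real n * t))"
      by (simp_all add: cis_mult m_def algebra_simps)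
    then show ?thesis
      unfolding green_kernel_def by (simp add: c s field_simps)
  qed
  have i: "(\<lambda>t. c * ?c a t) integrable_on {0..2*pi}" "(\<lambda>t. c * ?s a t) integrable_on {0..2*pi}" for a and c :: complex
    by (intro integrable_continuous_interval continuous_intros)+
  have int: "integral {0..2*pi} (\<lambda>t. complex_of_real (green_kernel t) * cis (-(real n * t))) =
     1/2 * (if -m = 0 then complex_of_real (2*pi) else 0)
     + 1/8 * (if 1-m = 0 then complex_of_real (2*pi) else 0)
     + 1/8 * (if -1-m = 0 then complex_of_real (2*pi) else 0)
     + \<i>/4 * (if 1-m = 0 then 0 else 2 * pi * \<i> / of_int (1-m))
     + (-\<i>/4) * (if -1-m = 0 then 0 else 2 * pi * \<i> / of_int (-1-m))"
    unfolding eq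
    by (simp only: integral_add i integrable_add integral_mult_right integral_cis_int integral_sawtooth_cis)
  consider "n = 0" | "n = 1" | "n \<ge> 2" by linarith
  then show ?thesis
  proof cases
    case 3
    then have nz: "complex_of_nat n + 1 \<noteq> 0" "complex_of_nat n - 1 \<noteq> 0" "1 - complex_of_nat n \<noteq> 0" "- 1 - complex_of_nat n \<noteq> 0"
      by (auto simp: complex_eq_iff)
    then have sq: "(complex_of_nat n)\<^sup>2 - 1 \<noteq> 0"
      using square_diff_one_factored[of "complex_of_nat n"] by (simp add: power2_eq_square)
    have "fourier_coeff green_kernel n = (1/pi) *\<^sub>R (\<i>/4 * (2 * pi * \<i> / (1 - of_nat n)) + (-\<i>/4) * (2 * pi * \<i> / (-1 - of_nat n)))"
      unfolding fourier_coeff_def int using 3 by (simp add: m_def)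
    also have "\<dots> = - 1/2 * (1 / (1 - of_nat n)) + 1/2 * (1 / (-1 - of_nat n))"
    proof -
      have "1 / P * (\<i>/4 * (2 * P * \<i> / a) + (-\<i>/4) * (2 * P * \<i> / b)) = - 1/2 * (1 / a) + 1/2 * (1 / b)" if "a \<noteq> 0" "b \<noteq> 0" "P \<noteq> 0" for a b P :: complex
        using that by (simp add: divide_simps) (simp add: algebra_simps)
      from this[OF nz(3,4), of "complex_of_real pi"] show ?thesis by (simp add: scaleR_conv_of_real)
    qed
    also have "\<dots> = 1 / ((of_nat n)\<^sup>2 - 1)"
      using nz sq by (simp add: divide_simps power2_eq_square) (simp add: algebra_simps)
    finally show ?thesis using 3 by (simp add: green_coeff_def)
  next
    case 1
    then show ?thesis unfolding fourier_coeff_def int by (simp add: green_coeff_def m_def)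
  next
    case 2
    then show ?thesis unfolding fourier_coeff_def int by (simp add: green_coeff_def m_def scaleR_conv_of_real mult.left_commute[of \<i>])
  qed
qed

lemma summable_green_coeff: "summable green_coeff"
proof (rule summable_comparison_test')
  show "summable (\<lambda>n. 2 * inverse ((real n)\<^sup>2))"
    by (intro summable_mult inverse_power_summable) simp
  fix n :: nat assume "n \<ge> 2"
  then have "(real n)\<^sup>2 \<ge> 4" using power_mono[of 2 "real n" 2] by simp
  then show "norm (green_coeff n) \<le> 2 * inverse ((real n)\<^sup>2)"
    using \<open>n \<ge> 2\<close> by (simp add: green_coeff_def field_simps)
qed

lemma green_kernel_sums:
  assumes "t \<in> {0..2*pi}"
  shows "(\<lambda>n. green_coeff n * cos (real n * t)) sums green_kernel t"
proof -
  have z: "summable (\<lambda>n. norm (fourier_coeff green_kernel n))"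
    using summable_green_coeff by (simp add: fourier_coeff_green_kernel green_coeff_nonneg)
  have "green_kernel t = fourier_series (fourier_coeff green_kernel) t"
  proof (rule fourier_series_expansion)
    show "continuous_on {0..2*pi} green_kernel"
      unfolding green_kernel_def by (intro continuous_intros) auto
    show "green_kernel 0 = green_kernel (2*pi)" by (simp add: green_kernel_def)
    show "fourier_coeff green_kernel 0 = 0" by (simp add: fourier_coeff_green_kernel green_coeff_def)
  qed (use z assms in auto)
  moreover have "Re (fourier_coeff green_kernel n * cis (real n * t)) = green_coeff n * cos (real n * t)" for n
    by (simp add: fourier_coeff_green_kernel)
  ultimately show ?thesis using fourier_series_sums[OF z, of t] by (simp only:)
qed

lemma sin_taylor5: "\<bar>sin x - (x - x^3/6)\<bar> \<le> \<bar>x\<bar>^5/120" for x :: real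
  using Maclaurin_sin_bound[of x 5]
  by (simp add: sin_coeff_def lessThan_nat_numeral lessThan_Suc fact_numeral)

text \<open>The cosine is nonnegative up to \<open>\<pi> / 2\<close>, but negative at 33/20 by the Taylor bound for
  \<open>sin (33/40)\<close>.\<close>

lemma pi_less_33: "pi < 33/10"
proof (rule ccontr)
  assume "\<not> pi < 33/10"
  then have "cos (33/20::real) \<ge> 0" by (intro cos_ge_zero) auto
  moreover have "cos (33/20::real) = 1 - 2 * (sin (33/40))\<^sup>2"
    using cos_double_sin[of "33/40::real"] by simp
  moreover have "sin (33/40::real) \<ge> 72/100"
    using abs_le_D2[OF sin_taylor5[of "33/40"]] by (simp add: power_divide)
  then have "(sin (33/40::real))\<^sup>2 \<ge> (72/100)\<^sup>2" by (intro power_mono) auto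
  ultimately show False by (simp add: power2_eq_square)
qed

text \<open>The maximum of \<open>s sin s\<close> is about 1.82. With \<open>x = s\<^sup>2 \<le> 11\<close> the Taylor bound
  \<open>x - x\<^sup>2/6 + x\<^sup>3/120 \<le> 2\<close> amounts to \<open>(11 - x) (x\<^sup>2 - 9 x + 21) + 9 \<ge> 0\<close>.\<close>

lemma mult_sin_bounds:
  assumes "0 \<le> s" "s \<le> pi"
  shows "0 \<le> s * sin s" "s * sin s \<le> 2"
proof -
  show "0 \<le> s * sin s" using assms by (simp add: sin_ge_zero)
  define x where "x = s\<^sup>2"
  have "sin s \<le> s - s^3/6 + s^5/120"
    using abs_le_D1[OF sin_taylor5[of s]] unfolding abs_of_nonneg[OF assms(1)] by linarith
  then have "s * sin s \<le> s * (s - s^3/6 + s^5/120)" using assms by (intro mult_left_mono) auto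
  also have "\<dots> = x - x\<^sup>2/6 + x^3/120" by (simp add: x_def algebra_simps eval_nat_numeral)
  also have "\<dots> \<le> 2"
  proof -
    have "x \<le> (33/10)\<^sup>2" unfolding x_def using assms pi_less_33 by (intro power_mono) auto
    then have "x \<le> 11" by (simp add: power2_eq_square)
    moreover have "x\<^sup>2 - 9*x + 21 = (x - 9/2)\<^sup>2 + 3/4" by (simp add: power2_eq_square algebra_simps)
    then have "x\<^sup>2 - 9*x + 21 \<ge> 0" by simp
    ultimately have "(11 - x) * (x\<^sup>2 - 9*x + 21) \<ge> 0" by (intro mult_nonneg_nonneg) auto
    then show ?thesis by (simp add: algebra_simps eval_nat_numeral)
  qed
  finally show "s * sin s \<le> 2" .
qed

lemma sawtooth_sin_bounds:
  assumes "t \<in> {0..2*pi}"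
  shows "0 \<le> (pi - t) * sin t" "(pi - t) * sin t \<le> 2"
proof -
  have "(pi - t) * sin t = \<bar>pi - t\<bar> * sin \<bar>pi - t\<bar>"
    by (cases "t \<le> pi") (simp_all add: sin_diff algebra_simps)
  with mult_sin_bounds[of "\<bar>pi - t\<bar>"] assms
  show "0 \<le> (pi - t) * sin t" "(pi - t) * sin t \<le> 2" by auto
qed

text \<open>Probability weights on directions whose centre of mass is the origin. Against such weights the
  first harmonics of a support function, that is, translations of the body, are invisible.\<close>

definition balanced :: "nat set \<Rightarrow> (nat \<Rightarrow> real) \<Rightarrow> (nat \<Rightarrow> real) \<Rightarrow> bool" where
  "balanced I w x \<longleftrightarrow> finite I \<and> (\<forall>i\<in>I. 0 \<le> w i \<and> x i \<in> {0..2*pi}) \<and> sum w I = 1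
     \<and> (\<Sum>i\<in>I. complex_of_real (w i) * cis (x i)) = 0"

definition char_sum :: "nat set \<Rightarrow> (nat \<Rightarrow> real) \<Rightarrow> (nat \<Rightarrow> real) \<Rightarrow> nat \<Rightarrow> complex" where
  "char_sum I w x n = (\<Sum>i\<in>I. complex_of_real (w i) * cis (real n * x i))"

lemma Re_char_sum_mult:
  "Re (char_sum I w x n * cnj (char_sum J v y n)) = (\<Sum>i\<in>I. \<Sum>j\<in>J. w i * v j * cos (real n * \<bar>x i - y j\<bar>))"
proof -
  have "cos (real n * \<bar>x i - y j\<bar>) = Re (cis (real n * x i) * cnj (cis (real n * y j)))" for i j
    by (simp add: cis_cnj cis_mult abs_if algebra_simps) (metis cos_minus minus_diff_eq)
  then have "(\<Sum>i\<in>I. \<Sum>j\<in>J. w i * v j * cos (real n * \<bar>x i - y j\<bar>)) =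
      (\<Sum>i\<in>I. \<Sum>j\<in>J. Re ((complex_of_real (w i) * cis (real n * x i)) * cnj (complex_of_real (v j) * cis (real n * y j))))"
    by (intro sum.cong refl) (simp add: algebra_simps)
  then show ?thesis
    unfolding char_sum_def cnj_sum sum_product Re_sum by simp
qed

text \<open>On balanced weights the constant 1/2 in the kernel contributes 1/2 and the cosine term contributes
  0 because the first moments vanish. The remaining term is minus half a mean of values of
  \<open>(\<pi> - t) sin t\<close>, which lie between 0 and 2.\<close>

lemma green_energy_bound:
  assumes b: "balanced I w x" "balanced J v y"
  obtains s where "(\<lambda>n. green_coeff n * Re (char_sum I w x n * cnj (char_sum J v y n))) sums s" "\<bar>s\<bar> \<le> 1/2"
proof -
  let ?d = "\<lambda>i j. \<bar>x i - y j\<bar>"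
  define K where "K = (\<Sum>i\<in>I. \<Sum>j\<in>J. w i * v j * ((pi - ?d i j) * sin (?d i j)))"
  have d: "?d i j \<in> {0..2*pi}" if "i \<in> I" "j \<in> J" for i j
    using b that unfolding balanced_def by (force simp: abs_le_iff)
  have "(\<lambda>n. \<Sum>i\<in>I. \<Sum>j\<in>J. w i * v j * (green_coeff n * cos (real n * ?d i j))) sums
      (\<Sum>i\<in>I. \<Sum>j\<in>J. w i * v j * green_kernel (?d i j))"
    by (intro sums_sum sums_mult green_kernel_sums d)
  moreover have "(\<Sum>i\<in>I. \<Sum>j\<in>J. w i * v j * (green_coeff n * cos (real n * ?d i j))) =
      green_coeff n * Re (char_sum I w x n * cnj (char_sum J v y n))" for n
    unfolding Re_char_sum_mult sum_distrib_left by (simp only: mult_ac)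
  moreover have "(\<Sum>i\<in>I. \<Sum>j\<in>J. w i * v j * green_kernel (?d i j)) = 1/2 - K/2"
  proof -
    have "(\<Sum>i\<in>I. \<Sum>j\<in>J. w i * v j * green_kernel (?d i j)) =
       (\<Sum>i\<in>I. \<Sum>j\<in>J. 1/2 * (w i * v j) + 1/4 * (w i * v j * cos (real 1 * ?d i j)) - 1/2 * (w i * v j * ((pi - ?d i j) * sin (?d i j))))"
      by (intro sum.cong refl) (simp add: green_kernel_def field_simps)
    also have "\<dots> = 1/2 * (\<Sum>i\<in>I. \<Sum>j\<in>J. w i * v j) + 1/4 * Re (char_sum I w x 1 * cnj (char_sum J v y 1)) - 1/2 * K"
      unfolding Re_char_sum_mult K_def by (simp add: sum.distrib sum_subtractf sum_distrib_left)
    also have "(\<Sum>i\<in>I. \<Sum>j\<in>J. w i * v j) = 1"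
      using b by (simp add: balanced_def flip: sum_product)
    also have "char_sum I w x 1 = 0" using b by (simp add: balanced_def char_sum_def)
    finally show ?thesis by simp
  qed
  moreover have "0 \<le> K"
    unfolding K_def by (intro sum_nonneg mult_nonneg_nonneg sawtooth_sin_bounds(1) d)
      (use b in \<open>auto simp: balanced_def\<close>)
  moreover have "K \<le> (\<Sum>i\<in>I. \<Sum>j\<in>J. w i * v j * 2)"
    unfolding K_def by (intro sum_mono mult_left_mono sawtooth_sin_bounds(2) d)
      (use b in \<open>auto simp: balanced_def\<close>)
  then have "K \<le> 2" using b by (simp add: balanced_def flip: sum_product sum_distrib_right)
  moreover from \<open>0 \<le> K\<close> \<open>K \<le> 2\<close> have "\<bar>1/2 - K/2\<bar> \<le> 1/2" by linarith
  ultimately show ?thesis using that[of "1/2 - K/2"] by simp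
qed

lemma sums_Cauchy_Schwarz:
  fixes a p r :: "nat \<Rightarrow> real"
  assumes a: "a sums A" and p: "p sums P" and r: "r sums R"
    and pos: "\<And>n. 0 \<le> p n" "\<And>n. 0 \<le> r n" and le: "\<And>n. (a n)\<^sup>2 \<le> p n * r n"
  shows "A\<^sup>2 \<le> P * R"
proof (rule LIMSEQ_le)
  show "(\<lambda>N. (\<Sum>n<N. a n)\<^sup>2) \<longlonglongrightarrow> A\<^sup>2" using a unfolding sums_def by (intro tendsto_power)
  show "(\<lambda>N. (\<Sum>n<N. p n) * (\<Sum>n<N. r n)) \<longlonglongrightarrow> P * R" using p r unfolding sums_def by (intro tendsto_mult)
  have "(\<Sum>n<N. a n)\<^sup>2 \<le> (\<Sum>n<N. p n) * (\<Sum>n<N. r n)" for N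
  proof -
    have "\<bar>a n\<bar> \<le> sqrt (p n) * sqrt (r n)" for n
      using le[of n] by (metis real_sqrt_abs real_sqrt_le_mono real_sqrt_mult)
    then have "\<bar>\<Sum>n<N. a n\<bar> \<le> (\<Sum>n<N. sqrt (p n) * sqrt (r n))"
      by (intro order_trans[OF sum_abs] sum_mono)
    then have "(\<Sum>n<N. a n)\<^sup>2 \<le> (\<Sum>n<N. sqrt (p n) * sqrt (r n))\<^sup>2"
      by (metis abs_ge_zero power2_abs power_mono)
    also have "\<dots> \<le> (\<Sum>n<N. (sqrt (p n))\<^sup>2) * (\<Sum>n<N. (sqrt (r n))\<^sup>2)"
      by (rule Cauchy_Schwarz_ineq_sum)
    finally show ?thesis using pos by simp
  qed
  then show "\<exists>N. \<forall>n\<ge>N. (\<Sum>n<n. a n)\<^sup>2 \<le> (\<Sum>n<n. p n) * (\<Sum>n<n. r n)" by blast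
qed

lemma weighted_coeff_bound:
  assumes z: "n < 2 \<longrightarrow> z = 0"
  shows "(Re (z * m))\<^sup>2 \<le> (((real n)\<^sup>2 - 1) * (norm z)\<^sup>2) * (green_coeff n * (norm m)\<^sup>2)"
proof (cases "n \<ge> 2")
  case True
  then have "(real n)\<^sup>2 > 1" using power_mono[of 2 "real n" 2] by simp
  then have "(real n)\<^sup>2 \<noteq> 1" by simp
  then have "(((real n)\<^sup>2 - 1) * (norm z)\<^sup>2) * (green_coeff n * (norm m)\<^sup>2) = (norm (z * m))\<^sup>2"
    using True by (auto simp add: green_coeff_def norm_mult power_mult_distrib)
  moreover have "(Re (z * m))\<^sup>2 \<le> (norm (z * m))\<^sup>2"
    using abs_Re_le_cmod[of "z * m"] by (metis abs_ge_zero power2_abs power_mono)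
  ultimately show ?thesis by simp
qed (use z in auto)

context
  fixes q :: "real \<Rightarrow> real" and S :: real
  assumes q: "continuous_on {0..2*pi} q" "q 0 = q (2*pi)"
    and low: "fourier_coeff q 0 = 0" "fourier_coeff q 1 = 0"
    and z: "summable (\<lambda>n. norm (fourier_coeff q n))"
    and S: "(\<lambda>n. ((real n)\<^sup>2 - 1) * (norm (fourier_coeff q n))\<^sup>2) sums S"
begin

lemma low_coeff_zero: "n < 2 \<longrightarrow> fourier_coeff q n = 0"
  using low by (auto simp: less_2_cases_iff)

lemma deficit_term_nonneg: "0 \<le> ((real n)\<^sup>2 - 1) * (norm (fourier_coeff q n))\<^sup>2"
proof (cases "n < 2")
  case False
  then show ?thesis using power_mono[of 1 "real n" 2] by simp
qed (use low_coeff_zero in auto)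

text \<open>Point evaluation has energy \<open>green_kernel 0 = \<Sum> 1 / (n\<^sup>2 - 1) = 3/4\<close>.\<close>

lemma square_le_deficit:
  assumes "t \<in> {0..2*pi}"
  shows "(q t)\<^sup>2 \<le> 3/4 * S"
proof -
  have "(q t)\<^sup>2 \<le> S * (3/4)"
  proof (rule sums_Cauchy_Schwarz[OF _ S])
    show "(\<lambda>n. Re (fourier_coeff q n * cis (real n * t))) sums q t"
      using fourier_series_expansion[OF q low(1) z assms] fourier_series_sums[OF z, of t] by simp
    show "(\<lambda>n. green_coeff n * (norm (cis (real n * t)))\<^sup>2) sums (3/4)"
      using green_kernel_sums[of 0] by (simp add: green_kernel_def)
  qed (intro deficit_term_nonneg mult_nonneg_nonneg green_coeff_nonneg zero_le_power2 weighted_coeff_bound[OF low_coeff_zero])+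
  then show ?thesis by simp
qed

lemma balanced_mean_sums:
  assumes "balanced I w x"
  shows "(\<lambda>n. Re (fourier_coeff q n * char_sum I w x n)) sums (\<Sum>i\<in>I. w i * q (x i))"
proof -
  have "(\<lambda>n. \<Sum>i\<in>I. w i * Re (fourier_coeff q n * cis (real n * x i))) sums (\<Sum>i\<in>I. w i * q (x i))"
  proof (intro sums_sum sums_mult)
    fix i assume "i \<in> I"
    then have "x i \<in> {0..2*pi}" using assms by (auto simp: balanced_def)
    then show "(\<lambda>n. Re (fourier_coeff q n * cis (real n * x i))) sums q (x i)"
      using fourier_series_expansion[OF q low(1) z] fourier_series_sums[OF z, of "x i"] by simp
  qed
  moreover have "(\<Sum>i\<in>I. w i * Re (fourier_coeff q n * cis (real n * x i))) = Re (fourier_coeff q n * char_sum I w x n)" for n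
    by (simp add: char_sum_def sum_distrib_left Re_sum algebra_simps)
  ultimately show ?thesis by simp
qed

text \<open>The energy of the difference of two balanced weights is \<open>s1 + s2 - 2 s3\<close> with all three terms of
  absolute value at most 1/2, hence at most 2. Applied to the extremal weights for circumradius and
  inradius this is Bonnesen's inequality.\<close>

lemma balanced_mean_difference_le_deficit:
  assumes b: "balanced I w x" "balanced J v y"
  shows "((\<Sum>i\<in>I. w i * q (x i)) - (\<Sum>j\<in>J. v j * q (y j)))\<^sup>2 \<le> 2 * S"
proof -
  let ?m = "\<lambda>n. char_sum I w x n - char_sum J v y n"
  let ?e = "\<lambda>I w x J v y n. green_coeff n * Re (char_sum I w x n * cnj (char_sum J v y n))"
  obtain s1 where s1: "?e I w x I w x sums s1" "\<bar>s1\<bar> \<le> 1/2" by (rule green_energy_bound[OF b(1) b(1)])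
  obtain s2 where s2: "?e J v y J v y sums s2" "\<bar>s2\<bar> \<le> 1/2" by (rule green_energy_bound[OF b(2) b(2)])
  obtain s3 where s3: "?e I w x J v y sums s3" "\<bar>s3\<bar> \<le> 1/2" by (rule green_energy_bound[OF b(1) b(2)])
  have "(\<lambda>n. ?e I w x I w x n + ?e J v y J v y n - 2 * ?e I w x J v y n) sums (s1 + s2 - 2 * s3)"
    by (intro sums_add sums_diff sums_mult s1 s2 s3)
  moreover have "?e I w x I w x n + ?e J v y J v y n - 2 * ?e I w x J v y n = green_coeff n * (norm (?m n))\<^sup>2" for n
    unfolding cmod_power2 by (simp add: power2_eq_square algebra_simps)
  ultimately have e: "(\<lambda>n. green_coeff n * (norm (?m n))\<^sup>2) sums (s1 + s2 - 2 * s3)" by simp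
  have "((\<Sum>i\<in>I. w i * q (x i)) - (\<Sum>j\<in>J. v j * q (y j)))\<^sup>2 \<le> S * (s1 + s2 - 2 * s3)"
  proof (rule sums_Cauchy_Schwarz[OF _ S e])
    show "(\<lambda>n. Re (fourier_coeff q n * ?m n)) sums ((\<Sum>i\<in>I. w i * q (x i)) - (\<Sum>j\<in>J. v j * q (y j)))"
      using sums_diff[OF balanced_mean_sums[OF b(1)] balanced_mean_sums[OF b(2)]] by (simp add: algebra_simps)
  qed (intro deficit_term_nonneg mult_nonneg_nonneg green_coeff_nonneg zero_le_power2 weighted_coeff_bound[OF low_coeff_zero])+
  also have "\<dots> \<le> S * 2"
    using s1 s2 s3 sums_le[OF _ sums_zero S] deficit_term_nonneg by (intro mult_left_mono) auto
  finally show ?thesis by simp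
qed

end

section \<open>Smoothness of the support function\<close>

text \<open>Functions with \<open>n\<close> continuous derivatives. Closure properties need an induction on the order, and
  expressing the order by recursion provides it.\<close>

primrec Ck :: "nat \<Rightarrow> (real \<Rightarrow> real) \<Rightarrow> bool" where
  "Ck 0 f \<longleftrightarrow> continuous_on UNIV f"
| "Ck (Suc n) f \<longleftrightarrow> (\<forall>x. (f has_real_derivative deriv f x) (at x)) \<and> Ck n (deriv f)"

lemma Ck_SucI:
  assumes f': "\<And>x. (f has_real_derivative f' x) (at x)" and "Ck n f'"
  shows "Ck (Suc n) f"
proof -
  have "deriv f = f'" by (intro ext DERIV_imp_deriv f')
  with assms show ?thesis by simp
qed

lemma Ck_has_deriv: "Ck (Suc n) f \<Longrightarrow> (f has_real_derivative deriv f x) (at x)"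
  by simp

lemma Ck_deriv: "Ck (Suc n) f \<Longrightarrow> Ck n (deriv f)"
  by simp

lemma Ck_SucD: "Ck (Suc n) f \<Longrightarrow> Ck n f"
proof (induction n arbitrary: f)
  case 0
  show ?case
    unfolding Ck.simps by (rule DERIV_continuous_on[OF has_field_derivative_at_within[OF Ck_has_deriv[OF 0]]])
next
  case (Suc n)
  show ?case by (rule Ck_SucI[OF Ck_has_deriv[OF Suc.prems] Suc.IH[OF Ck_deriv[OF Suc.prems]]])
qed

lemma Ck_const: "Ck n (\<lambda>_. c)"
proof (induction n arbitrary: c)
  case (Suc n)
  show ?case by (rule Ck_SucI[OF DERIV_const Suc])
qed simp

lemma Ck_add: "Ck n f \<Longrightarrow> Ck n g \<Longrightarrow> Ck n (\<lambda>x. f x + g x)"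
proof (induction n arbitrary: f g)
  case (Suc n)
  show ?case
    by (rule Ck_SucI[OF DERIV_add[OF Suc.prems[THEN Ck_has_deriv]] Suc.IH[OF Suc.prems[THEN Ck_deriv]]])
qed (simp add: continuous_on_add)

lemma Ck_mult: "Ck n f \<Longrightarrow> Ck n g \<Longrightarrow> Ck n (\<lambda>x. f x * g x)"
proof (induction n arbitrary: f g)
  case (Suc n)
  have "Ck n (\<lambda>x. deriv f x * g x)" "Ck n (\<lambda>x. deriv g x * f x)"
    by (rule Suc.IH[OF Ck_deriv Ck_SucD]; rule Suc.prems)+
  then show ?case
    by (rule Ck_SucI[OF DERIV_mult[OF Suc.prems[THEN Ck_has_deriv]] Ck_add])
qed (simp add: continuous_on_mult)

lemma Ck_diff: "Ck n f \<Longrightarrow> Ck n g \<Longrightarrow> Ck n (\<lambda>x. f x - g x)"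
  using Ck_add[of n f "\<lambda>x. (-1) * g x"] Ck_mult[OF Ck_const[of n "-1"], of g] by simp

lemma Ck_inverse: "Ck n f \<Longrightarrow> (\<And>x. f x \<noteq> 0) \<Longrightarrow> Ck n (\<lambda>x. inverse (f x))"
proof (induction n arbitrary: f)
  case (Suc n)
  have "Ck n (\<lambda>x. inverse (f x))" by (rule Suc.IH[OF Ck_SucD[OF Suc.prems(1)] Suc.prems(2)])
  then have "Ck n (\<lambda>x. (-1) * (inverse (f x) * deriv f x * inverse (f x)))"
    by (intro Ck_mult Ck_const Ck_deriv[OF Suc.prems(1)])
  moreover have "((\<lambda>x. inverse (f x)) has_real_derivative (-1) * (inverse (f x) * deriv f x * inverse (f x))) (at x)" for x
    using DERIV_inverse'[OF Ck_has_deriv[OF Suc.prems(1)] Suc.prems(2)] by simp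
  ultimately show ?case by (rule Ck_SucI[rotated])
qed (simp add: continuous_on_inverse)

lemma Ck_compose: "Ck n f \<Longrightarrow> Ck n g \<Longrightarrow> Ck n (\<lambda>x. f (g x))"
proof (induction n arbitrary: f)
  case 0
  then show ?case using continuous_on_compose2[of UNIV f UNIV g] by simp
next
  case (Suc n)
  have "Ck n (\<lambda>x. deriv f (g x))" by (rule Suc.IH[OF Ck_deriv[OF Suc.prems(1)] Ck_SucD[OF Suc.prems(2)]])
  then show ?case
    by (rule Ck_SucI[OF DERIV_chain2[OF Suc.prems[THEN Ck_has_deriv]] Ck_mult[OF _ Ck_deriv[OF Suc.prems(2)]]])
qed

lemma Ck_cos_sin: "Ck n cos" "Ck n sin"
proof (induction n)
  case (Suc n)
  have "Ck n (\<lambda>x. (-1) * sin x)" by (intro Ck_mult Ck_const Suc)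
  then have "Ck n (\<lambda>x. - sin x)" by simp
  then show "Ck (Suc n) cos" by (rule Ck_SucI[OF DERIV_cos])
  show "Ck (Suc n) sin" by (rule Ck_SucI[OF DERIV_sin Suc(1)])
qed (simp_all add: continuous_on_cos continuous_on_sin)

lemma unit_vec_nth [simp]: "unit_vec \<theta> $ 1 = cos \<theta>" "unit_vec \<theta> $ 2 = sin \<theta>"
  by (simp_all add: unit_vec_def)

lemma inner_unit_vec: "x \<bullet> unit_vec \<theta> = x$1 * cos \<theta> + x$2 * sin \<theta>"
  by (simp add: inner_vec_def sum_2)

lemma norm_unit_vec [simp]: "norm (unit_vec \<theta>) = 1"
  by (simp add: norm_eq_sqrt_inner inner_unit_vec flip: power2_eq_square)

lemma polar_unit_vec:
  fixes a :: "real^2"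
  obtains \<theta> where "0 \<le> \<theta>" "\<theta> < 2*pi" "a = norm a *\<^sub>R unit_vec \<theta>"
proof (cases "a = 0")
  case True
  then show ?thesis using that[of 0] by simp
next
  case False
  have n: "(norm a)\<^sup>2 = (a$1)\<^sup>2 + (a$2)\<^sup>2"
    unfolding power2_norm_eq_inner inner_vec_def sum_2 by (simp add: power2_eq_square)
  have "(a$1 / norm a)\<^sup>2 + (a$2 / norm a)\<^sup>2 = 1"
    using False unfolding power_divide add_divide_distrib[symmetric] n[symmetric] by simp
  then obtain \<theta> where \<theta>: "0 \<le> \<theta>" "\<theta> < 2*pi" "a$1 / norm a = cos \<theta>" "a$2 / norm a = sin \<theta>"
    by (rule sincos_total_2pi)
  have "a = norm a *\<^sub>R unit_vec \<theta>"
    using False by (simp add: vec_eq_iff forall_2 flip: \<theta>(3,4))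
  with \<theta>(1,2) show ?thesis by (rule that)
qed

lemma support_fun_upper:
  assumes "compact K" "x \<in> K"
  shows "x \<bullet> unit_vec \<theta> \<le> support_fun K \<theta>"
  unfolding support_fun_def
proof (rule cSUP_upper[OF assms(2)])
  have "compact ((\<lambda>x. x \<bullet> unit_vec \<theta>) ` K)"
    by (intro compact_continuous_image continuous_intros assms)
  then show "bdd_above ((\<lambda>x. x \<bullet> unit_vec \<theta>) ` K)"
    by (intro bounded_imp_bdd_above compact_imp_bounded)
qed

lemma support_fun_eqI:
  assumes "x \<in> K" "\<And>y. y \<in> K \<Longrightarrow> y \<bullet> unit_vec \<theta> \<le> x \<bullet> unit_vec \<theta>"
  shows "support_fun K \<theta> = x \<bullet> unit_vec \<theta>"
  unfolding support_fun_def by (rule cSup_eq_maximum) (use assms in auto)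

lemma strictly_convex_imp_convex: "strictly_convex K \<Longrightarrow> convex K"
  unfolding strictly_convex_def convex_contains_open_segment
  by (metis empty_subsetI interior_subset open_segment_idem order_trans)

text \<open>The sign of the second derivative is what distinguishes the outward from the inward normal below.\<close>

lemma second_derivative_nonpos_at_max:
  fixes f :: "real \<Rightarrow> real"
  assumes f: "\<And>x. (f has_real_derivative f' x) (at x)" and f': "(f' has_real_derivative d) (at t)"
    and max: "\<And>x. f x \<le> f t"
  shows "f' t = 0" "d \<le> 0"
proof -
  show 0: "f' t = 0" by (rule DERIV_local_max[OF f, of 1]) (use max in auto)
  show "d \<le> 0"
  proof (rule ccontr)
    assume "\<not> d \<le> 0"
    then obtain e where e: "e > 0" "\<And>h. 0 < h \<Longrightarrow> h < e \<Longrightarrow> f' t < f' (t + h)"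
      using DERIV_pos_inc_right[OF f'] by auto
    obtain z where z: "t < z" "z < t + e/2" "f (t + e/2) - f t = (t + e/2 - t) * f' z"
      using MVT2[of t "t + e/2" f f'] f e by auto
    have "f' z > 0" using e(2)[of "z - t"] z e(1) 0 by simp
    then have "f (t + e/2) - f t > 0" unfolding z(3) using e(1) by simp
    then show False using max[of "t + e/2"] by simp
  qed
qed

context
  fixes K :: "(real^2) set" and c :: "real \<Rightarrow> real^2" and T :: real
  assumes K: "compact K" "interior K \<noteq> {}" "strictly_convex K"
    and c: "smooth_closed_curve c T" "frontier K = c ` {0..T}"
    and curv: "\<And>t. curve_curvature c t > 0"
begin

definition "coord m i t = (velocity ^^ m) c t $ i"

lemma coord_deriv: "(coord m i has_real_derivative coord (Suc m) i t) (at t)"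
proof -
  have "((velocity ^^ m) c) differentiable (at t)"
    using c(1) unfolding smooth_closed_curve_def smooth_def by blast
  then have "((velocity ^^ m) c has_vector_derivative (velocity ^^ Suc m) c t) (at t)"
    by (simp add: velocity_def vector_derivative_works)
  then have "((\<lambda>t. (velocity ^^ m) c t $ i) has_vector_derivative (velocity ^^ Suc m) c t $ i) (at t)"
    by (rule bounded_linear.has_vector_derivative[OF bounded_linear_vec_nth])
  then show ?thesis
    by (simp add: has_real_derivative_iff_has_vector_derivative coord_def[abs_def])
qed

lemma Ck_coord: "Ck n (coord m i)"
proof (induction n arbitrary: m)
  case 0
  show ?case unfolding Ck.simps by (rule DERIV_continuous_on[OF has_field_derivative_at_within[OF coord_deriv]])
next
  case (Suc n)
  show ?case by (rule Ck_SucI[OF coord_deriv Suc])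
qed

lemma coord_periodic: "coord m i (t + T) = coord m i t"
proof (induction m arbitrary: t)
  case 0
  show ?case using c(1) by (simp add: coord_def smooth_closed_curve_def)
next
  case (Suc m)
  have "((\<lambda>t. coord m i (t + T)) has_real_derivative coord (Suc m) i (t + T)) (at t)"
    using coord_deriv[of m i "t + T"] by (simp add: DERIV_shift)
  then show ?case using coord_deriv[of m i t] Suc by (auto intro: DERIV_unique)
qed

abbreviation "v1 \<equiv> coord 1 1"
abbreviation "v2 \<equiv> coord 1 2"
abbreviation "a1 \<equiv> coord 2 1"
abbreviation "a2 \<equiv> coord 2 2"

text \<open>With velocity \<open>v\<close> and acceleration \<open>a\<close>, the rate \<open>turn_rate\<close> is the derivative of the direction angle of
  the curve, and \<open>a = accel v + turn_rate J v\<close>, where \<open>J\<close> is the rotation by a right angle. They are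
  rational in the coordinates, so no square roots enter the smoothness argument.\<close>

definition "speed2 t = (v1 t)\<^sup>2 + (v2 t)\<^sup>2"
definition "turn_rate t = (v1 t * a2 t - v2 t * a1 t) * inverse (speed2 t)"
definition "accel t = (v1 t * a1 t + v2 t * a2 t) * inverse (speed2 t)"

lemma speed2_pos: "speed2 t > 0"
proof -
  have "velocity c t \<noteq> 0" using c(1) by (simp add: smooth_closed_curve_def)
  then show ?thesis unfolding speed2_def coord_def
    by (auto simp: vec_eq_iff forall_2 sum_power2_gt_zero_iff)
qed

lemma turn_rate_pos: "turn_rate t > 0"
proof -
  have "velocity c t \<noteq> 0" using c(1) by (simp add: smooth_closed_curve_def)
  then have "v1 t * a2 t - v2 t * a1 t > 0"
    using curv[of t] by (simp add: curve_curvature_def Let_def coord_def zero_less_divide_iff numeral_2_eq_2)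
  then show ?thesis using speed2_pos[of t] by (simp add: turn_rate_def)
qed

lemma Ck_turn_rate: "Ck n turn_rate"
proof -
  have "Ck n speed2"
    unfolding speed2_def[abs_def] power2_eq_square by (intro Ck_add Ck_mult Ck_coord)
  then show ?thesis
    unfolding turn_rate_def[abs_def]
    by (intro Ck_mult Ck_diff Ck_coord Ck_inverse) (simp_all add: less_imp_neq[OF speed2_pos, symmetric])
qed

lemma coord_1_deriv: "(v1 has_real_derivative a1 t) (at t)" "(v2 has_real_derivative a2 t) (at t)"
  using coord_deriv[of 1 _ t] by (simp_all add: numeral_2_eq_2)

lemma accel_decomposition:
  "a1 t = accel t * v1 t - turn_rate t * v2 t" "a2 t = accel t * v2 t + turn_rate t * v1 t"
  using speed2_pos[of t] unfolding accel_def turn_rate_def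
  by (simp_all add: field_simps) (simp_all add: speed2_def power2_eq_square algebra_simps)

lemma on_frontier: "c t \<in> frontier K"
proof -
  have T: "T > 0" using c(1) by (simp add: smooth_closed_curve_def)
  have per: "c (s + T) = c s" for s using c(1) by (simp add: smooth_closed_curve_def)
  interpret periodic_fun_simple c T by standard (rule per)
  define s where "s = t - T * of_int \<lfloor>t / T\<rfloor>"
  have "0 \<le> t / T - of_int \<lfloor>t / T\<rfloor>" "t / T - of_int \<lfloor>t / T\<rfloor> \<le> 1" by linarith+
  then have "0 \<le> T * (t / T - of_int \<lfloor>t / T\<rfloor>)" "T * (t / T - of_int \<lfloor>t / T\<rfloor>) \<le> T * 1"
    using T by (simp, intro mult_left_mono, auto)
  then have "s \<in> {0..T}" using T by (simp add: s_def algebra_simps)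
  moreover have "c t = c s" using minus_of_int[of t "\<lfloor>t / T\<rfloor>"] by (simp add: s_def mult.commute)
  ultimately show ?thesis using c(2) by auto
qed

lemma in_K: "c t \<in> K"
  using on_frontier frontier_subset_closed[OF compact_imp_closed[OF K(1)]] by blast

lemma supporting_normal: 
  obtains \<theta> where "\<And>y. y \<in> K \<Longrightarrow> y \<bullet> unit_vec \<theta> \<le> c t \<bullet> unit_vec \<theta>"
proof -
  have "c t \<notin> rel_interior K"
    using on_frontier[of t] K(2) by (simp add: frontier_def rel_interior_nonempty_interior)
  then obtain a where a: "a \<noteq> 0" "\<And>y. y \<in> K \<Longrightarrow> a \<bullet> c t \<le> a \<bullet> y"
    and "\<And>y. y \<in> rel_interior K \<Longrightarrow> a \<bullet> c t < a \<bullet> y"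
    by (rule supporting_hyperplane_rel_boundary[OF strictly_convex_imp_convex[OF K(3)] in_K]) blast
  obtain \<theta> where "0 \<le> \<theta>" "\<theta> < 2*pi" and \<theta>: "- a = norm (- a) *\<^sub>R unit_vec \<theta>" by (rule polar_unit_vec[of "-a"])
  have "y \<bullet> unit_vec \<theta> \<le> c t \<bullet> unit_vec \<theta>" if "y \<in> K" for y
  proof -
    have eq: "- (x \<bullet> a) = norm a * (x \<bullet> unit_vec \<theta>)" for x
      using arg_cong[OF \<theta>, of "inner x"]
      unfolding inner_scaleR_right inner_minus_right norm_minus_cancel .
    have "norm a * (y \<bullet> unit_vec \<theta>) \<le> norm a * (c t \<bullet> unit_vec \<theta>)"
      using a(2)[OF that] eq[of y] eq[of "c t"] unfolding inner_commute[of a] by linarith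
    then show ?thesis by (rule mult_left_le_imp_le) (simp add: a(1))
  qed
  then show ?thesis by (rule that)
qed

text \<open>The height function in direction \<open>\<theta>\<close> is maximal at the support point. The first-order condition
  determines \<open>\<theta>\<close> up to sign; with positive curvature the second-order condition selects the outward
  normal.\<close>

lemma supporting_normal_conditions:
  assumes "\<And>y. y \<in> K \<Longrightarrow> y \<bullet> unit_vec \<theta> \<le> c t \<bullet> unit_vec \<theta>"
  shows "v1 t * cos \<theta> + v2 t * sin \<theta> = 0" "a1 t * cos \<theta> + a2 t * sin \<theta> \<le> 0"
proof -
  have d: "((\<lambda>s. coord 0 1 s * cos \<theta> + coord 0 2 s * sin \<theta>) has_real_derivative v1 s * cos \<theta> + v2 s * sin \<theta>) (at s)" for s
    using coord_deriv[of 0] by (auto intro!: derivative_eq_intros)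
  have dd: "((\<lambda>s. v1 s * cos \<theta> + v2 s * sin \<theta>) has_real_derivative a1 t * cos \<theta> + a2 t * sin \<theta>) (at t)"
    using coord_1_deriv by (auto intro!: derivative_eq_intros)
  have "coord 0 1 s * cos \<theta> + coord 0 2 s * sin \<theta> \<le> coord 0 1 t * cos \<theta> + coord 0 2 t * sin \<theta>" for s
    using assms[OF in_K[of s]] by (simp add: inner_unit_vec coord_def)
  from second_derivative_nonpos_at_max[OF d dd this]
  show "v1 t * cos \<theta> + v2 t * sin \<theta> = 0" "a1 t * cos \<theta> + a2 t * sin \<theta> \<le> 0" .
qed

text \<open>An antiderivative \<open>\<psi>\<close> of the turning rate, started at a supporting direction, stays normal to the
  curve: the components \<open>g\<close> and \<open>f\<close> of the velocity along \<open>u(\<psi>)\<close> and \<open>u'(\<psi>)\<close> both solve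
  \<open>y' = accel y\<close>, and so does the speed, so \<open>y\<^sup>2 / speed2\<close> is constant. Hence \<open>g = 0\<close>, and \<open>f\<close>
  has no zeros and keeps the sign it has at 0.\<close>

lemma normal_angle:
  obtains \<psi> where "\<And>t. (\<psi> has_real_derivative turn_rate t) (at t)"
    "\<And>t. v1 t * cos (\<psi> t) + v2 t * sin (\<psi> t) = 0"
    "\<And>t. v2 t * cos (\<psi> t) - v1 t * sin (\<psi> t) > 0"
proof -
  have "continuous_on UNIV turn_rate" using Ck_turn_rate[of 0] by simp
  then have "\<exists>F. \<forall>x::real. - \<infinity> < ereal x \<longrightarrow> ereal x < \<infinity> \<longrightarrow> (F has_vector_derivative turn_rate x) (at x)"
    by (intro einterval_antiderivative) (auto simp: continuous_on_eq_continuous_at)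
  then obtain F where F: "\<And>t. (F has_real_derivative turn_rate t) (at t)"
    by (auto simp: has_real_derivative_iff_has_vector_derivative)
  obtain \<theta>0 where \<theta>0: "\<And>y. y \<in> K \<Longrightarrow> y \<bullet> unit_vec \<theta>0 \<le> c 0 \<bullet> unit_vec \<theta>0"
    using supporting_normal[of 0] by blast
  \<comment> \<open>Starting at a supporting direction gives \<open>g 0 = 0\<close> and, by the second-order condition, \<open>f 0 \<ge> 0\<close>.\<close>
  define \<psi> where "\<psi> t = F t - F 0 + \<theta>0" for t
  have \<psi>: "(\<psi> has_real_derivative turn_rate t) (at t)" for t
    unfolding \<psi>_def[abs_def] using F by (auto intro!: derivative_eq_intros)
  define g where "g t = v1 t * cos (\<psi> t) + v2 t * sin (\<psi> t)" for t
  define f where "f t = v2 t * cos (\<psi> t) - v1 t * sin (\<psi> t)" for t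
  have dg: "(g has_real_derivative accel t * g t) (at t)" for t
  proof -
    have "(g has_real_derivative (a1 t * cos (\<psi> t) - v1 t * (sin (\<psi> t) * turn_rate t) + (a2 t * sin (\<psi> t) + v2 t * (cos (\<psi> t) * turn_rate t)))) (at t)"
      unfolding g_def[abs_def] using coord_1_deriv \<psi> by (auto intro!: derivative_eq_intros simp: algebra_simps)
    then show ?thesis by (rule DERIV_cong) (simp add: accel_decomposition g_def algebra_simps)
  qed
  have df: "(f has_real_derivative accel t * f t) (at t)" for t
  proof -
    have "(f has_real_derivative (a2 t * cos (\<psi> t) - v2 t * (sin (\<psi> t) * turn_rate t) - (a1 t * sin (\<psi> t) + v1 t * (cos (\<psi> t) * turn_rate t)))) (at t)"
      unfolding f_def[abs_def] using coord_1_deriv \<psi> by (auto intro!: derivative_eq_intros simp: algebra_simps)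
    then show ?thesis by (rule DERIV_cong) (simp add: accel_decomposition f_def algebra_simps)
  qed
  have ds: "(speed2 has_real_derivative 2 * accel t * speed2 t) (at t)" for t
  proof -
    have "(speed2 has_real_derivative (2 * v1 t * a1 t + 2 * v2 t * a2 t)) (at t)"
      unfolding speed2_def[abs_def] using coord_1_deriv by (auto intro!: derivative_eq_intros)
    then show ?thesis by (rule DERIV_cong) (use speed2_pos[of t] in \<open>simp add: accel_def mult.assoc; simp add: algebra_simps\<close>)
  qed
  have const: "(y t)\<^sup>2 / speed2 t = (y 0)\<^sup>2 / speed2 0" if y: "\<And>t. (y has_real_derivative accel t * y t) (at t)" for y :: "real \<Rightarrow> real" and t
  proof (rule DERIV_isconst_all[of "\<lambda>t. (y t)\<^sup>2 / speed2 t"])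
    show "\<forall>x. ((\<lambda>t. (y t)\<^sup>2 / speed2 t) has_real_derivative 0) (at x)"
      using speed2_pos by (auto intro!: derivative_eq_intros y ds simp: power2_eq_square less_imp_neq[symmetric])
  qed
  have "\<psi> 0 = \<theta>0" by (simp add: \<psi>_def)
  then have g0: "g 0 = 0" and a0: "a1 0 * cos (\<psi> 0) + a2 0 * sin (\<psi> 0) \<le> 0"
    using supporting_normal_conditions[OF \<theta>0] by (simp_all add: g_def)
  have "a1 0 * cos (\<psi> 0) + a2 0 * sin (\<psi> 0) = accel 0 * g 0 - turn_rate 0 * f 0"
    by (simp add: accel_decomposition f_def g_def algebra_simps)
  then have f0: "f 0 \<ge> 0" using a0 g0 turn_rate_pos[of 0] by (simp add: zero_le_mult_iff)
  have g: "g t = 0" for t using const[OF dg, of t] g0 speed2_pos[of t] by auto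
  have fg: "(f t)\<^sup>2 + (g t)\<^sup>2 = speed2 t" for t
  proof -
    have "(f t)\<^sup>2 + (g t)\<^sup>2 = ((v1 t)\<^sup>2 + (v2 t)\<^sup>2) * ((cos (\<psi> t))\<^sup>2 + (sin (\<psi> t))\<^sup>2)"
      unfolding f_def g_def by algebra
    then show ?thesis by (simp add: speed2_def)
  qed
  have fnz: "f t \<noteq> 0" for t using fg[of t] g[of t] speed2_pos[of t] by auto
  have "f t > 0" for t
  proof (rule ccontr)
    assume "\<not> f t > 0"
    then have "f t < 0" using fnz[of t] by simp
    have cf: "continuous_on UNIV f" by (rule DERIV_continuous_on[OF has_field_derivative_at_within[OF df]])
    have "connected (range f)" by (intro connected_continuous_image cf) simp
    then have "0 \<in> range f" using \<open>f t < 0\<close> f0 by (meson connected_contains_Icc less_imp_le rangeI subsetD atLeastAtMost_iff)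
    then show False using fnz by auto
  qed
  then show ?thesis using that[of \<psi>] \<psi> g by (simp add: f_def g_def)
qed

text \<open>Over one period of the curve the normal angle grows by a fixed positive amount, so it is unbounded
  in both directions.\<close>

lemma normal_angle_strict_mono_surj:
  fixes \<psi> :: "real \<Rightarrow> real"
  assumes \<psi>: "\<And>t. (\<psi> has_real_derivative turn_rate t) (at t)"
  shows "strict_mono \<psi>" "surj \<psi>"
proof -
  show mono: "strict_mono \<psi>"
  proof (rule strict_monoI)
    fix s t :: real assume "s < t"
    then show "\<psi> s < \<psi> t"
      by (rule DERIV_pos_imp_increasing) (use \<psi> turn_rate_pos in blast)
  qed
  have T: "T > 0" using c(1) by (simp add: smooth_closed_curve_def)
  define P where "P = \<psi> T - \<psi> 0"
  have P: "P > 0" using mono T by (simp add: P_def strict_mono_less)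
  have per: "turn_rate (t + T) = turn_rate t" for t
    by (simp add: turn_rate_def speed2_def coord_periodic)
  have "\<psi> (t + T) - \<psi> t = \<psi> (0 + T) - \<psi> 0" for t
  proof (rule DERIV_isconst_all[of "\<lambda>t. \<psi> (t + T) - \<psi> t"], intro allI)
    fix t
    have "((\<lambda>t. \<psi> (t + T)) has_real_derivative turn_rate t) (at t)"
      using \<psi>[of "t + T"] by (simp add: DERIV_shift per)
    then show "((\<lambda>t. \<psi> (t + T) - \<psi> t) has_real_derivative 0) (at t)"
      using DERIV_diff[OF _ \<psi>] by fastforce
  qed
  then have step: "\<psi> (t + T) = \<psi> t + P" for t
    unfolding P_def by (simp only: add_0_left diff_eq_eq)
  have up: "\<psi> (real n * T) = \<psi> 0 + real n * P" for n
  proof (induction n)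
    case (Suc n)
    show ?case using step[of "real n * T"] Suc by (simp add: algebra_simps)
  qed simp
  have down: "\<psi> (- (real n * T)) = \<psi> 0 - real n * P" for n
  proof (induction n)
    case (Suc n)
    show ?case using step[of "- (real (Suc n) * T)"] Suc by (simp add: algebra_simps)
  qed simp
  have cont: "continuous_on UNIV \<psi>" by (rule DERIV_continuous_on[OF has_field_derivative_at_within[OF \<psi>]])
  show "surj \<psi>"
  unfolding surj_def
  proof (rule allI)
    fix y
    obtain n where n: "\<bar>y - \<psi> 0\<bar> < real n * P" using P reals_Archimedean3 by blast
    then have "\<psi> (- (real n * T)) \<le> y" "y \<le> \<psi> (real n * T)" unfolding up down by linarith+
    moreover have "- (real n * T) \<le> real n * T" using T by simp
    ultimately obtain x where "\<psi> x = y"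
      using IVT'[OF _ _ _ continuous_on_subset[OF cont subset_UNIV], of "- (real n * T)" y "real n * T"] by blast
    then show "\<exists>x. y = \<psi> x" by blast
  qed
qed

text \<open>The inverse solves \<open>\<tau>' = 1 / turn_rate (\<tau>)\<close>, and a solution of such an equation with smooth right-hand
  side gains one derivative at a time.\<close>

lemma normal_angle_inverse:
  assumes \<psi>: "\<And>t. (\<psi> has_real_derivative turn_rate t) (at t)"
  obtains \<tau> where "\<And>\<theta>. \<psi> (\<tau> \<theta>) = \<theta>"
    "\<And>\<theta>. (\<tau> has_real_derivative inverse (turn_rate (\<tau> \<theta>))) (at \<theta>)" "\<And>n. Ck n \<tau>"
proof -
  note mono = normal_angle_strict_mono_surj(1)[OF \<psi>] and surj = normal_angle_strict_mono_surj(2)[OF \<psi>]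
  define \<tau> where "\<tau> = inv \<psi>"
  have inv1: "\<psi> (\<tau> \<theta>) = \<theta>" for \<theta> unfolding \<tau>_def by (rule surj_f_inv_f[OF surj])
  have inv2: "\<tau> (\<psi> t) = t" for t unfolding \<tau>_def by (rule inv_f_f[OF strict_mono_imp_inj_on[OF mono]])
  have cont: "isCont \<tau> \<theta>" for \<theta>
    using isCont_inverse_function[of 1 "\<tau> \<theta>" \<tau> \<psi>] inv1 inv2 DERIV_isCont[OF \<psi>] by simp
  have d: "(\<tau> has_real_derivative inverse (turn_rate (\<tau> \<theta>))) (at \<theta>)" for \<theta>
    by (rule DERIV_inverse_function[where f = \<psi> and a = "\<theta> - 1" and b = "\<theta> + 1"])
       (use \<psi> inv1 cont turn_rate_pos[of "\<tau> \<theta>"] in auto)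
  have "Ck n \<tau>" for n
  proof (induction n)
    case 0
    show ?case using cont by (simp add: continuous_on_eq_continuous_at)
  next
    case (Suc n)
    have "Ck n (\<lambda>\<theta>. inverse (turn_rate (\<tau> \<theta>)))"
      by (intro Ck_inverse Ck_compose[OF Ck_turn_rate Suc]) (simp add: less_imp_neq[OF turn_rate_pos, symmetric])
    then show ?case by (rule Ck_SucI[OF d])
  qed
  then show ?thesis using that inv1 d by blast
qed

text \<open>Some direction \<open>\<theta>\<close> supports \<open>K\<close> at \<open>c t\<close>, by convexity. Its unit vector is normal to the curve and
  outward, as is that of \<open>\<psi>\<close>, so the two unit vectors agree.\<close>

lemma support_fun_normal_angle:
  assumes g: "v1 t * cos \<psi> + v2 t * sin \<psi> = 0" and f: "v2 t * cos \<psi> - v1 t * sin \<psi> > 0"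
  shows "support_fun K \<psi> = c t \<bullet> unit_vec \<psi>"
proof -
  obtain \<theta> where \<theta>: "\<And>y. y \<in> K \<Longrightarrow> y \<bullet> unit_vec \<theta> \<le> c t \<bullet> unit_vec \<theta>"
    using supporting_normal[of t] by blast
  have cond: "v1 t * cos \<theta> + v2 t * sin \<theta> = 0" "a1 t * cos \<theta> + a2 t * sin \<theta> \<le> 0"
    using supporting_normal_conditions[of \<theta> t] \<theta> by blast+
  let ?f = "v2 t * cos \<psi> - v1 t * sin \<psi>"
  let ?e = "v2 t * cos \<theta> - v1 t * sin \<theta>"
  have "a1 t * cos \<theta> + a2 t * sin \<theta> = accel t * (v1 t * cos \<theta> + v2 t * sin \<theta>) - turn_rate t * ?e"
    by (simp add: accel_decomposition algebra_simps)
  then have e: "?e \<ge> 0" using cond turn_rate_pos[of t] by (simp add: zero_le_mult_iff)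
  have len: "(v2 t * cos x - v1 t * sin x)\<^sup>2 + (v1 t * cos x + v2 t * sin x)\<^sup>2 = speed2 t" for x
  proof -
    have "(v2 t * cos x - v1 t * sin x)\<^sup>2 + (v1 t * cos x + v2 t * sin x)\<^sup>2 = ((v1 t)\<^sup>2 + (v2 t)\<^sup>2) * ((cos x)\<^sup>2 + (sin x)\<^sup>2)"
      by algebra
    then show ?thesis by (simp add: speed2_def)
  qed
  have "?e = ?f"
  proof (rule power2_eq_imp_eq)
    show "?e\<^sup>2 = ?f\<^sup>2" using len[of \<theta>] len[of \<psi>] unfolding g cond(1) by simp
  qed (use e f in simp_all)
  have expand: "speed2 t * cos x = (v2 t * cos x - v1 t * sin x) * v2 t + (v1 t * cos x + v2 t * sin x) * v1 t"
    "speed2 t * sin x = (v1 t * cos x + v2 t * sin x) * v2 t - (v2 t * cos x - v1 t * sin x) * v1 t" for x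
    by (simp_all add: speed2_def power2_eq_square algebra_simps)
  have "speed2 t * cos \<theta> = speed2 t * cos \<psi>" "speed2 t * sin \<theta> = speed2 t * sin \<psi>"
    unfolding expand g cond(1) \<open>?e = ?f\<close> by simp_all
  then have "unit_vec \<theta> = unit_vec \<psi>"
    using speed2_pos[of t] by (simp add: vec_eq_iff forall_2)
  then show ?thesis using support_fun_eqI[OF in_K[of t], of \<theta>] \<theta> by (simp add: support_fun_def)
qed

text \<open>Reparametrized by the normal angle, the curve gives \<open>p(\<theta>) = c(\<tau> \<theta>) \<bullet> u(\<theta>)\<close>. The velocity is orthogonal
  to \<open>u(\<theta>)\<close>, so \<open>p' = c(\<tau> \<theta>) \<bullet> u'(\<theta>)\<close>, and differentiating again \<open>p + p''\<close> is the speed times \<open>\<tau>'\<close>.\<close>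

lemma support_fun_smooth: "Ck n (support_fun K)"
  and radius_of_curvature_pos: "radius_of_curvature K \<theta> > 0"
proof -
  obtain \<psi> where \<psi>: "\<And>t. (\<psi> has_real_derivative turn_rate t) (at t)"
    and g: "\<And>t. v1 t * cos (\<psi> t) + v2 t * sin (\<psi> t) = 0"
    and f: "\<And>t. v2 t * cos (\<psi> t) - v1 t * sin (\<psi> t) > 0"
    using normal_angle by blast
  obtain \<tau> where inv: "\<And>\<theta>. \<psi> (\<tau> \<theta>) = \<theta>"
    and d: "\<And>\<theta>. (\<tau> has_real_derivative inverse (turn_rate (\<tau> \<theta>))) (at \<theta>)" and C: "\<And>n. Ck n \<tau>"
    using normal_angle_inverse[OF \<psi>] by blast
  have g': "v1 (\<tau> \<theta>) * cos \<theta> + v2 (\<tau> \<theta>) * sin \<theta> = 0" and f': "v2 (\<tau> \<theta>) * cos \<theta> - v1 (\<tau> \<theta>) * sin \<theta> > 0" for \<theta>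
    using g[of "\<tau> \<theta>"] f[of "\<tau> \<theta>"] by (simp_all add: inv)
  have p: "support_fun K = (\<lambda>\<theta>. coord 0 1 (\<tau> \<theta>) * cos \<theta> + coord 0 2 (\<tau> \<theta>) * sin \<theta>)"
    using support_fun_normal_angle[OF g' f'] by (auto simp: inner_unit_vec coord_def)
  show "Ck n (support_fun K)"
    unfolding p by (intro Ck_add Ck_mult Ck_cos_sin Ck_compose[OF Ck_coord C])
  have dc: "((\<lambda>\<theta>. coord 0 i (\<tau> \<theta>)) has_real_derivative coord 1 i (\<tau> \<theta>) * inverse (turn_rate (\<tau> \<theta>))) (at \<theta>)" for i \<theta>
    using DERIV_chain2[OF coord_deriv[of 0 i "\<tau> \<theta>"] d] by simp
  have "deriv (support_fun K) \<theta> = coord 0 2 (\<tau> \<theta>) * cos \<theta> - coord 0 1 (\<tau> \<theta>) * sin \<theta>" for \<theta>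
  proof (rule DERIV_imp_deriv)
    have "(support_fun K has_real_derivative
       (coord 1 1 (\<tau> \<theta>) * inverse (turn_rate (\<tau> \<theta>))) * cos \<theta> + (- sin \<theta>) * coord 0 1 (\<tau> \<theta>)
       + ((coord 1 2 (\<tau> \<theta>) * inverse (turn_rate (\<tau> \<theta>))) * sin \<theta> + cos \<theta> * coord 0 2 (\<tau> \<theta>))) (at \<theta>)"
      unfolding p by (rule DERIV_add[OF DERIV_mult[OF dc DERIV_cos] DERIV_mult[OF dc DERIV_sin]])
    then show "(support_fun K has_real_derivative coord 0 2 (\<tau> \<theta>) * cos \<theta> - coord 0 1 (\<tau> \<theta>) * sin \<theta>) (at \<theta>)"
    proof (rule DERIV_cong)
      have "(coord 1 1 (\<tau> \<theta>) * inverse (turn_rate (\<tau> \<theta>))) * cos \<theta> + (coord 1 2 (\<tau> \<theta>) * inverse (turn_rate (\<tau> \<theta>))) * sin \<theta>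
         = inverse (turn_rate (\<tau> \<theta>)) * (v1 (\<tau> \<theta>) * cos \<theta> + v2 (\<tau> \<theta>) * sin \<theta>)"
        by (simp add: algebra_simps)
      then show "(coord 1 1 (\<tau> \<theta>) * inverse (turn_rate (\<tau> \<theta>))) * cos \<theta> + (- sin \<theta>) * coord 0 1 (\<tau> \<theta>)
       + ((coord 1 2 (\<tau> \<theta>) * inverse (turn_rate (\<tau> \<theta>))) * sin \<theta> + cos \<theta> * coord 0 2 (\<tau> \<theta>))
         = coord 0 2 (\<tau> \<theta>) * cos \<theta> - coord 0 1 (\<tau> \<theta>) * sin \<theta>"
        unfolding g' by (simp add: algebra_simps)
    qed
  qed
  then have p': "deriv (support_fun K) = (\<lambda>\<theta>. coord 0 2 (\<tau> \<theta>) * cos \<theta> - coord 0 1 (\<tau> \<theta>) * sin \<theta>)" by blast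
  have p'': "deriv (deriv (support_fun K)) \<theta> = inverse (turn_rate (\<tau> \<theta>)) * (v2 (\<tau> \<theta>) * cos \<theta> - v1 (\<tau> \<theta>) * sin \<theta>) - support_fun K \<theta>"
  proof (rule DERIV_imp_deriv)
    have "(deriv (support_fun K) has_real_derivative
       ((coord 1 2 (\<tau> \<theta>) * inverse (turn_rate (\<tau> \<theta>))) * cos \<theta> + (- sin \<theta>) * coord 0 2 (\<tau> \<theta>))
       - ((coord 1 1 (\<tau> \<theta>) * inverse (turn_rate (\<tau> \<theta>))) * sin \<theta> + cos \<theta> * coord 0 1 (\<tau> \<theta>))) (at \<theta>)"
      unfolding p' by (rule DERIV_diff[OF DERIV_mult[OF dc DERIV_cos] DERIV_mult[OF dc DERIV_sin]])
    then show "(deriv (support_fun K) has_real_derivative inverse (turn_rate (\<tau> \<theta>)) * (v2 (\<tau> \<theta>) * cos \<theta> - v1 (\<tau> \<theta>) * sin \<theta>) - support_fun K \<theta>) (at \<theta>)"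
      by (rule DERIV_cong) (simp add: p algebra_simps)
  qed
  have "radius_of_curvature K \<theta> = inverse (turn_rate (\<tau> \<theta>)) * (v2 (\<tau> \<theta>) * cos \<theta> - v1 (\<tau> \<theta>) * sin \<theta>)"
    by (simp add: radius_of_curvature_def numeral_2_eq_2 p'')
  then show "radius_of_curvature K \<theta> > 0"
    using f'[of \<theta>] turn_rate_pos[of "\<tau> \<theta>"] by (metis positive_imp_inverse_positive mult_pos_pos)
qed

end

section \<open>Circumradius and inradius as balanced means of the support function\<close>

lemma continuous_on_unit_vec: "continuous_on A unit_vec"
proof -
  have "unit_vec = (\<lambda>\<theta>. cos \<theta> *\<^sub>R axis 1 1 + sin \<theta> *\<^sub>R axis 2 1)"
    by (simp add: fun_eq_iff vec_eq_iff forall_2 axis_def)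
  moreover have "continuous_on A (\<lambda>\<theta>. cos \<theta> *\<^sub>R axis 1 1 + sin \<theta> *\<^sub>R axis 2 1 :: real^2)"
    by (intro continuous_intros)
  ultimately show ?thesis by (simp only:)
qed

lemma norm_le_if_unit_vec_le:
  fixes z :: "real^2"
  assumes "\<And>\<theta>. \<theta> \<in> {0..2*pi} \<Longrightarrow> z \<bullet> unit_vec \<theta> \<le> r"
  shows "norm z \<le> r"
proof -
  obtain \<theta> where \<theta>: "0 \<le> \<theta>" "\<theta> < 2*pi" "z = norm z *\<^sub>R unit_vec \<theta>" by (rule polar_unit_vec)
  have "z \<bullet> unit_vec \<theta> = norm z * (unit_vec \<theta> \<bullet> unit_vec \<theta>)"
    using arg_cong[OF \<theta>(3), of "\<lambda>v. v \<bullet> unit_vec \<theta>"] unfolding inner_scaleR_left .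
  then have "z \<bullet> unit_vec \<theta> = norm z"
    by (simp add: norm_eq_1[symmetric])
  with assms[of \<theta>] \<theta> show ?thesis by simp
qed

context
  fixes K :: "(real^2) set"
  assumes K: "compact K" "convex K" "K \<noteq> {}"
begin

lemma subset_cball_if_support_le:
  assumes "\<And>\<theta>. \<theta> \<in> {0..2*pi} \<Longrightarrow> support_fun K \<theta> \<le> y \<bullet> unit_vec \<theta> + r"
  shows "K \<subseteq> cball y r"
proof
  fix x assume "x \<in> K"
  have "(x - y) \<bullet> unit_vec \<theta> \<le> r" if "\<theta> \<in> {0..2*pi}" for \<theta>
    using assms[OF that] support_fun_upper[OF K(1) \<open>x \<in> K\<close>, of \<theta>] by (simp add: inner_diff_left)
  then have "norm (x - y) \<le> r" by (rule norm_le_if_unit_vec_le)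
  then show "x \<in> cball y r" by (simp add: dist_norm norm_minus_commute)
qed

lemma cball_subset_if_support_ge:
  assumes "\<And>\<theta>. \<theta> \<in> {0..2*pi} \<Longrightarrow> y \<bullet> unit_vec \<theta> + r \<le> support_fun K \<theta>"
  shows "cball y r \<subseteq> K"
proof (rule ccontr)
  assume "\<not> cball y r \<subseteq> K"
  then obtain x where x: "norm (x - y) \<le> r" "x \<notin> K" by (metis dist_norm mem_cball norm_minus_commute subsetI)
  obtain a b where ab: "a \<bullet> x < b" "\<And>z. z \<in> K \<Longrightarrow> a \<bullet> z > b"
    using separating_hyperplane_closed_point[OF K(2) compact_imp_closed[OF K(1)] x(2)] by blast
  obtain \<theta> where \<theta>: "0 \<le> \<theta>" "\<theta> < 2*pi" "- a = norm (- a) *\<^sub>R unit_vec \<theta>" by (rule polar_unit_vec)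
  have a: "- (z \<bullet> a) = norm a * (z \<bullet> unit_vec \<theta>)" for z
    using arg_cong[OF \<theta>(3), of "inner z"]
    unfolding inner_scaleR_right inner_minus_right norm_minus_cancel .
  have "a \<noteq> 0" using ab K(3) by fastforce
  then have na: "norm a > 0" by simp
  have "z \<bullet> unit_vec \<theta> \<le> - b / norm a" if "z \<in> K" for z
    unfolding pos_le_divide_eq[OF na]
    using a[of z] ab(2)[OF that] unfolding inner_commute[of a] mult.commute[of _ "norm a"] by linarith
  then have "support_fun K \<theta> \<le> - b / norm a"
    unfolding support_fun_def using K(3) by (intro cSUP_least)
  also have "\<dots> < x \<bullet> unit_vec \<theta>"
    unfolding pos_divide_less_eq[OF na]
    using a[of x] ab(1) unfolding inner_commute[of a] mult.commute[of _ "norm a"] by linarith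
  also have "\<dots> = y \<bullet> unit_vec \<theta> + (x - y) \<bullet> unit_vec \<theta>" by (simp add: inner_diff_left)
  also have "\<dots> \<le> y \<bullet> unit_vec \<theta> + r"
    using norm_cauchy_schwarz[of "x - y" "unit_vec \<theta>"] x(1) by simp
  also have "\<dots> \<le> support_fun K \<theta>" using assms[of \<theta>] \<theta> by simp
  finally show False by simp
qed

lemma circumradius_le:
  assumes "\<And>\<theta>. \<theta> \<in> {0..2*pi} \<Longrightarrow> support_fun K \<theta> \<le> y \<bullet> unit_vec \<theta> + r"
  shows "circumradius K \<le> r"
proof -
  have "K \<subseteq> cball y r" by (rule subset_cball_if_support_le[OF assms])
  moreover from this have "r \<ge> 0" using K(3) by (metis cball_eq_empty linorder_not_le subset_empty)
  ultimately show ?thesis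
    unfolding circumradius_def by (intro cInf_lower bdd_belowI[of _ 0]) auto
qed

lemma enclosing_radius_ge_enclosed:
  assumes "cball x r \<subseteq> K" "K \<subseteq> cball y R" "r \<ge> 0"
  shows "r \<le> R"
proof -
  have "cball x r \<subseteq> cball y R" using assms by blast
  then have "dist x y + r \<le> R" using assms(3) by (simp add: cball_subset_cball_iff)
  then show ?thesis using zero_le_dist[of x y] by linarith
qed

lemma enclosing_disk: obtains y R where "K \<subseteq> cball y R"
  using compact_imp_bounded[OF K(1)] unfolding bounded_subset_cball by blast

lemma inradius_bdd: "bdd_above {r. r \<ge> 0 \<and> (\<exists>x. cball x r \<subseteq> K)}"
proof -
  obtain y R where R: "K \<subseteq> cball y R" by (rule enclosing_disk)
  show ?thesis by (rule bdd_aboveI[of _ R]) (use enclosing_radius_ge_enclosed[OF _ R] in blast)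
qed

lemma inradius_nonneg: "0 \<le> inradius K"
proof -
  obtain x where "x \<in> K" using K(3) by blast
  then show ?thesis unfolding inradius_def
    by (intro cSup_upper inradius_bdd) (auto intro!: exI[of _ x])
qed

lemma inradius_ge:
  assumes "\<And>\<theta>. \<theta> \<in> {0..2*pi} \<Longrightarrow> y \<bullet> unit_vec \<theta> + r \<le> support_fun K \<theta>"
  shows "r \<le> inradius K"
proof (cases "r \<ge> 0")
  case True
  then show ?thesis unfolding inradius_def
    by (intro cSup_upper inradius_bdd) (use cball_subset_if_support_ge[OF assms] in blast)
next
  case False
  then show ?thesis using inradius_nonneg by simp
qed

lemma inradius_le_circumradius: "inradius K \<le> circumradius K"
proof -
  obtain x where "x \<in> K" using K(3) by blast
  then have "{r. r \<ge> 0 \<and> (\<exists>x. cball x r \<subseteq> K)} \<noteq> {}" by (auto intro!: exI[of _ 0] exI[of _ x])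
  moreover obtain y R where R: "K \<subseteq> cball y R" by (rule enclosing_disk)
  have "R \<ge> 0" using R K(3) by (metis cball_eq_empty linorder_not_le subset_empty)
  then have "{r. r \<ge> 0 \<and> (\<exists>x. K \<subseteq> cball x r)} \<noteq> {}" using R by blast
  ultimately show ?thesis
    unfolding inradius_def circumradius_def
    by (intro cSup_least cInf_greatest) (use enclosing_radius_ge_enclosed in blast)+
qed

text \<open>A point \<open>(0, h)\<close> of the convex hull is a convex combination of points \<open>(u(\<theta>), p(\<theta>))\<close>: the first
  component says that the weights are balanced, the second that \<open>h\<close> is the mean of \<open>p\<close>.\<close>

lemma convex_hull_balanced:
  fixes \<Gamma> :: "((real^2) \<times> real) set"
  assumes \<Gamma>: "\<Gamma> = (\<lambda>\<theta>. (unit_vec \<theta>, support_fun K \<theta>)) ` {0..2*pi}" and h: "(0, h) \<in> convex hull \<Gamma>"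
  obtains I w x where "balanced I w x" "h = (\<Sum>i\<in>I. w i * support_fun K (x i))"
proof -
  obtain k u p where p: "\<forall>i\<in>{1::nat..k}. 0 \<le> u i \<and> p i \<in> \<Gamma>" and sum: "sum u {1..k} = 1"
    and eq: "(\<Sum>i=1..k. u i *\<^sub>R p i) = (0, h)"
    using h unfolding convex_hull_indexed by blast
  have "\<forall>i\<in>{1..k}. \<exists>\<theta>. \<theta> \<in> {0..2*pi} \<and> p i = (unit_vec \<theta>, support_fun K \<theta>)"
    using p \<Gamma> by blast
  then obtain x where x: "\<And>i. i \<in> {1..k} \<Longrightarrow> x i \<in> {0..2*pi} \<and> p i = (unit_vec (x i), support_fun K (x i))"
    by metis
  have eq': "(\<Sum>i=1..k. u i *\<^sub>R (unit_vec (x i), support_fun K (x i))) = (0, h)"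
    using x by (subst eq[symmetric], intro sum.cong) auto
  have "(\<Sum>i=1..k. u i *\<^sub>R unit_vec (x i)) = 0"
    using arg_cong[OF eq', of fst] by (simp add: fst_sum)
  then have "(\<Sum>i=1..k. u i * cos (x i)) = 0" "(\<Sum>i=1..k. u i * sin (x i)) = 0"
    unfolding vec_eq_iff forall_2 by (simp_all add: sum_component)
  then have "(\<Sum>i=1..k. complex_of_real (u i) * cis (x i)) = 0"
    by (simp add: complex_eq_iff Re_sum Im_sum)
  then have "balanced {1..k} u x" using p x sum by (simp add: balanced_def)
  moreover have "h = (\<Sum>i=1..k. u i * support_fun K (x i))"
    using arg_cong[OF eq', of snd] by (simp add: snd_sum)
  ultimately show ?thesis by (rule that)
qed

text \<open>Let \<open>h1\<close> and \<open>h2\<close> be the largest and smallest heights of the hull above the origin. A point just above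
  height \<open>h1\<close> can be separated from the hull; the separating plane is a graph
  \<open>y \<bullet> u + r\<close> above the curve, that is, a disk of radius \<open>r\<close> about \<open>y\<close> containing \<open>K\<close>. In the same way a
  point just below \<open>h2\<close> yields a disk inside \<open>K\<close>.\<close>

lemma radii_as_balanced_means:
  assumes cont: "continuous_on {0..2*pi} (support_fun K)"
  obtains I w x J v y where "balanced I w x" "balanced J v y"
    "circumradius K \<le> (\<Sum>i\<in>I. w i * support_fun K (x i))"
    "(\<Sum>j\<in>J. v j * support_fun K (y j)) \<le> inradius K"
proof -
  define \<Gamma> where "\<Gamma> = (\<lambda>\<theta>. (unit_vec \<theta>, support_fun K \<theta>)) ` {0..2*pi}"
  define H where "H = convex hull \<Gamma>"
  have "compact \<Gamma>" unfolding \<Gamma>_def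
    by (intro compact_continuous_image continuous_on_Pair continuous_on_unit_vec cont compact_Icc)
  then have H: "compact H" "convex H" unfolding H_def by (simp_all add: compact_convex_hull)
  have "H \<inter> ({0} \<times> UNIV) \<noteq> {}"
  proof -
    have "(unit_vec 0, support_fun K 0) \<in> H" "(unit_vec pi, support_fun K pi) \<in> H"
      unfolding H_def \<Gamma>_def by (intro hull_inc imageI; simp)+
    then have "(1/2) *\<^sub>R (unit_vec 0, support_fun K 0) + (1/2) *\<^sub>R (unit_vec pi, support_fun K pi) \<in> H"
      by (intro convexD[OF H(2)]) auto
    moreover have "(1/2::real) *\<^sub>R unit_vec 0 + (1/2::real) *\<^sub>R unit_vec pi = 0"
      by (simp add: vec_eq_iff forall_2)
    ultimately show ?thesis by auto
  qed
  then have ne: "snd ` (H \<inter> ({0} \<times> UNIV)) \<noteq> {}" by simp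
  have "compact (H \<inter> ({0} \<times> UNIV))"
    by (intro compact_Int_closed H closed_Times) auto
  then have cpt: "compact (snd ` (H \<inter> ({0} \<times> UNIV)))"
    by (intro compact_continuous_image continuous_intros)
  have mem: "h \<in> snd ` (H \<inter> ({0} \<times> UNIV)) \<longleftrightarrow> (0, h) \<in> H" for h by force
  obtain h1 where h1: "(0, h1) \<in> H" "\<And>h. (0, h) \<in> H \<Longrightarrow> h \<le> h1"
    using compact_attains_sup[OF cpt ne] mem by metis
  obtain h2 where h2: "(0, h2) \<in> H" "\<And>h. (0, h) \<in> H \<Longrightarrow> h2 \<le> h"
    using compact_attains_inf[OF cpt ne] mem by metis
  have sep: "\<exists>a b. b * h < b * h' \<and> (\<forall>\<theta>\<in>{0..2*pi}. b * h < a \<bullet> unit_vec \<theta> + b * support_fun K \<theta>)"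
    if h: "(0, h) \<notin> H" "(0, h') \<in> H" for h h'
  proof -
    obtain n d where nd: "n \<bullet> (0, h) < d" "\<And>z. z \<in> H \<Longrightarrow> n \<bullet> z > d"
      using separating_hyperplane_closed_point[OF H(2) compact_imp_closed[OF H(1)] h(1)] by blast
    obtain a b where n: "n = (a, b)" by (cases n)
    have "b * h < b * h'" using nd(1) nd(2)[OF h(2)] by (simp add: n)
    moreover have "b * h < a \<bullet> unit_vec \<theta> + b * support_fun K \<theta>" if "\<theta> \<in> {0..2*pi}" for \<theta>
    proof -
      have "(unit_vec \<theta>, support_fun K \<theta>) \<in> H"
        unfolding H_def \<Gamma>_def by (intro hull_inc imageI that)
      from nd(2)[OF this] nd(1) show ?thesis by (simp add: n)
    qed
    ultimately show ?thesis by blast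
  qed
  have "circumradius K \<le> h1 + e" if "e > 0" for e
  proof -
    have "(0, h1 + e) \<notin> H" using h1(2)[of "h1 + e"] that by auto
    from sep[OF this h1(1)] obtain a b where ab: "b * (h1 + e) < b * h1"
      "\<And>\<theta>. \<theta> \<in> {0..2*pi} \<Longrightarrow> b * (h1 + e) < a \<bullet> unit_vec \<theta> + b * support_fun K \<theta>" by blast
    have b: "b < 0" using ab(1) that by (simp add: algebra_simps mult_less_0_iff)
    show ?thesis
    proof (rule circumradius_le)
      fix \<theta> :: real assume "\<theta> \<in> {0..2*pi}"
      from ab(2)[OF this] have "(- b) * support_fun K \<theta> \<le> (- b) * (((- 1 / b) *\<^sub>R a) \<bullet> unit_vec \<theta> + (h1 + e))"
        using b by (simp add: algebra_simps)
      then show "support_fun K \<theta> \<le> ((- 1 / b) *\<^sub>R a) \<bullet> unit_vec \<theta> + (h1 + e)"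
        by (rule mult_left_le_imp_le) (use b in simp)
    qed
  qed
  then have r1: "circumradius K \<le> h1" by (rule field_le_epsilon)
  have "h2 \<le> inradius K + e" if "e > 0" for e
  proof -
    have "(0, h2 - e) \<notin> H" using h2(2)[of "h2 - e"] that by auto
    from sep[OF this h2(1)] obtain a b where ab: "b * (h2 - e) < b * h2"
      "\<And>\<theta>. \<theta> \<in> {0..2*pi} \<Longrightarrow> b * (h2 - e) < a \<bullet> unit_vec \<theta> + b * support_fun K \<theta>" by blast
    have b: "b > 0" using ab(1) that by (simp add: algebra_simps zero_less_mult_iff)
    have "h2 - e \<le> inradius K"
    proof (rule inradius_ge)
      fix \<theta> :: real assume "\<theta> \<in> {0..2*pi}"
      from ab(2)[OF this] have "b * (((- 1 / b) *\<^sub>R a) \<bullet> unit_vec \<theta> + (h2 - e)) \<le> b * support_fun K \<theta>"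
        using b by (simp add: algebra_simps)
      then show "((- 1 / b) *\<^sub>R a) \<bullet> unit_vec \<theta> + (h2 - e) \<le> support_fun K \<theta>"
        by (rule mult_left_le_imp_le) (use b in simp)
    qed
    then show ?thesis by simp
  qed
  then have r2: "h2 \<le> inradius K" by (rule field_le_epsilon)
  obtain I w x where 1: "balanced I w x" "h1 = (\<Sum>i\<in>I. w i * support_fun K (x i))"
    by (rule convex_hull_balanced[OF \<Gamma>_def h1(1)[unfolded H_def]])
  obtain J v y where 2: "balanced J v y" "h2 = (\<Sum>i\<in>J. v i * support_fun K (y i))"
    by (rule convex_hull_balanced[OF \<Gamma>_def h2(1)[unfolded H_def]])
  show ?thesis using that[OF 1(1) 2(1)] r1 r2 1(2) 2(2) by simp
qed

end

section \<open>Spectral inequalities\<close>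

lemma deriv_periodic:
  assumes "\<And>t. (f has_real_derivative deriv f t) (at t)" and per: "\<And>t. f (t + T) = f t"
  shows "deriv f (t + T) = deriv f t"
proof -
  have "((\<lambda>t. f (t + T)) has_real_derivative deriv f (t + T)) (at t)"
    using assms(1)[of "t + T"] by (simp add: DERIV_shift)
  then show ?thesis using assms(1)[of t] per by (auto intro: DERIV_unique)
qed

lemma fourier_coeff_0: "fourier_coeff f 0 = complex_of_real (integral {0..2*pi} f / pi)"
  if "continuous_on {0..2*pi} f"
proof -
  have "integral {0..2*pi} (\<lambda>t. complex_of_real (f t)) = complex_of_real (integral {0..2*pi} f)"
    using integral_linear[OF integrable_continuous_interval[OF that] bounded_linear_of_real]
    by (simp add: o_def)
  then show ?thesis by (simp add: fourier_coeff_def scaleR_conv_of_real)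
qed

lemma fourier_coeff_1:
  assumes f: "continuous_on {0..2*pi} f"
  shows "integral {0..2*pi} (\<lambda>t. f t * cos t) = pi * Re (fourier_coeff f 1)"
    "integral {0..2*pi} (\<lambda>t. f t * sin t) = - pi * Im (fourier_coeff f 1)"
proof -
  note int = fourier_coeff_integrable[OF f, of 1]
  have "integral {0..2*pi} (\<lambda>t. Re (complex_of_real (f t) * cis (-(real 1 * t)))) = pi * Re (fourier_coeff f 1)"
    using integral_linear[OF int bounded_linear_Re] unfolding o_def fourier_coeff_def by simp
  then show "integral {0..2*pi} (\<lambda>t. f t * cos t) = pi * Re (fourier_coeff f 1)" by simp
  have "integral {0..2*pi} (\<lambda>t. Im (complex_of_real (f t) * cis (-(real 1 * t)))) = pi * Im (fourier_coeff f 1)"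
    using integral_linear[OF int bounded_linear_Im] unfolding o_def fourier_coeff_def by simp
  then show "integral {0..2*pi} (\<lambda>t. f t * sin t) = - pi * Im (fourier_coeff f 1)" by simp
qed

lemma Ck_continuous: "Ck n f \<Longrightarrow> continuous_on A f"
proof (induction n)
  case 0
  then show ?case using continuous_on_subset by auto
qed (blast dest: Ck_SucD)

text \<open>For the deviation of a support function from the Steiner disk, the energies below are
  the isoperimetric deficit \<open>(L\<^sup>2 - 4 \<pi> A) / (2 \<pi>\<^sup>2)\<close>, the integral \<open>1/\<pi> \<integral>(\<rho> - a)\<^sup>2\<close>
  with the mean radius of curvature \<open>a\<close>, and \<open>1/\<pi> \<integral>\<rho>\<^sub>\<beta>\<^sup>2\<close>.\<close>

definition coeff_energy :: "(nat \<Rightarrow> real) \<Rightarrow> (real \<Rightarrow> real) \<Rightarrow> real" where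
  "coeff_energy w q = (\<Sum>n. w n * (norm (fourier_coeff q n))\<^sup>2)"

abbreviation "deficit \<equiv> coeff_energy (\<lambda>n. (real n)\<^sup>2 - 1)"
abbreviation "radius_energy \<equiv> coeff_energy (\<lambda>n. ((real n)\<^sup>2 - 1)\<^sup>2)"
abbreviation "evolute_energy \<equiv> coeff_energy (\<lambda>n. (real n)\<^sup>2 * ((real n)\<^sup>2 - 1)\<^sup>2)"

context
  fixes q :: "real \<Rightarrow> real"
  assumes q: "\<And>n. Ck n q" and per: "\<And>t. q (t + 2*pi) = q t"
    and low: "fourier_coeff q 0 = 0" "fourier_coeff q 1 = 0"
begin

lemma Ck_funpow_deriv: "Ck n ((deriv ^^ k) q)"
proof (induction k arbitrary: n)
  case (Suc k)
  show ?case using Ck_deriv[OF Suc] by simp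
qed (simp add: q)

lemma periodic_funpow_deriv: "(deriv ^^ k) q (t + 2*pi) = (deriv ^^ k) q t"
proof (induction k arbitrary: t)
  case (Suc k)
  show ?case using deriv_periodic[OF Ck_has_deriv[OF Ck_funpow_deriv] Suc] by simp
qed (simp add: per)

lemma fourier_coeff_funpow_deriv: "fourier_coeff ((deriv ^^ k) q) n = (\<i> * of_nat n) ^ k * fourier_coeff q n"
proof (induction k)
  case (Suc k)
  have "fourier_coeff (deriv ((deriv ^^ k) q)) n = \<i> * of_nat n * fourier_coeff ((deriv ^^ k) q) n"
    by (rule fourier_coeff_deriv)
       (use Ck_has_deriv[OF Ck_funpow_deriv] Ck_continuous[OF Ck_funpow_deriv[of 0 "Suc k"]]
          periodic_funpow_deriv[of k 0] in simp_all)
  then show ?case using Suc by simp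
qed simp

text \<open>The coefficients of the derivative of order \<open>k + 2\<close> are bounded.\<close>

lemma fourier_coeff_decay: "summable (\<lambda>n. real n ^ k * norm (fourier_coeff q n))"
proof -
  obtain B where B: "B > 0" "\<And>n. norm (fourier_coeff ((deriv ^^ (k+2)) q) n) \<le> B"
    using fourier_coeff_bounded[OF Ck_continuous[OF Ck_funpow_deriv[of 0]]] by blast
  show ?thesis
  proof (rule summable_comparison_test')
    show "summable (\<lambda>n. B * inverse ((real n)\<^sup>2))"
      by (intro summable_mult inverse_power_summable) simp
    fix n :: nat assume "n \<ge> 1"
    have "real n ^ (k+2) * norm (fourier_coeff q n) \<le> B"
      using B(2)[of n] unfolding fourier_coeff_funpow_deriv by (simp add: norm_mult norm_power)
    then have "(real n)\<^sup>2 * (real n ^ k * norm (fourier_coeff q n)) \<le> B"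
      by (simp add: power_add power2_eq_square mult_ac)
    then show "norm (real n ^ k * norm (fourier_coeff q n)) \<le> B * inverse ((real n)\<^sup>2)"
      using \<open>n \<ge> 1\<close> by (simp add: field_simps)
  qed
qed

lemma low_coeff: "n < 2 \<Longrightarrow> fourier_coeff q n = 0"
  using low by (auto simp: less_2_cases_iff)

lemma summable_coeff: "summable (\<lambda>n. norm (fourier_coeff q n))"
  using fourier_coeff_decay[of 0] by simp

lemma coeff_energy_sums:
  assumes "\<And>n. n \<ge> 2 \<Longrightarrow> \<bar>w n\<bar> \<le> real n ^ 6"
  shows "(\<lambda>n. w n * (norm (fourier_coeff q n))\<^sup>2) sums coeff_energy w q"
proof -
  obtain B where B: "B > 0" "\<And>n. norm (fourier_coeff q n) \<le> B"
    using fourier_coeff_bounded[OF Ck_continuous[OF q[of 0]]] by blast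
  have "summable (\<lambda>n. w n * (norm (fourier_coeff q n))\<^sup>2)"
  proof (rule summable_comparison_test')
    show "summable (\<lambda>n. (real n ^ 6 * norm (fourier_coeff q n)) * B)"
      by (intro summable_mult2 fourier_coeff_decay)
    fix n :: nat assume "n \<ge> 2"
    then have "\<bar>w n\<bar> * norm (fourier_coeff q n) * norm (fourier_coeff q n) \<le> real n ^ 6 * norm (fourier_coeff q n) * B"
      by (intro mult_mono B assms) auto
    then show "norm (w n * (norm (fourier_coeff q n))\<^sup>2) \<le> (real n ^ 6 * norm (fourier_coeff q n)) * B"
      by (simp add: abs_mult power2_eq_square mult.assoc)
  qed
  then show ?thesis unfolding coeff_energy_def by (rule summable_sums)
qed

lemma square_weight_bounds:
  assumes "n \<ge> 2"
  shows "3 \<le> (real n)\<^sup>2 - 1" "(real n)\<^sup>2 - 1 \<le> (real n)\<^sup>2" "4 \<le> (real n)\<^sup>2"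
  using power_mono[of 2 "real n" 2] assms by simp_all

lemma energies_sums:
  "(\<lambda>n. ((real n)\<^sup>2 - 1) * (norm (fourier_coeff q n))\<^sup>2) sums deficit q"
  "(\<lambda>n. ((real n)\<^sup>2 - 1)\<^sup>2 * (norm (fourier_coeff q n))\<^sup>2) sums radius_energy q"
  "(\<lambda>n. ((real n)\<^sup>2 * ((real n)\<^sup>2 - 1)\<^sup>2) * (norm (fourier_coeff q n))\<^sup>2) sums evolute_energy q"
proof -
  show "(\<lambda>n. ((real n)\<^sup>2 - 1) * (norm (fourier_coeff q n))\<^sup>2) sums deficit q"
  proof (rule coeff_energy_sums)
    fix n :: nat assume n: "n \<ge> 2"
    have "(real n)\<^sup>2 \<le> real n ^ 6" using n by (intro power_increasing) auto
    then show "\<bar>(real n)\<^sup>2 - 1\<bar> \<le> real n ^ 6" using square_weight_bounds[OF n] by simp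
  qed
  show "(\<lambda>n. ((real n)\<^sup>2 - 1)\<^sup>2 * (norm (fourier_coeff q n))\<^sup>2) sums radius_energy q"
  proof (rule coeff_energy_sums)
    fix n :: nat assume n: "n \<ge> 2"
    have "((real n)\<^sup>2 - 1)\<^sup>2 \<le> ((real n)\<^sup>2)\<^sup>2" using square_weight_bounds[OF n] by (intro power_mono) auto
    also have "\<dots> \<le> real n ^ 6" using n by (simp flip: power_mult)
    finally show "\<bar>((real n)\<^sup>2 - 1)\<^sup>2\<bar> \<le> real n ^ 6" by simp
  qed
  show "(\<lambda>n. ((real n)\<^sup>2 * ((real n)\<^sup>2 - 1)\<^sup>2) * (norm (fourier_coeff q n))\<^sup>2) sums evolute_energy q"
  proof (rule coeff_energy_sums)
    fix n :: nat assume n: "n \<ge> 2"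
    have "(real n)\<^sup>2 * ((real n)\<^sup>2 - 1)\<^sup>2 \<le> (real n)\<^sup>2 * ((real n)\<^sup>2)\<^sup>2"
      using square_weight_bounds[OF n] by (intro mult_left_mono power_mono) auto
    also have "\<dots> = real n ^ 6" by (simp flip: power_mult power_add)
    finally show "\<bar>(real n)\<^sup>2 * ((real n)\<^sup>2 - 1)\<^sup>2\<bar> \<le> real n ^ 6" by (simp add: abs_mult)
  qed
qed

lemma energy_le:
  assumes "\<And>n. n \<ge> 2 \<Longrightarrow> w n \<le> v n"
    "(\<lambda>n. w n * (norm (fourier_coeff q n))\<^sup>2) sums s" "(\<lambda>n. v n * (norm (fourier_coeff q n))\<^sup>2) sums t"
  shows "s \<le> t"
proof (rule sums_le[OF _ assms(2,3)])
  fix n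
  show "w n * (norm (fourier_coeff q n))\<^sup>2 \<le> v n * (norm (fourier_coeff q n))\<^sup>2"
    using assms(1)[of n] low_coeff[of n] by (cases "n \<ge> 2") (auto intro: mult_right_mono)
qed

lemma deficit_nonneg: "0 \<le> deficit q"
proof (rule energy_le[OF _ _ energies_sums(1)])
  show "(\<lambda>n. 0 * (norm (fourier_coeff q n))\<^sup>2) sums 0" by simp
qed (use square_weight_bounds in force)

lemma deficit_le_radius_energy: "3 * deficit q \<le> radius_energy q"
proof (rule energy_le[OF _ _ energies_sums(2)])
  show "(\<lambda>n. (3 * ((real n)\<^sup>2 - 1)) * (norm (fourier_coeff q n))\<^sup>2) sums (3 * deficit q)"
    using sums_mult[OF energies_sums(1), of 3] by (simp only: mult.assoc)
  show "3 * ((real n)\<^sup>2 - 1) \<le> ((real n)\<^sup>2 - 1)\<^sup>2" if "n \<ge> 2" for n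
    using square_weight_bounds[OF that] unfolding power2_eq_square[of "(real n)\<^sup>2 - 1"]
    by (intro mult_right_mono) auto
qed

lemma radius_energy_le_evolute_energy: "4 * radius_energy q \<le> evolute_energy q"
proof (rule energy_le[OF _ _ energies_sums(3)])
  show "(\<lambda>n. (4 * ((real n)\<^sup>2 - 1)\<^sup>2) * (norm (fourier_coeff q n))\<^sup>2) sums (4 * radius_energy q)"
    using sums_mult[OF energies_sums(2), of 4] by (simp only: mult.assoc)
  show "4 * ((real n)\<^sup>2 - 1)\<^sup>2 \<le> (real n)\<^sup>2 * ((real n)\<^sup>2 - 1)\<^sup>2" if "n \<ge> 2" for n
    using square_weight_bounds[OF that] by (intro mult_right_mono) auto
qed

abbreviation "radius_part t \<equiv> q t + deriv (deriv q) t"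
abbreviation "radius_part' t \<equiv> deriv q t + deriv (deriv (deriv q)) t"

lemma continuous_parts:
  "continuous_on A q" "continuous_on A (deriv q)" "continuous_on A (deriv (deriv q))"
  "continuous_on A (deriv (deriv (deriv q)))"
  using Ck_continuous[OF Ck_funpow_deriv[of 0 0]] Ck_continuous[OF Ck_funpow_deriv[of 0 1]]
    Ck_continuous[OF Ck_funpow_deriv[of 0 2]] Ck_continuous[OF Ck_funpow_deriv[of 0 3]]
  by (simp_all add: numeral_2_eq_2 numeral_3_eq_3)

lemma periodic_parts:
  "q 0 = q (2*pi)" "deriv q 0 = deriv q (2*pi)" "deriv (deriv q) 0 = deriv (deriv q) (2*pi)"
  "deriv (deriv (deriv q)) 0 = deriv (deriv (deriv q)) (2*pi)"
  using periodic_funpow_deriv[of 0 0] periodic_funpow_deriv[of 1 0]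
    periodic_funpow_deriv[of 2 0] periodic_funpow_deriv[of 3 0]
  by (simp_all add: numeral_2_eq_2 numeral_3_eq_3)

lemma fourier_coeff_parts:
  "fourier_coeff (deriv q) n = \<i> * of_nat n * fourier_coeff q n"
  "fourier_coeff radius_part n = of_real (1 - (real n)\<^sup>2) * fourier_coeff q n"
  "fourier_coeff radius_part' n = \<i> * of_real (real n * (1 - (real n)\<^sup>2)) * fourier_coeff q n"
proof -
  have d: "fourier_coeff (deriv q) n = \<i> * of_nat n * fourier_coeff q n"
    "fourier_coeff (deriv (deriv q)) n = - (of_nat n)\<^sup>2 * fourier_coeff q n"
    "fourier_coeff (deriv (deriv (deriv q))) n = - \<i> * (of_nat n)^3 * fourier_coeff q n"
    using fourier_coeff_funpow_deriv[of 1 n] fourier_coeff_funpow_deriv[of 2 n] fourier_coeff_funpow_deriv[of 3 n]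
    by (simp_all add: numeral_2_eq_2 numeral_3_eq_3 algebra_simps)
  show "fourier_coeff (deriv q) n = \<i> * of_nat n * fourier_coeff q n" by (rule d)
  show "fourier_coeff radius_part n = of_real (1 - (real n)\<^sup>2) * fourier_coeff q n"
    by (simp add: fourier_coeff_add[OF continuous_parts(1,3)] d algebra_simps)
  show "fourier_coeff radius_part' n = \<i> * of_real (real n * (1 - (real n)\<^sup>2)) * fourier_coeff q n"
    by (simp add: fourier_coeff_add[OF continuous_parts(2,4)] d algebra_simps power2_eq_square power3_eq_cube)
qed

lemma summable_weighted_coeff:
  assumes "\<And>n. norm (fourier_coeff f n) \<le> C * (real n ^ k * norm (fourier_coeff q n))"
  shows "summable (\<lambda>n. norm (fourier_coeff f n))"
proof (rule summable_comparison_test')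
  show "summable (\<lambda>n. C * (real n ^ k * norm (fourier_coeff q n)))"
    by (intro summable_mult fourier_coeff_decay)
qed (use assms in simp)

lemma summable_parts:
  "summable (\<lambda>n. norm (fourier_coeff (deriv q) n))"
  "summable (\<lambda>n. norm (fourier_coeff radius_part n))"
  "summable (\<lambda>n. norm (fourier_coeff radius_part' n))"
proof -
  have 1: "\<bar>1 - (real n)\<^sup>2\<bar> * norm (fourier_coeff q n) \<le> real n ^ 2 * norm (fourier_coeff q n)" for n
    using low_coeff[of n] square_weight_bounds[of n] by (cases "n \<ge> 2") (auto intro!: mult_right_mono)
  show "summable (\<lambda>n. norm (fourier_coeff (deriv q) n))"
    by (rule summable_weighted_coeff[of _ 1 1]) (simp add: fourier_coeff_parts norm_mult)
  show "summable (\<lambda>n. norm (fourier_coeff radius_part n))"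
    by (rule summable_weighted_coeff[of _ 1 2]) (use 1 in \<open>simp add: fourier_coeff_parts norm_mult del: of_real_diff\<close>)
  show "summable (\<lambda>n. norm (fourier_coeff radius_part' n))"
  proof (rule summable_weighted_coeff[of _ 1 3])
    fix n
    have "real n * (\<bar>1 - (real n)\<^sup>2\<bar> * norm (fourier_coeff q n)) \<le> real n * (real n ^ 2 * norm (fourier_coeff q n))"
      by (intro mult_left_mono 1) auto
    then show "norm (fourier_coeff radius_part' n) \<le> 1 * (real n ^ 3 * norm (fourier_coeff q n))"
      by (simp add: fourier_coeff_parts norm_mult abs_mult power2_eq_square power3_eq_cube mult.assoc del: of_real_diff of_real_mult)
  qed
qed

lemma fourier_coeff_parts_low:
  "fourier_coeff (deriv q) 0 = 0" "fourier_coeff radius_part 0 = 0" "fourier_coeff radius_part' 0 = 0"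
  "fourier_coeff radius_part 1 = 0" "fourier_coeff radius_part' 1 = 0"
  using low by (simp_all add: fourier_coeff_parts)

text \<open>Each identity is Parseval's, with \<open>n\<^sup>2 (1 - n\<^sup>2) = - ((n\<^sup>2 - 1)\<^sup>2 + (n\<^sup>2 - 1))\<close> in the third.\<close>

lemma integral_parts:
  "integral {0..2*pi} (\<lambda>t. q t * radius_part t) = - pi * deficit q"
  "integral {0..2*pi} (\<lambda>t. radius_part t * radius_part t) = pi * radius_energy q"
  "integral {0..2*pi} (\<lambda>t. deriv q t * radius_part' t) = - pi * (radius_energy q + deficit q)"
  "integral {0..2*pi} (\<lambda>t. radius_part' t * radius_part' t) = pi * evolute_energy q"
proof -
  let ?z = "fourier_coeff q"
  have sq: "Re (?z n) * Re (?z n) + Im (?z n) * Im (?z n) = (norm (?z n))\<^sup>2" for n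
    unfolding cmod_power2 by (simp add: power2_eq_square)
  have c: "continuous_on {0..2*pi} radius_part" "continuous_on {0..2*pi} radius_part'"
    by (intro continuous_intros continuous_parts)+
  have p: "radius_part 0 = radius_part (2*pi)" "radius_part' 0 = radius_part' (2*pi)"
    using periodic_parts by simp_all
  have e1: "pi * Re (?z n * cnj (fourier_coeff radius_part n)) = - pi * (((real n)\<^sup>2 - 1) * (norm (?z n))\<^sup>2)" for n
    unfolding fourier_coeff_parts sq[symmetric] by (simp add: algebra_simps)
  have e2: "pi * Re (fourier_coeff radius_part n * cnj (fourier_coeff radius_part n)) = pi * (((real n)\<^sup>2 - 1)\<^sup>2 * (norm (?z n))\<^sup>2)" for n
    unfolding fourier_coeff_parts sq[symmetric] by (simp add: algebra_simps power2_eq_square)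
  have e3: "pi * Re (fourier_coeff (deriv q) n * cnj (fourier_coeff radius_part' n)) =
      - pi * (((real n)\<^sup>2 - 1)\<^sup>2 * (norm (?z n))\<^sup>2 + ((real n)\<^sup>2 - 1) * (norm (?z n))\<^sup>2)" for n
    unfolding fourier_coeff_parts sq[symmetric] by (simp add: algebra_simps power2_eq_square)
  have e4: "pi * Re (fourier_coeff radius_part' n * cnj (fourier_coeff radius_part' n)) =
      pi * (((real n)\<^sup>2 * ((real n)\<^sup>2 - 1)\<^sup>2) * (norm (?z n))\<^sup>2)" for n
    unfolding fourier_coeff_parts sq[symmetric] by (simp add: algebra_simps power2_eq_square)
  show "integral {0..2*pi} (\<lambda>t. q t * radius_part t) = - pi * deficit q"
    using sums_unique2[OF parseval[OF continuous_parts(1) periodic_parts(1) low(1) summable_coeff c(1), unfolded e1]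
        sums_mult[OF energies_sums(1)]] .
  show "integral {0..2*pi} (\<lambda>t. radius_part t * radius_part t) = pi * radius_energy q"
    using sums_unique2[OF parseval[OF c(1) p(1) fourier_coeff_parts_low(2) summable_parts(2) c(1), unfolded e2]
        sums_mult[OF energies_sums(2)]] .
  show "integral {0..2*pi} (\<lambda>t. deriv q t * radius_part' t) = - pi * (radius_energy q + deficit q)"
    using sums_unique2[OF parseval[OF continuous_parts(2) periodic_parts(2) fourier_coeff_parts_low(1) summable_parts(1) c(2), unfolded e3]
        sums_mult[OF sums_add[OF energies_sums(2,1)]]] .
  show "integral {0..2*pi} (\<lambda>t. radius_part' t * radius_part' t) = pi * evolute_energy q"
    using sums_unique2[OF parseval[OF c(2) p(2) fourier_coeff_parts_low(3) summable_parts(3) c(2), unfolded e4]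
        sums_mult[OF energies_sums(3)]] .
qed

lemma integral_radius_part: "integral {0..2*pi} radius_part = 0"
  using fourier_coeff_0[of radius_part] fourier_coeff_parts_low(2) continuous_parts
  by (simp add: continuous_on_add)

text \<open>A function \<open>f\<close> with mean zero and values in \<open>[lo, hi]\<close> has mean square at most \<open>- lo hi\<close>, by integrating
  \<open>(hi - f) (f - lo) \<ge> 0\<close>.\<close>

lemma radius_energy_le_oscillation:
  assumes "\<And>t. t \<in> {0..2*pi} \<Longrightarrow> lo \<le> radius_part t \<and> radius_part t \<le> hi"
  shows "2 * radius_energy q \<le> (hi - lo)\<^sup>2"
proof -
  have c: "continuous_on {0..2*pi} radius_part"
    by (intro continuous_intros continuous_parts)
  have "integral {0..2*pi} (\<lambda>t. radius_part t * radius_part t) \<le> integral {0..2*pi} (\<lambda>t. (hi + lo) * radius_part t - hi * lo)"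
  proof (rule integral_le)
    fix t assume "t \<in> {0..2*pi}"
    with assms have "(hi - radius_part t) * (radius_part t - lo) \<ge> 0" by (intro mult_nonneg_nonneg) auto
    then show "radius_part t * radius_part t \<le> (hi + lo) * radius_part t - hi * lo" by (simp add: algebra_simps)
  qed (intro integrable_continuous_interval continuous_intros continuous_parts)+
  also have "\<dots> = (hi + lo) * integral {0..2*pi} radius_part - 2 * pi * (hi * lo)"
    by (subst integral_diff)
       (auto intro!: integrable_continuous_interval continuous_intros continuous_parts simp: integral_mult_right)
  finally have "pi * radius_energy q \<le> pi * (- 2 * (hi * lo))"
    unfolding integral_parts integral_radius_part by simp
  then have "radius_energy q \<le> - 2 * (hi * lo)" by (simp only: mult_le_cancel_left_pos[OF pi_gt_zero])
  moreover have "(hi - lo)\<^sup>2 = (hi + lo)\<^sup>2 - 4 * (hi * lo)" by (simp add: power2_eq_square algebra_simps)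
  ultimately show ?thesis using zero_le_power2[of "hi + lo"] by linarith
qed

end

section \<open>The stability inequality\<close>

lemma support_fun_cball:
  assumes "r \<ge> 0"
  shows "support_fun (cball x r) \<theta> = x \<bullet> unit_vec \<theta> + r"
proof -
  have u: "unit_vec \<theta> \<bullet> unit_vec \<theta> = 1" by (simp add: norm_eq_1[symmetric])
  have "support_fun (cball x r) \<theta> = (x + r *\<^sub>R unit_vec \<theta>) \<bullet> unit_vec \<theta>"
  proof (rule support_fun_eqI)
    show "x + r *\<^sub>R unit_vec \<theta> \<in> cball x r" using assms by (simp add: dist_norm)
    fix y assume "y \<in> cball x r"
    then have "norm (y - x) \<le> r" by (simp add: dist_norm norm_minus_commute)
    then have "(y - x) \<bullet> unit_vec \<theta> \<le> r"
      using norm_cauchy_schwarz[of "y - x" "unit_vec \<theta>"] by simp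
    then show "y \<bullet> unit_vec \<theta> \<le> (x + r *\<^sub>R unit_vec \<theta>) \<bullet> unit_vec \<theta>"
      by (simp add: inner_add_left inner_diff_left u)
  qed
  then show ?thesis by (simp add: inner_add_left u)
qed

lemma integral_cos_sin:
  "integral {0..2*pi} cos = 0" "integral {0..2*pi} sin = 0"
proof -
  have "(cos has_integral (sin (2*pi) - sin 0)) {0..2*pi}"
    by (rule fundamental_theorem_of_calculus)
       (auto intro!: derivative_eq_intros simp flip: has_real_derivative_iff_has_vector_derivative)
  then show "integral {0..2*pi} cos = 0" by (simp add: integral_unique)
  have "(sin has_integral ((- cos (2*pi)) - (- cos 0))) {0..2*pi}"
    by (rule fundamental_theorem_of_calculus)
       (auto intro!: derivative_eq_intros simp flip: has_real_derivative_iff_has_vector_derivative)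
  then show "integral {0..2*pi} sin = 0" by (simp add: integral_unique)
qed

lemma fourier_coeff_const_0: "fourier_coeff (\<lambda>_. c) 0 = complex_of_real (2 * c)"
  using fourier_coeff_0[of "\<lambda>_. c"] by simp

lemma fourier_coeff_first_harmonic:
  "fourier_coeff (\<lambda>t. a * cos t + b * sin t) n = (if n = 1 then Complex a (- b) else 0)"
  using fourier_coeff_harmonic[of 1 "Complex a (- b)" n] by simp

lemma fourier_coeff_const_1: "fourier_coeff (\<lambda>_. c) 1 = 0"
proof -
  have "fourier_coeff (\<lambda>_. c) 1 = (1/pi) *\<^sub>R (complex_of_real c * integral {0..2*pi} (\<lambda>t. cis (of_int (-1) * t)))"
    unfolding fourier_coeff_def by (simp add: integral_mult_right)
  then show ?thesis by (simp only: integral_cis_int) simp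
qed

context
  fixes K :: "(real^2) set"
  assumes K: "compact K" "convex K" "K \<noteq> {}"
    and smooth: "\<And>n. Ck n (support_fun K)" and pos: "\<And>\<theta>. radius_of_curvature K \<theta> > 0"
begin

abbreviation "p \<equiv> support_fun K"
abbreviation "\<rho> \<equiv> radius_of_curvature K"
text \<open>The constant term of the support function, and the radius of the Steiner disk.\<close>

definition "mean_radius = boundary_length K / (2*pi)"
abbreviation "s1 \<equiv> steiner_point K $ 1"
abbreviation "s2 \<equiv> steiner_point K $ 2"
definition "dev \<theta> = p \<theta> - (s1 * cos \<theta> + s2 * sin \<theta>) - mean_radius"

lemma radius_eq: "\<rho> = (\<lambda>\<theta>. p \<theta> + deriv (deriv p) \<theta>)"
  by (simp add: fun_eq_iff radius_of_curvature_def numeral_2_eq_2)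

lemma support_deriv:
  "(p has_real_derivative deriv p \<theta>) (at \<theta>)" "(deriv p has_real_derivative deriv (deriv p) \<theta>) (at \<theta>)"
  "(deriv (deriv p) has_real_derivative deriv (deriv (deriv p)) \<theta>) (at \<theta>)"
  using smooth[of 3] by (simp_all add: numeral_3_eq_3)

lemma continuous_support:
  "continuous_on A p" "continuous_on A (deriv p)" "continuous_on A (deriv (deriv p))"
  "continuous_on A (deriv (deriv (deriv p)))" "continuous_on A \<rho>"
proof -
  show 1: "continuous_on A p" by (rule Ck_continuous[OF smooth])
  show "continuous_on A (deriv p)" by (rule Ck_continuous[OF Ck_deriv[OF smooth]])
  show 2: "continuous_on A (deriv (deriv p))" by (rule Ck_continuous[OF Ck_deriv[OF Ck_deriv[OF smooth]]])
  show "continuous_on A (deriv (deriv (deriv p)))" by (rule Ck_continuous[OF Ck_deriv[OF Ck_deriv[OF Ck_deriv[OF smooth]]]])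
  show "continuous_on A \<rho>" unfolding radius_eq by (intro continuous_intros 1 2)
qed

lemma support_periodic: "p (\<theta> + 2*pi) = p \<theta>"
  by (simp add: support_fun_def inner_unit_vec)

lemma deriv_support_periodic: "deriv p (\<theta> + 2*pi) = deriv p \<theta>"
  by (rule deriv_periodic[where f = p, OF support_deriv(1) support_periodic])

lemma mean_radius_nonneg: "mean_radius \<ge> 0"
proof -
  have "0 \<le> integral {0..2*pi} \<rho>"
    by (intro Henstock_Kurzweil_Integration.integral_nonneg integrable_continuous_interval
        continuous_support less_imp_le[OF pos])
  then show ?thesis by (simp add: mean_radius_def boundary_length_def)
qed

lemma Ck_dev: "Ck n dev"
  unfolding dev_def[abs_def] by (intro Ck_diff Ck_add Ck_mult Ck_const Ck_cos_sin smooth)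

lemma dev_periodic: "dev (t + 2*pi) = dev t"
  by (simp add: dev_def support_periodic)

text \<open>Hence \<open>L = \<integral>p\<close> (Cauchy's formula), which makes the mean of \<open>dev\<close> vanish.\<close>

lemma integral_radius_eq: "integral {0..2*pi} \<rho> = integral {0..2*pi} p"
proof -
  have "(deriv (deriv p) has_integral deriv p (2*pi) - deriv p 0) {0..2*pi}"
    using support_deriv(2)
    by (intro fundamental_theorem_of_calculus)
       (auto simp flip: has_real_derivative_iff_has_vector_derivative intro: has_field_derivative_at_within)
  then have "integral {0..2*pi} (deriv (deriv p)) = 0"
    using deriv_support_periodic[of 0] by (simp add: integral_unique)
  then show ?thesis unfolding radius_eq
    by (subst integral_add) (auto intro!: integrable_continuous_interval continuous_support)
qed

lemma fourier_coeff_support_1: "fourier_coeff p 1 = Complex s1 (- s2)"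
proof -
  have int: "(\<lambda>\<theta>. p \<theta> *\<^sub>R unit_vec \<theta>) integrable_on {0..2*pi}"
    by (intro integrable_continuous_interval continuous_on_scaleR continuous_support continuous_on_unit_vec)
  have "s1 = integral {0..2*pi} (\<lambda>\<theta>. p \<theta> * cos \<theta>) / pi" "s2 = integral {0..2*pi} (\<lambda>\<theta>. p \<theta> * sin \<theta>) / pi"
    using integral_component_eq_cart[OF int, of 1] integral_component_eq_cart[OF int, of 2]
    by (simp_all add: steiner_point_def)
  then show ?thesis
    unfolding fourier_coeff_1[OF continuous_support(1)] by (simp add: complex_eq_iff)
qed

lemma dev_low: "fourier_coeff dev 0 = 0" "fourier_coeff dev 1 = 0"
proof -
  have h: "continuous_on {0..2*pi} (\<lambda>\<theta>. s1 * cos \<theta> + s2 * sin \<theta>)" by (intro continuous_intros)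
  have eq: "fourier_coeff dev n = fourier_coeff p n - fourier_coeff (\<lambda>\<theta>. s1 * cos \<theta> + s2 * sin \<theta>) n
      - fourier_coeff (\<lambda>_. mean_radius) n" for n
    unfolding dev_def[abs_def]
    using fourier_coeff_diff[of "\<lambda>\<theta>. p \<theta> - (s1 * cos \<theta> + s2 * sin \<theta>)" "\<lambda>_. mean_radius" n]
      fourier_coeff_diff[OF continuous_support(1) h, of n]
      continuous_on_diff[OF continuous_support(1) h] by simp
  show "fourier_coeff dev 0 = 0"
    unfolding eq fourier_coeff_first_harmonic fourier_coeff_const_0 fourier_coeff_0[OF continuous_support(1)]
    by (simp add: mean_radius_def boundary_length_def integral_radius_eq)
  show "fourier_coeff dev 1 = 0"
    unfolding eq fourier_coeff_first_harmonic fourier_coeff_const_1 fourier_coeff_support_1 by simp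
qed

lemma deriv_dev:
  "deriv dev = (\<lambda>\<theta>. deriv p \<theta> - (s2 * cos \<theta> - s1 * sin \<theta>))"
  "deriv (deriv dev) = (\<lambda>\<theta>. deriv (deriv p) \<theta> + (s1 * cos \<theta> + s2 * sin \<theta>))"
  "deriv (deriv (deriv dev)) = (\<lambda>\<theta>. deriv (deriv (deriv p)) \<theta> + (s2 * cos \<theta> - s1 * sin \<theta>))"
proof -
  show 1: "deriv dev = (\<lambda>\<theta>. deriv p \<theta> - (s2 * cos \<theta> - s1 * sin \<theta>))"
    unfolding dev_def[abs_def]
    by (intro ext DERIV_imp_deriv) (auto intro!: derivative_eq_intros support_deriv)
  show 2: "deriv (deriv dev) = (\<lambda>\<theta>. deriv (deriv p) \<theta> + (s1 * cos \<theta> + s2 * sin \<theta>))"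
    unfolding 1
    by (intro ext DERIV_imp_deriv) (auto intro!: derivative_eq_intros support_deriv)
  show "deriv (deriv (deriv dev)) = (\<lambda>\<theta>. deriv (deriv (deriv p)) \<theta> + (s2 * cos \<theta> - s1 * sin \<theta>))"
    unfolding 2
    by (intro ext DERIV_imp_deriv) (auto intro!: derivative_eq_intros support_deriv)
qed

abbreviation "dev_radius \<theta> \<equiv> dev \<theta> + deriv (deriv dev) \<theta>"
abbreviation "dev_radius' \<theta> \<equiv> deriv dev \<theta> + deriv (deriv (deriv dev)) \<theta>"

lemma radius_via_dev: "\<rho> \<theta> = mean_radius + dev_radius \<theta>"
  unfolding deriv_dev(2) by (simp add: radius_eq dev_def)

lemma evolute_radius_via_dev: "evolute_radius_of_curvature K \<theta> = \<bar>dev_radius' \<theta>\<bar>"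
  unfolding deriv_dev(3) unfolding deriv_dev(1) by (simp add: evolute_radius_of_curvature_def numeral_3_eq_3)

lemmas dev_facts = Ck_dev dev_periodic dev_low

lemma continuous_dev_radius: "continuous_on A dev_radius" "continuous_on A dev_radius'"
  by (intro continuous_intros continuous_parts[OF dev_facts])+

lemma integral_dev_radius: "integral {0..2*pi} dev_radius = 0" "integral {0..2*pi} dev = 0"
  "integral {0..2*pi} (\<lambda>t. dev_radius t * cos t) = 0" "integral {0..2*pi} (\<lambda>t. dev_radius t * sin t) = 0"
  "integral {0..2*pi} (\<lambda>t. dev_radius' t * cos t) = 0" "integral {0..2*pi} (\<lambda>t. dev_radius' t * sin t) = 0"
proof -
  show "integral {0..2*pi} dev_radius = 0" by (rule integral_radius_part[OF dev_facts])
  show "integral {0..2*pi} dev = 0"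
    using fourier_coeff_0[OF continuous_parts(1)[OF dev_facts]] dev_low by simp
  show "integral {0..2*pi} (\<lambda>t. dev_radius t * cos t) = 0" "integral {0..2*pi} (\<lambda>t. dev_radius t * sin t) = 0"
    "integral {0..2*pi} (\<lambda>t. dev_radius' t * cos t) = 0" "integral {0..2*pi} (\<lambda>t. dev_radius' t * sin t) = 0"
    unfolding fourier_coeff_1[OF continuous_dev_radius(1)] fourier_coeff_1[OF continuous_dev_radius(2)]
      fourier_coeff_parts_low[OF dev_facts] by simp_all
qed

lemma length_via_dev: "boundary_length K = 2 * pi * mean_radius"
  by (simp add: mean_radius_def)

lemma integral_radius_square:
  "integral {0..2*pi} (\<lambda>\<theta>. (\<rho> \<theta>)\<^sup>2) = 2 * pi * mean_radius\<^sup>2 + pi * radius_energy dev"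
proof -
  have "((\<lambda>\<theta>. mean_radius\<^sup>2 + 2 * mean_radius * dev_radius \<theta> + dev_radius \<theta> * dev_radius \<theta>) has_integral
      mean_radius\<^sup>2 * (2*pi) + 2 * mean_radius * integral {0..2*pi} dev_radius + integral {0..2*pi} (\<lambda>\<theta>. dev_radius \<theta> * dev_radius \<theta>)) {0..2*pi}"
    by (intro has_integral_add has_integral_mult_right integrable_integral integrable_continuous_interval continuous_intros continuous_dev_radius)
       (use has_integral_const_real[of "mean_radius\<^sup>2" 0 "2*pi"] in \<open>simp add: mult.commute\<close>)
  then have "((\<lambda>\<theta>. mean_radius\<^sup>2 + 2 * mean_radius * dev_radius \<theta> + dev_radius \<theta> * dev_radius \<theta>) has_integral
      mean_radius\<^sup>2 * (2*pi) + pi * radius_energy dev) {0..2*pi}"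
    unfolding integral_dev_radius integral_parts(2)[OF dev_facts] by simp
  moreover have "mean_radius\<^sup>2 + 2 * mean_radius * dev_radius \<theta> + dev_radius \<theta> * dev_radius \<theta> = (\<rho> \<theta>)\<^sup>2" for \<theta>
    unfolding radius_via_dev by (simp add: power2_eq_square algebra_simps)
  ultimately show ?thesis by (simp add: integral_unique mult.commute)
qed

text \<open>Integration by parts turns the area into \<open>1/2 \<integral> p \<rho>\<close>. In \<open>p = a + (first harmonic) + dev\<close> and
  \<open>\<rho> = a + dev_radius\<close> all mixed products integrate to zero, since \<open>dev_radius\<close> has no frequencies below 2.\<close>

lemma area_via_dev: "area K = pi * mean_radius\<^sup>2 - pi / 2 * deficit dev"
proof -
  let ?l = "\<lambda>\<theta>. s1 * cos \<theta> + s2 * sin \<theta>"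
  have "((\<lambda>\<theta>. p \<theta> * \<rho> \<theta> - ((p \<theta>)\<^sup>2 - (deriv p \<theta>)\<^sup>2)) has_integral (p (2*pi) * deriv p (2*pi) - p 0 * deriv p 0)) {0..2*pi}"
  proof (rule fundamental_theorem_of_calculus)
    fix \<theta> :: real
    have "((\<lambda>\<theta>. p \<theta> * deriv p \<theta>) has_real_derivative p \<theta> * \<rho> \<theta> - ((p \<theta>)\<^sup>2 - (deriv p \<theta>)\<^sup>2)) (at \<theta>)"
      by (rule DERIV_cong[OF DERIV_mult[OF support_deriv(1,2)]]) (simp add: radius_eq power2_eq_square algebra_simps)
    then show "((\<lambda>\<theta>. p \<theta> * deriv p \<theta>) has_vector_derivative p \<theta> * \<rho> \<theta> - ((p \<theta>)\<^sup>2 - (deriv p \<theta>)\<^sup>2)) (at \<theta> within {0..2*pi})"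
      by (simp add: has_real_derivative_iff_has_vector_derivative has_vector_derivative_at_within)
  qed simp
  then have "integral {0..2*pi} (\<lambda>\<theta>. p \<theta> * \<rho> \<theta> - ((p \<theta>)\<^sup>2 - (deriv p \<theta>)\<^sup>2)) = 0"
    using support_periodic[of 0] deriv_support_periodic[of 0] by (simp add: integral_unique)
  then have "integral {0..2*pi} (\<lambda>\<theta>. (p \<theta>)\<^sup>2 - (deriv p \<theta>)\<^sup>2) = integral {0..2*pi} (\<lambda>\<theta>. p \<theta> * \<rho> \<theta>)"
    by (subst (asm) integral_diff)
       (auto intro!: integrable_continuous_interval continuous_intros continuous_support)
  also have "\<dots> = 2 * pi * mean_radius\<^sup>2 - pi * deficit dev"
  proof -
    have "((\<lambda>\<theta>. mean_radius\<^sup>2 + mean_radius * dev_radius \<theta> + mean_radius * (s1 * cos \<theta>) + mean_radius * (s2 * sin \<theta>)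
         + s1 * (dev_radius \<theta> * cos \<theta>) + s2 * (dev_radius \<theta> * sin \<theta>) + mean_radius * dev \<theta> + dev \<theta> * dev_radius \<theta>) has_integral
       mean_radius\<^sup>2 * (2*pi) + mean_radius * integral {0..2*pi} dev_radius
         + mean_radius * (s1 * integral {0..2*pi} cos) + mean_radius * (s2 * integral {0..2*pi} sin)
         + s1 * integral {0..2*pi} (\<lambda>t. dev_radius t * cos t) + s2 * integral {0..2*pi} (\<lambda>t. dev_radius t * sin t)
         + mean_radius * integral {0..2*pi} dev + integral {0..2*pi} (\<lambda>t. dev t * dev_radius t)) {0..2*pi}"
      by (intro has_integral_add has_integral_mult_right integrable_integral integrable_continuous_interval
            continuous_intros continuous_dev_radius continuous_parts(1)[OF dev_facts])
         (use has_integral_const_real[of "mean_radius\<^sup>2" 0 "2*pi"] in \<open>simp add: mult.commute\<close>)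
    then have "((\<lambda>\<theta>. mean_radius\<^sup>2 + mean_radius * dev_radius \<theta> + mean_radius * (s1 * cos \<theta>) + mean_radius * (s2 * sin \<theta>)
         + s1 * (dev_radius \<theta> * cos \<theta>) + s2 * (dev_radius \<theta> * sin \<theta>) + mean_radius * dev \<theta> + dev \<theta> * dev_radius \<theta>) has_integral
         2 * pi * mean_radius\<^sup>2 - pi * deficit dev) {0..2*pi}"
      unfolding integral_dev_radius integral_cos_sin integral_parts(1)[OF dev_facts] by (simp add: mult.commute)
    moreover have "mean_radius\<^sup>2 + mean_radius * dev_radius \<theta> + mean_radius * (s1 * cos \<theta>) + mean_radius * (s2 * sin \<theta>)
         + s1 * (dev_radius \<theta> * cos \<theta>) + s2 * (dev_radius \<theta> * sin \<theta>) + mean_radius * dev \<theta> + dev \<theta> * dev_radius \<theta> = p \<theta> * \<rho> \<theta>" for \<theta>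
    proof -
      have "p \<theta> = mean_radius + ?l \<theta> + dev \<theta>" by (simp add: dev_def)
      then show ?thesis unfolding radius_via_dev by (simp only: power2_eq_square) (simp only: algebra_simps)
    qed
    ultimately show ?thesis by (simp add: integral_unique)
  qed
  finally show ?thesis by (simp add: area_def)
qed

text \<open>The evolute is \<open>p' u' - p'' u\<close> with derivative \<open>- (p' + p''') u\<close>, so the line integral is
  \<open>\<integral> p' (p' + p''')\<close>. The first harmonic of \<open>p'\<close> is orthogonal to the second factor.\<close>

lemma evolute_area_via_dev: "evolute_area K = - pi / 2 * (radius_energy dev + deficit dev)"
proof -
  have comp: "evolute K \<theta> $ 1 = - deriv p \<theta> * sin \<theta> - deriv (deriv p) \<theta> * cos \<theta>"
    "evolute K \<theta> $ 2 = deriv p \<theta> * cos \<theta> - deriv (deriv p) \<theta> * sin \<theta>" for \<theta>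
    by (simp_all add: evolute_def boundary_curve_def radius_eq algebra_simps)
  let ?d = "\<lambda>\<theta>. deriv p \<theta> + deriv (deriv (deriv p)) \<theta>"
  have d: "deriv (\<lambda>t. evolute K t $ 1) \<theta> = - ?d \<theta> * cos \<theta>" "deriv (\<lambda>t. evolute K t $ 2) \<theta> = - ?d \<theta> * sin \<theta>" for \<theta>
    unfolding comp
    by (intro DERIV_imp_deriv; auto intro!: derivative_eq_intros support_deriv simp: algebra_simps)+
  have gd: "?d \<theta> = dev_radius' \<theta>" for \<theta>
    unfolding deriv_dev(3) unfolding deriv_dev(1) by simp
  have integrand: "evolute K \<theta> $ 1 * deriv (\<lambda>t. evolute K t $ 2) \<theta> - evolute K \<theta> $ 2 * deriv (\<lambda>t. evolute K t $ 1) \<theta>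
     = deriv dev \<theta> * dev_radius' \<theta> + s2 * (dev_radius' \<theta> * cos \<theta>) + (- s1) * (dev_radius' \<theta> * sin \<theta>)" for \<theta>
  proof -
    have "evolute K \<theta> $ 1 * deriv (\<lambda>t. evolute K t $ 2) \<theta> - evolute K \<theta> $ 2 * deriv (\<lambda>t. evolute K t $ 1) \<theta>
       = deriv p \<theta> * ((cos \<theta>)\<^sup>2 + (sin \<theta>)\<^sup>2) * dev_radius' \<theta>"
      unfolding d unfolding comp gd by algebra
    also have "\<dots> = (deriv dev \<theta> + (s2 * cos \<theta> - s1 * sin \<theta>)) * dev_radius' \<theta>"
      by (simp only: sin_cos_squared_add2 mult_1_right) (simp add: deriv_dev(1))
    finally show ?thesis by (simp only: algebra_simps)
  qed
  have "((\<lambda>\<theta>. deriv dev \<theta> * dev_radius' \<theta> + s2 * (dev_radius' \<theta> * cos \<theta>) + (- s1) * (dev_radius' \<theta> * sin \<theta>)) has_integral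
     integral {0..2*pi} (\<lambda>\<theta>. deriv dev \<theta> * dev_radius' \<theta>) + s2 * integral {0..2*pi} (\<lambda>t. dev_radius' t * cos t) + (- s1) * integral {0..2*pi} (\<lambda>t. dev_radius' t * sin t)) {0..2*pi}"
    by (intro has_integral_add has_integral_mult_right integrable_integral integrable_continuous_interval
            continuous_intros continuous_dev_radius continuous_parts(2)[OF dev_facts])
  then have "integral {0..2*pi} (\<lambda>\<theta>. deriv dev \<theta> * dev_radius' \<theta> + s2 * (dev_radius' \<theta> * cos \<theta>) + (- s1) * (dev_radius' \<theta> * sin \<theta>)) = - pi * (radius_energy dev + deficit dev)"
    unfolding integral_dev_radius integral_parts(3)[OF dev_facts] by (simp add: integral_unique)
  then show ?thesis unfolding evolute_area_def integrand by simp
qed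

lemma integral_evolute_radius_square:
  "integral {0..2*pi} (\<lambda>\<theta>. (evolute_radius_of_curvature K \<theta>)\<^sup>2) = pi * evolute_energy dev"
  using integral_parts(4)[OF dev_facts] by (simp add: evolute_radius_via_dev power2_eq_square)

lemma steiner_deviation_bound:
  "0 \<le> steiner_deviation K" "(steiner_deviation K)\<^sup>2 \<le> 3/4 * deficit dev"
proof -
  have sup: "steiner_deviation K = (SUP \<theta>\<in>{0..2*pi}. \<bar>dev \<theta>\<bar>)"
    unfolding steiner_deviation_def steiner_disk_def mean_radius_def[symmetric]
      support_fun_cball[OF mean_radius_nonneg] by (simp add: inner_unit_vec dev_def algebra_simps)
  have le: "\<bar>dev \<theta>\<bar> \<le> sqrt (3/4 * deficit dev)" if "\<theta> \<in> {0..2*pi}" for \<theta>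
    using square_le_deficit[OF continuous_parts(1)[OF dev_facts] periodic_parts(1)[OF dev_facts] dev_low
        summable_coeff[OF dev_facts] energies_sums(1)[OF dev_facts] that]
    by (metis real_sqrt_abs real_sqrt_le_mono)
  have "steiner_deviation K \<le> sqrt (3/4 * deficit dev)"
    unfolding sup by (rule cSUP_least) (use le in auto)
  moreover have "\<bar>dev 0\<bar> \<le> steiner_deviation K"
    unfolding sup by (intro cSUP_upper bdd_aboveI2[OF le]) auto
  then show "0 \<le> steiner_deviation K" by simp
  ultimately have "(steiner_deviation K)\<^sup>2 \<le> (sqrt (3/4 * deficit dev))\<^sup>2" by (intro power_mono)
  then show "(steiner_deviation K)\<^sup>2 \<le> 3/4 * deficit dev"
    using deficit_nonneg[OF dev_facts] by simp
qed

text \<open>Bonnesen's inequality. Balanced means of \<open>p\<close> and of \<open>dev\<close> differ by the constant \<open>mean_radius\<close>, which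
  cancels in the difference.\<close>

lemma radii_difference_bound: "(circumradius K - inradius K)\<^sup>2 \<le> 2 * deficit dev"
proof -
  obtain I w x J v y where b: "balanced I w x" "balanced J v y"
    and le: "circumradius K \<le> (\<Sum>i\<in>I. w i * p (x i))" "(\<Sum>j\<in>J. v j * p (y j)) \<le> inradius K"
    by (rule radii_as_balanced_means[OF K continuous_support(1)])
  have mean: "(\<Sum>i\<in>I. w i * p (x i)) = mean_radius + (\<Sum>i\<in>I. w i * dev (x i))" if "balanced I w x" for I w x
  proof -
    have "(\<Sum>i\<in>I. w i * cos (x i)) = 0" "(\<Sum>i\<in>I. w i * sin (x i)) = 0" and one: "(\<Sum>i\<in>I. w i) = 1"
      using that by (simp_all add: balanced_def complex_eq_iff Re_sum Im_sum)
    moreover have "(\<Sum>i\<in>I. w i * p (x i)) = mean_radius * (\<Sum>i\<in>I. w i) + s1 * (\<Sum>i\<in>I. w i * cos (x i))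
        + s2 * (\<Sum>i\<in>I. w i * sin (x i)) + (\<Sum>i\<in>I. w i * dev (x i))"
      unfolding sum_distrib_left sum.distrib[symmetric]
      by (intro sum.cong refl) (simp add: dev_def algebra_simps)
    ultimately show ?thesis by simp
  qed
  have "0 \<le> circumradius K - inradius K" using inradius_le_circumradius[OF K] by simp
  moreover have "circumradius K - inradius K \<le> (\<Sum>i\<in>I. w i * dev (x i)) - (\<Sum>j\<in>J. v j * dev (y j))"
    using le unfolding mean[OF b(1)] mean[OF b(2)] by simp
  ultimately have "(circumradius K - inradius K)\<^sup>2 \<le> ((\<Sum>i\<in>I. w i * dev (x i)) - (\<Sum>j\<in>J. v j * dev (y j)))\<^sup>2"
    by (intro power_mono)
  also have "\<dots> \<le> 2 * deficit dev"
    by (rule balanced_mean_difference_le_deficit[OF continuous_parts(1)[OF dev_facts] periodic_parts(1)[OF dev_facts] dev_low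
        summable_coeff[OF dev_facts] energies_sums(1)[OF dev_facts] b])
  finally show ?thesis .
qed

lemma radius_oscillation_bound:
  "2 * radius_energy dev \<le> (max_radius_of_curvature K - min_radius_of_curvature K)\<^sup>2"
proof -
  have cpt: "compact (\<rho> ` {0..2*pi})"
    by (intro compact_continuous_image continuous_support compact_Icc)
  then have bdd: "bdd_above (\<rho> ` {0..2*pi})" "bdd_below (\<rho> ` {0..2*pi})"
    by (auto intro: bounded_imp_bdd_above bounded_imp_bdd_below compact_imp_bounded)
  have "2 * radius_energy dev \<le> ((max_radius_of_curvature K - mean_radius) - (min_radius_of_curvature K - mean_radius))\<^sup>2"
  proof (rule radius_energy_le_oscillation[OF dev_facts])
    fix t assume "t \<in> {0..2*pi}"
    then have "\<rho> t \<le> max_radius_of_curvature K" "min_radius_of_curvature K \<le> \<rho> t"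
      unfolding max_radius_of_curvature_def min_radius_of_curvature_def
      using bdd by (auto intro: cSUP_upper cINF_lower)
    then show "min_radius_of_curvature K - mean_radius \<le> dev_radius t \<and> dev_radius t \<le> max_radius_of_curvature K - mean_radius"
      unfolding radius_via_dev by simp
  qed
  then show ?thesis by simp
qed

lemma curvature_energy_nonneg: "0 \<le> curvature_energy K"
  unfolding curvature_energy_def curvature_def
proof (rule Henstock_Kurzweil_Integration.integral_nonneg)
  show "(\<lambda>\<theta>. (1 / \<rho> \<theta>)\<^sup>2 * \<rho> \<theta>) integrable_on {0..2*pi}"
    by (intro integrable_continuous_interval continuous_intros continuous_support)
       (use pos in \<open>simp add: less_imp_neq[symmetric]\<close>)
qed (use pos in \<open>simp add: less_imp_le\<close>)

lemma deviation_le_W: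
  assumes "\<eta> \<ge> 0" "\<xi> \<ge> 0" "\<zeta> \<ge> 0" "lam \<le> 0"
    and c1: "2*\<alpha> + 4*pi*\<delta> + \<mu> - 4*\<zeta> \<ge> 0" and c2: "2*\<alpha> + \<sigma> - 2*\<eta> - 4*\<zeta> \<ge> 0"
    and E: "E_const \<alpha> \<mu> \<sigma> \<eta> lam \<xi> \<zeta> > 0"
  shows "(steiner_deviation K)\<^sup>2 \<le> C_const \<alpha> \<mu> \<sigma> \<eta> lam \<xi> \<zeta> * W K \<alpha> \<delta> \<mu> \<sigma> \<eta> lam \<xi> \<zeta>"
proof -
  define a S R V where "a = mean_radius\<^sup>2" and "S = deficit dev" and "R = radius_energy dev" and "V = evolute_energy dev"
  let ?E = "E_const \<alpha> \<mu> \<sigma> \<eta> lam \<xi> \<zeta>" and ?W = "W K \<alpha> \<delta> \<mu> \<sigma> \<eta> lam \<xi> \<zeta>"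
  have S: "0 \<le> S" "3 * S \<le> R" "4 * R \<le> V"
    unfolding S_def R_def V_def
    by (rule deficit_nonneg[OF dev_facts] deficit_le_radius_energy[OF dev_facts] radius_energy_le_evolute_energy[OF dev_facts])+
  define d osc \<kappa> where "d = (circumradius K - inradius K)\<^sup>2"
    and "osc = (max_radius_of_curvature K - min_radius_of_curvature K)\<^sup>2" and "\<kappa> = curvature_energy K"
  have "\<bar>evolute_area K\<bar> = pi / 2 * (R + S)"
    unfolding evolute_area_via_dev using S by (simp add: R_def S_def abs_mult)
  then have W: "?W = \<alpha> * (2 * pi * a + pi * R) + \<delta> * (4 * pi\<^sup>2 * a) + \<mu> * (pi * a - pi / 2 * S)
      + \<sigma> * (pi / 2 * (R + S)) + \<eta> * (pi * V) + lam * d + \<xi> * osc + \<zeta> * \<kappa>"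
    unfolding W_def integral_radius_square length_via_dev area_via_dev integral_evolute_radius_square
      a_def S_def R_def V_def d_def osc_def \<kappa>_def
    by (simp add: power_mult_distrib)
  \<comment> \<open>The sign conditions enter term by term; the energy of \<open>\<rho>\<close> is added and subtracted to replace \<open>\<alpha>\<close> by \<open>\<alpha> - 2 \<zeta>\<close>.\<close>
  have "?W - ?E / 2 * S = lam * (d - 2 * S) + \<xi> * (osc - 2 * S) + \<zeta> * \<kappa> + \<zeta> * (2 * (2 * pi * a + pi * R))
     + pi * a * (2*\<alpha> + 4*pi*\<delta> + \<mu> - 4*\<zeta>) + pi / 2 * (2*\<alpha> + \<sigma> - 4*\<zeta>) * (R - 3 * S) + pi * \<eta> * (V - 12 * S)"
    unfolding W E_const_def by (simp add: field_simps power2_eq_square)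
  also have "\<dots> \<ge> 0"
  proof (intro add_nonneg_nonneg)
    show "0 \<le> lam * (d - 2 * S)"
      using radii_difference_bound assms(4) unfolding d_def S_def by (intro mult_nonpos_nonpos) auto
    show "0 \<le> \<xi> * (osc - 2 * S)"
      using radius_oscillation_bound S assms(2) unfolding osc_def R_def by (intro mult_nonneg_nonneg) auto
    show "0 \<le> \<zeta> * \<kappa>" using assms(3) curvature_energy_nonneg by (simp add: \<kappa>_def)
    show "0 \<le> \<zeta> * (2 * (2 * pi * a + pi * R))" using assms(3) S by (simp add: a_def)
    show "0 \<le> pi * a * (2*\<alpha> + 4*pi*\<delta> + \<mu> - 4*\<zeta>)" using c1 by (intro mult_nonneg_nonneg) (auto simp: a_def)
    show "0 \<le> pi / 2 * (2*\<alpha> + \<sigma> - 4*\<zeta>) * (R - 3 * S)"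
      using c2 assms(1) S by (intro mult_nonneg_nonneg) auto
    show "0 \<le> pi * \<eta> * (V - 12 * S)" using assms(1) S by (intro mult_nonneg_nonneg) auto
  qed
  finally have "?E / 2 * S \<le> ?W" by simp
  moreover have "0 \<le> ?E / 2 * S" using E S by simp
  ultimately have "0 \<le> ?W" by linarith
  have "(steiner_deviation K)\<^sup>2 \<le> 3/4 * S" using steiner_deviation_bound(2) by (simp add: S_def)
  also have "\<dots> = 3 / (2 * ?E) * (?E / 2 * S)" using E by (simp add: field_simps)
  also have "\<dots> \<le> 3 / (2 * ?E) * ?W" using E \<open>?E / 2 * S \<le> ?W\<close> by (intro mult_left_mono) auto
  also have "\<dots> \<le> C_const \<alpha> \<mu> \<sigma> \<eta> lam \<xi> \<zeta> * ?W"
    unfolding C_const_def using \<open>0 \<le> ?W\<close> by (intro mult_right_mono) auto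
  finally show ?thesis .
qed

text \<open>The radius of curvature is constant, so \<open>dev_radius\<close> and its derivative vanish. Hence both higher
  energies are 0, and so is the deficit, which is at most a third of the radius energy.\<close>

lemma disk_equality:
  assumes disk: "K = cball c r" "r > 0" and c1: "2*\<alpha> + 4*pi*\<delta> + \<mu> = 0"
  shows "steiner_deviation K = 0" "W K \<alpha> \<delta> \<mu> \<sigma> \<eta> lam \<xi> 0 = 0"
proof -
  have p: "p = (\<lambda>\<theta>. c $ 1 * cos \<theta> + c $ 2 * sin \<theta> + r)"
    unfolding disk(1) using disk(2) by (simp add: fun_eq_iff support_fun_cball inner_unit_vec)
  have "deriv p = (\<lambda>\<theta>. c $ 2 * cos \<theta> - c $ 1 * sin \<theta>)"
    unfolding p by (intro ext DERIV_imp_deriv) (auto intro!: derivative_eq_intros)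
  then have "deriv (deriv p) = (\<lambda>\<theta>. - (c $ 1 * cos \<theta> + c $ 2 * sin \<theta>))"
    by (simp, intro ext DERIV_imp_deriv) (auto intro!: derivative_eq_intros)
  then have \<rho>: "\<rho> \<theta> = r" for \<theta> by (simp add: radius_eq) (simp add: p)
  then have "\<rho> = (\<lambda>_. r)" by (rule ext)
  then have "mean_radius = r" by (simp add: mean_radius_def boundary_length_def)
  then have dev_radius: "dev_radius \<theta> = 0" for \<theta> using radius_via_dev[of \<theta>] \<rho>[of \<theta>] by simp
  have "dev_radius' \<theta> = 0" for \<theta>
  proof -
    have "(dev_radius has_real_derivative dev_radius' \<theta>) (at \<theta>)"
      using Ck_has_deriv[OF Ck_dev] Ck_has_deriv[OF Ck_deriv[OF Ck_deriv[OF Ck_dev]]] by (rule DERIV_add)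
    then show ?thesis unfolding dev_radius by (rule DERIV_unique) simp
  qed
  then have V: "evolute_energy dev = 0" using integral_parts(4)[OF dev_facts] by simp
  have R: "radius_energy dev = 0" using integral_parts(2)[OF dev_facts] by (simp add: dev_radius)
  have S: "deficit dev = 0"
    using deficit_nonneg[OF dev_facts] deficit_le_radius_energy[OF dev_facts] R by simp
  show "steiner_deviation K = 0" using steiner_deviation_bound(2) by (simp add: S)
  have "circumradius K - inradius K = 0" using radii_difference_bound by (simp add: S)
  moreover have "max_radius_of_curvature K - min_radius_of_curvature K = 0"
    by (simp add: max_radius_of_curvature_def min_radius_of_curvature_def \<rho>)
  ultimately have "W K \<alpha> \<delta> \<mu> \<sigma> \<eta> lam \<xi> 0 = pi * mean_radius\<^sup>2 * (2*\<alpha> + 4*pi*\<delta> + \<mu>)"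
    unfolding W_def integral_radius_square length_via_dev area_via_dev evolute_area_via_dev integral_evolute_radius_square S R V
    by (simp add: power2_eq_square algebra_simps)
  then show "W K \<alpha> \<delta> \<mu> \<sigma> \<eta> lam \<xi> 0 = 0" by (simp add: c1)
qed

end

theorem theorem1p2:
  fixes K :: "(real^2) set" and c :: "real \<Rightarrow> real^2" and T :: real
    and \<alpha> \<delta> \<mu> \<sigma> \<eta> lam \<xi> \<zeta> :: real
  assumes "compact K" and "interior K \<noteq> {}" and "strictly_convex K"
    and "smooth_closed_curve c T" and "frontier K = c ` {0..T}"
    and "\<And>t. curve_curvature c t > 0"
  shows
    "(\<eta> \<ge> 0 \<and> \<xi> \<ge> 0 \<and> \<zeta> \<ge> 0 \<and> lam \<le> 0
        \<and> 2*\<alpha> + 4*pi*\<delta> + \<mu> - 4*\<zeta> \<ge> 0 \<and> 2*\<alpha> + \<sigma> - 2*\<eta> - 4*\<zeta> \<ge> 0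
        \<and> E_const \<alpha> \<mu> \<sigma> \<eta> lam \<xi> \<zeta> > 0
      \<longrightarrow> (steiner_deviation K)\<^sup>2
            \<le> C_const \<alpha> \<mu> \<sigma> \<eta> lam \<xi> \<zeta> * W K \<alpha> \<delta> \<mu> \<sigma> \<eta> lam \<xi> \<zeta>)
     \<and> ((\<exists>a r. r > 0 \<and> K = cball a r)
        \<and> 2*\<alpha> + 4*pi*\<delta> + \<mu> = 0 \<and> \<zeta> = 0 \<and> E_const \<alpha> \<mu> \<sigma> \<eta> lam \<xi> \<zeta> \<noteq> 0
      \<longrightarrow> (steiner_deviation K)\<^sup>2
            = C_const \<alpha> \<mu> \<sigma> \<eta> lam \<xi> \<zeta> * W K \<alpha> \<delta> \<mu> \<sigma> \<eta> lam \<xi> \<zeta>)"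
proof -
  have "convex K" by (rule strictly_convex_imp_convex) fact
  moreover have "K \<noteq> {}" using assms(2) by auto
  ultimately have K: "compact K" "convex K" "K \<noteq> {}" "\<And>n. Ck n (support_fun K)" "\<And>\<theta>. radius_of_curvature K \<theta> > 0"
    using assms(1) support_fun_smooth[OF assms] radius_of_curvature_pos[OF assms] by auto
  show ?thesis
  proof (intro conjI impI)
    assume "\<eta> \<ge> 0 \<and> \<xi> \<ge> 0 \<and> \<zeta> \<ge> 0 \<and> lam \<le> 0
        \<and> 2*\<alpha> + 4*pi*\<delta> + \<mu> - 4*\<zeta> \<ge> 0 \<and> 2*\<alpha> + \<sigma> - 2*\<eta> - 4*\<zeta> \<ge> 0
        \<and> E_const \<alpha> \<mu> \<sigma> \<eta> lam \<xi> \<zeta> > 0"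
    then show "(steiner_deviation K)\<^sup>2
            \<le> C_const \<alpha> \<mu> \<sigma> \<eta> lam \<xi> \<zeta> * W K \<alpha> \<delta> \<mu> \<sigma> \<eta> lam \<xi> \<zeta>"
      by (intro deviation_le_W[OF K]) simp_all
  next
    assume a: "(\<exists>a r. r > 0 \<and> K = cball a r)
        \<and> 2*\<alpha> + 4*pi*\<delta> + \<mu> = 0 \<and> \<zeta> = 0 \<and> E_const \<alpha> \<mu> \<sigma> \<eta> lam \<xi> \<zeta> \<noteq> 0"
    then obtain x r where disk: "K = cball x r" "r > 0" by blast
    have "2*\<alpha> + 4*pi*\<delta> + \<mu> = 0" "\<zeta> = 0" using a by simp_all
    with disk_equality[OF K disk] show "(steiner_deviation K)\<^sup>2
            = C_const \<alpha> \<mu> \<sigma> \<eta> lam \<xi> \<zeta> * W K \<alpha> \<delta> \<mu> \<sigma> \<eta> lam \<xi> \<zeta>"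
      by simp
  qed
qed

end
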